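(* Consider the control system $$\dot x_1=u_1\cos y_1,\quad \dot x_2=u_1\sin y_1,\quad \dot y=u_1h_1(y)+u_2h_2(y)\qquad(\ast)$$ and suppose the following. A. $\mathcal{M}=\mathbb{R}^2\times\mathcal{O}$, where $\mathcal{O}\subset\mathcal{Y}$ is an open submanifold split as $\mathcal{O}=\mathbb{R}\times\check{\mathcal{O}}$ (the coordinate on the first factor being $y_1$); for all $y\in\mathcal{O}$ one has $L_{h_2}L_{h_1}^iy_1=0$ for $i=0,\ldots,n-2$ and $L_{h_2}L_{h_1}^{n-1}y_1\ne0$; the map $S(y)=\mathrm{col}(L_{h_1}^0y_1,\ldots,L_{h_1}^{n-1}y_1)$ maps $\mathcal{O}$ bijectively onto $\mathbb{R}^n$; and $M$ is a maneuvering operator of $(\ast)$ on $\mathcal{M}$. B. The metric $d$ on $\mathcal{O}=\mathbb{R}\times\check{\mathcal{O}}$ is $d(y,y')=|y_1-y_1'|+\check d(\check y,\check y')$, where $y=\mathrm{col}(y_1,\check y)$, $y'=\mathrm{col}(y_1',\check y')$, $y_1,y_1'\in\mathbb{R}$, $\check y,\check y'\in\check{\mathcal{O}}$, and $\check d$ is a metric on the manifold $\check{\mathcal{O}}$. C. The vector fields $h_1,h_2$ do not depend on the coordinate $y_1$. Then the control law $u=U(t,q,x^D)=\Phi(q,q^D(t),u^D(t))$, $(q^D,u^D)=M(x^D)$, with $\Phi$ the feedback function defined in the context, solves the problem of stabilizing the distinguished point trajectories of $(\ast)$ on $\mathcal{M}$. That is, for every strongly admissible $x^D$, with $(q^D,u^D)=M(x^D)$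 and $q^D=\mathrm{col}(x^D,y^D)$, and every initial value $q(0)\in\mathcal{M}$, the solution $q=\mathrm{col}(x,y)$ of the closed-loop system consisting of $(\ast)$ and $u=\Phi(q,q^D(t),u^D(t))$ is defined and lies in $\mathcal{M}$ for all $t\ge0$, and $$\lim_{t\to\infty}(x(t)-x^D(t))=0,\quad \lim_{t\to\infty}d(y(t),y^D(t))=0,\quad \lim_{t\to\infty}(u(t)-u^D(t))=0 .$$ In addition, on the trajectories of the closed-loop system the input $u$ is bounded.
   Context: Setting. $n\ge1$; $\mathcal{Y}$ is a smooth $n$-dimensional manifold with coordinates $y=\mathrm{col}(y_1,\ldots,y_n)$; $h_1,h_2$ are (sufficiently smooth) vector fields on $\mathcal{Y}$. The state is $q=\mathrm{col}(x,y)\in\mathbb{R}^2\times\mathcal{Y}$, the input is $u\in\mathbb{R}^2$. $L_h\phi$ is the Lie derivative, $L_h^0\phi=\phi$, $L_h^i\phi=L_hL_h^{i-1}\phi$; $y_1$ is regarded as a function. Trajectories. $x^D:[0,\infty)\to\mathbb{R}^2$ is admissible if $x^D\in C^{n+1}$ and $\inf_{t\ge0}|\dot x^D(t)|>0$; it is strongly admissible if in addition its derivatives of orders $1,\ldots,n+1$ are bounded on $[0,\infty)$. A maneuvering operator of $(\ast)$ on $\mathcal{M}$ is an operator $M$ assigning to each admissible $x^D$ a pair $(q^D,u^D)$ with $q^D=\mathrm{col}(x^D,y^D)\in C^1([0,\infty),\mathcal{M})$, $u^D\in C([0,\infty),\mathbb{R}^2)$ satisfying $(\ast)$. Feedback function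 $\Phi$. Put $$F(y)=\begin{pmatrix}1&0\\ L_{h_1}^ny_1&L_{h_2}L_{h_1}^{n-1}y_1\end{pmatrix},\qquad F_2(y)=\begin{pmatrix}0&0\\0&1\end{pmatrix}F(y).$$ For $q=\mathrm{col}(x,y)$, $q^D=\mathrm{col}(x^D,y^D)$ in $\mathcal{M}$ and $u^D\in\mathbb{R}^2$ with $u_1^D\ne0$, $$\Phi(q,q^D,u^D)=F(y)^{-1}\left\{|u_1^D|\,\Psi\big(x-x^D,\,S(y)-S(y^D),\,S(y^D),\,F(y^D)u^D\big)+F_2(y^D)u^D\right\}.$$ Function $\Psi$. Fix arbitrary parameters $\gamma>0$, $\delta_1,\ldots,\delta_n>0$. Let $\bar w\in\{-1,1\}$, $\xi\in\mathbb{R}^2$, $\sigma_1,\ldots,\sigma_n\in\mathbb{R}$, $a=(a_1,\ldots,a_{n+1})\in\mathbb{R}^{n+1}$, $z^0=\xi$, $z^i=\mathrm{col}(\xi,\sigma_1,\ldots,\sigma_i)$, and $G(a_1)=\begin{pmatrix}\cos a_1&-\sin a_1\\ \sin a_1&\cos a_1\end{pmatrix}$. Define $$c=-\frac{\tanh(\gamma|\xi|)}{|\xi|}G(a_1)^{-1}\xi+\bar w\begin{pmatrix}1\\0\end{pmatrix}$$ (first term $0$ for $\xi=0$; $c_1$ always has the sign of $\bar w$), $\lambda=\bar w|c|$, $\alpha_0=\arctan(c_2/c_1)$, $V_0=\sinh^2(\gamma|\xi|)$. Let $b_i=(\lambda-\bar w)a_{i+1}$, $\beta_i=\lambda$ for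 $1\le i\le n-1$, and $b_n=0$, $\beta_n=1$. Let $$B_0(z^0,\sigma_1)=-\bar w\begin{pmatrix}\cos a_1\\ \sin a_1\end{pmatrix}+\lambda G(a_1)\begin{pmatrix}\cos\sigma_1\\ \sin\sigma_1\end{pmatrix},\quad B_i(z^i,\sigma_{i+1})=\mathrm{col}\big(B_{i-1}(z^{i-1},\sigma_i),\,b_i+\beta_i\sigma_{i+1}\big),\ 1\le i\le n-1$$ (dependence on $a,\bar w$ suppressed), and let $D_i(z^i,\zeta,\eta)=\frac{B_i(z^i,\zeta)-B_i(z^i,\eta)}{\zeta-\eta}$ for $\zeta\ne\eta$, $D_i(z^i,\zeta,\zeta)=\frac{\partial B_i}{\partial\zeta}(z^i,\zeta)$. For $i=1,\ldots,n$ define recursively $$\alpha_i=\beta_i^{-1}\Big[\frac{\partial\alpha_{i-1}}{\partial z^{i-1}}B_{i-1}(z^{i-1},\sigma_i)+\bar w\sum_{j=1}^{i}\frac{\partial\alpha_{i-1}}{\partial a_j}a_{j+1}-\delta_i^{-1}\frac{\partial V_{i-1}}{\partial z^{i-1}}D_{i-1}(z^{i-1},\sigma_i,\alpha_{i-1})-b_i-\gamma(\sigma_i-\alpha_{i-1})\Big],$$ $$V_i=V_{i-1}+\tfrac12\delta_i(\sigma_i-\alpha_{i-1})^2,$$ where $\alpha_i$ depends on $(z^i,a_1,\ldots,a_{i+1},\bar w)$ and derivatives with respect to $z$ are row vectors. Finally, for $\xi\in\mathbb{R}^2$, $\sigma\in\mathbb{R}^n$, $\bar s\in\mathbb{R}^n$,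 $\bar v\in\mathbb{R}^2$ with $\bar v_1\ne0$, $$\Psi(\xi,\sigma,\bar s,\bar v)=\begin{pmatrix}\lambda\\ \alpha_n\end{pmatrix}\quad\text{evaluated at } z^n=\mathrm{col}(\xi,\sigma),\ (a_1,\ldots,a_n)=\bar s,\ a_{n+1}=\bar v_2/\bar v_1,\ \bar w=\mathrm{sign}\,\bar v_1 .$$ *)

theory Defs
  imports "HOL-Analysis.Analysis"
begin

section \<open>Smooth manifolds, vector fields, Lie derivatives\<close>

text \<open>
  Manifolds are modelled on a linear subspace \<open>E\<close> of a Euclidean space, so that the dimension of
  the manifold is \<^term>\<open>dim E\<close>, and may be zero.
\<close>

type_synonym ('p, 'e) chart = "'p set \<times> ('p \<Rightarrow> 'e)"

abbreviation chart_dom :: "('p, 'e) chart \<Rightarrow> 'p set" where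
  "chart_dom \<equiv> fst"

abbreviation chart_map :: "('p, 'e) chart \<Rightarrow> 'p \<Rightarrow> 'e" where
  "chart_map \<equiv> snd"

definition chart_inv :: "('p, 'e) chart \<Rightarrow> 'e \<Rightarrow> 'p" where
  "chart_inv c = inv_into (chart_dom c) (chart_map c)"

text \<open>
  \<open>f\<close> is of class \<open>C\<^sup>k\<close> on \<open>W\<close>, where \<open>W\<close> is a relatively open subset of the subspace \<open>E\<close>. The
  value of the derivative within \<open>E\<close> is only determined in the directions \<open>v \<in> E\<close>.
\<close>

primrec Ck_on ::
  "'e::euclidean_space set \<Rightarrow> nat \<Rightarrow> ('e \<Rightarrow> 'f::real_normed_vector) \<Rightarrow> 'e set \<Rightarrow> bool"
where
  "Ck_on E 0 f W \<longleftrightarrow> continuous_on W f"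
| "Ck_on E (Suc k) f W \<longleftrightarrow>
     (\<forall>x\<in>W. f differentiable (at x within E)) \<and>
     (\<forall>v\<in>E. Ck_on E k (\<lambda>x. frechet_derivative f (at x within E) v) W)"

definition is_chart :: "'e::euclidean_space set \<Rightarrow> 'p topology \<Rightarrow> ('p, 'e) chart \<Rightarrow> bool" where
  "is_chart E X c \<longleftrightarrow>
     openin X (chart_dom c) \<and>
     openin (top_of_set E) (chart_map c ` chart_dom c) \<and>
     homeomorphic_map (subtopology X (chart_dom c)) (top_of_set (chart_map c ` chart_dom c))
       (chart_map c)"

definition smooth_transition ::
  "'e::euclidean_space set \<Rightarrow> ('p, 'e) chart \<Rightarrow> ('p, 'e) chart \<Rightarrow> bool" where
  "smooth_transition E c c' \<longleftrightarrow>
     (\<forall>k. Ck_on E k (chart_map c' \<circ> chart_inv c) (chart_map c ` (chart_dom c \<inter> chart_dom c')))"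

text \<open>The atlas \<open>A\<close> is the maximal one, that is, the smooth structure itself.\<close>

definition smooth_manifold ::
  "'e::euclidean_space set \<Rightarrow> 'p topology \<Rightarrow> ('p, 'e) chart set \<Rightarrow> bool" where
  "smooth_manifold E X A \<longleftrightarrow>
     subspace E \<and> Hausdorff_space X \<and> second_countable X \<and>
     (\<forall>c\<in>A. is_chart E X c) \<and>
     \<Union> (chart_dom ` A) = topspace X \<and>
     (\<forall>c\<in>A. \<forall>c'\<in>A. smooth_transition E c c') \<and>
     (\<forall>c. is_chart E X c \<and> (\<forall>c'\<in>A. smooth_transition E c c' \<and> smooth_transition E c' c)
        \<longrightarrow> c \<in> A)"

text \<open>
  A vector field on a manifold modelled on the full space \<^typ>\<open>'e\<close> is given by its component
  vectors \<open>h c p\<close> in all charts \<open>c\<close>, subject to the transformation law of tangent vectors.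
\<close>

type_synonym ('p, 'e) vfield = "('p, 'e) chart \<Rightarrow> 'p \<Rightarrow> 'e"

definition Ck_vector_field ::
  "nat \<Rightarrow> ('p, 'e::euclidean_space) chart set \<Rightarrow> ('p, 'e) vfield \<Rightarrow> bool" where
  "Ck_vector_field k A h \<longleftrightarrow>
     (\<forall>c\<in>A. \<forall>c'\<in>A. \<forall>p \<in> chart_dom c \<inter> chart_dom c'.
        h c' p = frechet_derivative (chart_map c' \<circ> chart_inv c) (at (chart_map c p)) (h c p)) \<and>
     (\<forall>c\<in>A. Ck_on UNIV k (h c \<circ> chart_inv c) (chart_map c ` chart_dom c))"

text \<open>For functions that are differentiable near \<open>p\<close> the choice of the chart is immaterial.\<close>

definition lie_deriv ::
  "('p, 'e::euclidean_space) chart set \<Rightarrow> ('p, 'e) vfield \<Rightarrow> ('p \<Rightarrow> real) \<Rightarrow> 'p \<Rightarrow> real" where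
  "lie_deriv A h f p =
     (let c = (SOME c. c \<in> A \<and> p \<in> chart_dom c)
      in frechet_derivative (f \<circ> chart_inv c) (at (chart_map c p)) (h c p))"

text \<open>
  The open set \<open>Om\<close> of the manifold \<open>(Y, A)\<close> is split as the product of the real line (coordinate
  \<open>y1\<close>) and a manifold \<open>(Yc, Ac)\<close> (projection \<open>pc\<close>) modelled on the hyperplane orthogonal to the
  unit vector \<open>e\<close>: the products of the identity and the charts of \<open>(Yc, Ac)\<close> are charts of \<open>(Y, A)\<close>.
\<close>

definition product_chart ::
  "'p set \<Rightarrow> ('p \<Rightarrow> real) \<Rightarrow> ('p \<Rightarrow> 'c) \<Rightarrow> 'e::euclidean_space \<Rightarrow> ('c, 'e) chart \<Rightarrow> ('p, 'e) chart"
where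
  "product_chart Om y1 pc e c =
     ({p \<in> Om. pc p \<in> chart_dom c}, \<lambda>p. y1 p *\<^sub>R e + chart_map c (pc p))"

definition line_splitting ::
  "'p topology \<Rightarrow> ('p, 'e::euclidean_space) chart set \<Rightarrow> 'p set \<Rightarrow>
   'c topology \<Rightarrow> ('c, 'e) chart set \<Rightarrow> 'e \<Rightarrow> ('p \<Rightarrow> real) \<Rightarrow> ('p \<Rightarrow> 'c) \<Rightarrow> bool" where
  "line_splitting Y A Om Yc Ac e y1 pc \<longleftrightarrow>
     openin Y Om \<and> e \<in> Basis \<and>
     smooth_manifold {v. v \<bullet> e = 0} Yc Ac \<and>
     bij_betw (\<lambda>p. (y1 p, pc p)) Om (UNIV \<times> topspace Yc) \<and>
     (\<forall>c\<in>Ac. product_chart Om y1 pc e c \<in> A)"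

definition independent_of_line_coordinate ::
  "'p set \<Rightarrow> ('c, 'e::euclidean_space) chart set \<Rightarrow> 'e \<Rightarrow> ('p \<Rightarrow> real) \<Rightarrow> ('p \<Rightarrow> 'c) \<Rightarrow>
   ('p, 'e) vfield \<Rightarrow> bool" where
  "independent_of_line_coordinate Om Ac e y1 pc h \<longleftrightarrow>
     (\<forall>c\<in>Ac. \<forall>p\<in>Om. \<forall>p'\<in>Om. pc p = pc p' \<and> pc p \<in> chart_dom c \<longrightarrow>
        h (product_chart Om y1 pc e c) p = h (product_chart Om y1 pc e c) p')"


section \<open>Trajectories and maneuvering operators\<close>

text \<open>Derivatives of functions on \<open>[0,\<infinity>)\<close>; at \<open>0\<close> they are one-sided. Values at negative
  arguments are irrelevant.\<close>

primrec vderiv :: "nat \<Rightarrow> (real \<Rightarrow> 'a::real_normed_vector) \<Rightarrow> real \<Rightarrow> 'a" where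
  "vderiv 0 f = f"
| "vderiv (Suc k) f = (\<lambda>t. vector_derivative (vderiv k f) (at t within {0..}))"

definition Ck_halfline :: "nat \<Rightarrow> (real \<Rightarrow> 'a::real_normed_vector) \<Rightarrow> bool" where
  "Ck_halfline k f \<longleftrightarrow>
     (\<forall>j<k. \<forall>t\<ge>0. vderiv j f differentiable (at t within {0..})) \<and>
     continuous_on {0..} (vderiv k f)"

definition admissible :: "nat \<Rightarrow> (real \<Rightarrow> real^2) \<Rightarrow> bool" where
  "admissible n xD \<longleftrightarrow> Ck_halfline (n + 1) xD \<and> (INF t\<in>{0..}. norm (vderiv 1 xD t)) > 0"

definition strongly_admissible :: "nat \<Rightarrow> (real \<Rightarrow> real^2) \<Rightarrow> bool" where
  "strongly_admissible n xD \<longleftrightarrow>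
     admissible n xD \<and> (\<forall>k\<in>{1..n+1}. bounded (vderiv k xD ` {0..}))"

definition C1_manifold_curve ::
  "'p topology \<Rightarrow> ('p, 'e::euclidean_space) chart set \<Rightarrow> (real \<Rightarrow> 'p) \<Rightarrow> bool" where
  "C1_manifold_curve Y A y \<longleftrightarrow>
     continuous_map (top_of_set {0..}) Y y \<and>
     (\<forall>c\<in>A.
        (\<forall>t\<in>{0..}. y t \<in> chart_dom c \<longrightarrow> (chart_map c \<circ> y) differentiable (at t within {0..})) \<and>
        continuous_on {t\<in>{0..}. y t \<in> chart_dom c}
          (\<lambda>t. vector_derivative (chart_map c \<circ> y) (at t within {0..})))"

text \<open>
  \<open>q = (x, y)\<close> is a solution, with values in \<open>\<real>\<^sup>2 \<times> Om\<close>, of the control system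
  \<open>x\<^sub>1' = u\<^sub>1 cos y\<^sub>1, x\<^sub>2' = u\<^sub>1 sin y\<^sub>1, y' = u\<^sub>1 h\<^sub>1(y) + u\<^sub>2 h\<^sub>2(y)\<close> on the interval \<open>J\<close>
  under the input \<open>u\<close>.
\<close>

definition solves_system ::
  "'p topology \<Rightarrow> ('p, 'e::euclidean_space) chart set \<Rightarrow> 'p set \<Rightarrow> ('p \<Rightarrow> real) \<Rightarrow>
   ('p, 'e) vfield \<Rightarrow> ('p, 'e) vfield \<Rightarrow>
   real set \<Rightarrow> (real \<Rightarrow> real^2) \<Rightarrow> (real \<Rightarrow> (real^2) \<times> 'p) \<Rightarrow> bool" where
  "solves_system Y A Om y1 h1 h2 J u q \<longleftrightarrow>
     (\<forall>t\<in>J. snd (q t) \<in> Om) \<and>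
     continuous_map (top_of_set J) Y (snd \<circ> q) \<and>
     (\<forall>t\<in>J.
        ((fst \<circ> q) has_vector_derivative
           u t $ 1 *\<^sub>R vector [cos (y1 (snd (q t))), sin (y1 (snd (q t)))]) (at t within J) \<and>
        (\<forall>c\<in>A. snd (q t) \<in> chart_dom c \<longrightarrow>
           ((chart_map c \<circ> snd \<circ> q) has_vector_derivative
              u t $ 1 *\<^sub>R h1 c (snd (q t)) + u t $ 2 *\<^sub>R h2 c (snd (q t))) (at t within J)))"

type_synonym 'p operator =
  "(real \<Rightarrow> real^2) \<Rightarrow> (real \<Rightarrow> (real^2) \<times> 'p) \<times> (real \<Rightarrow> real^2)"

definition maneuvering_operator ::
  "'p topology \<Rightarrow> ('p, 'e::euclidean_space) chart set \<Rightarrow> 'p set \<Rightarrow> ('p \<Rightarrow> real) \<Rightarrow>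
   ('p, 'e) vfield \<Rightarrow> ('p, 'e) vfield \<Rightarrow> 'p operator \<Rightarrow> bool" where
  "maneuvering_operator Y A Om y1 h1 h2 M \<longleftrightarrow>
     (\<forall>xD qD uD. admissible DIM('e) xD \<and> M xD = (qD, uD) \<longrightarrow>
        (\<forall>t\<ge>0. fst (qD t) = xD t \<and> snd (qD t) \<in> Om) \<and>
        Ck_halfline 1 (fst \<circ> qD) \<and> C1_manifold_curve Y A (snd \<circ> qD) \<and>
        continuous_on {0..} uD \<and>
        solves_system Y A Om y1 h1 h2 {0..} uD qD)"


section \<open>The function \<open>\<Psi>\<close>\<close>

text \<open>
  Tuples of variable length are functions \<^typ>\<open>nat \<Rightarrow> real\<close> with indices starting from \<open>0\<close>:
  the tuple \<open>z\<^sup>i = col(\<xi>,\<sigma>\<^sub>1,\<dots>,\<sigma>\<^sub>i)\<close> has the components \<open>z 0 = \<xi>\<^sub>1\<close>, \<open>z 1 = \<xi>\<^sub>2\<close> and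
  \<open>z (j + 1) = \<sigma>\<^sub>j\<close> for \<open>1 \<le> j \<le> i\<close>, and \<open>a\<^sub>j\<close> is \<open>a (j - 1)\<close>. The functions with subscript \<open>i\<close>
  only use the components of \<open>z\<^sup>i\<close>. The indices of \<open>\<alpha>, V, b, \<beta>, B, D, \<delta>\<close> are the original ones.
\<close>

definition partial :: "nat \<Rightarrow> ((nat \<Rightarrow> real) \<Rightarrow> real) \<Rightarrow> (nat \<Rightarrow> real) \<Rightarrow> real" where
  "partial k f x = deriv (\<lambda>t. f (x(k := t))) (x k)"

definition xi_of :: "(nat \<Rightarrow> real) \<Rightarrow> real^2" where
  "xi_of z = vector [z 0, z 1]"

definition rot :: "real \<Rightarrow> real^2^2" where
  "rot \<theta> = vector [vector [cos \<theta>, - sin \<theta>], vector [sin \<theta>, cos \<theta>]]"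

text \<open>The first term vanishes for \<open>\<xi> = 0\<close>, as \<open>x / 0 = 0\<close>.\<close>

definition cvec :: "real \<Rightarrow> real \<Rightarrow> (nat \<Rightarrow> real) \<Rightarrow> (nat \<Rightarrow> real) \<Rightarrow> real^2" where
  "cvec \<gamma> w z a =
     - ((tanh (\<gamma> * norm (xi_of z)) / norm (xi_of z)) *\<^sub>R (matrix_inv (rot (a 0)) *v xi_of z))
     + w *\<^sub>R vector [1, 0]"

definition lam :: "real \<Rightarrow> real \<Rightarrow> (nat \<Rightarrow> real) \<Rightarrow> (nat \<Rightarrow> real) \<Rightarrow> real" where
  "lam \<gamma> w z a = w * norm (cvec \<gamma> w z a)"

definition bcoef :: "real \<Rightarrow> nat \<Rightarrow> real \<Rightarrow> nat \<Rightarrow> (nat \<Rightarrow> real) \<Rightarrow> (nat \<Rightarrow> real) \<Rightarrow> real" where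
  "bcoef \<gamma> n w i z a = (if i < n then (lam \<gamma> w z a - w) * a i else 0)"

definition beta :: "real \<Rightarrow> nat \<Rightarrow> real \<Rightarrow> nat \<Rightarrow> (nat \<Rightarrow> real) \<Rightarrow> (nat \<Rightarrow> real) \<Rightarrow> real" where
  "beta \<gamma> n w i z a = (if i < n then lam \<gamma> w z a else 1)"

definition B0 :: "real \<Rightarrow> real \<Rightarrow> (nat \<Rightarrow> real) \<Rightarrow> (nat \<Rightarrow> real) \<Rightarrow> real \<Rightarrow> real^2" where
  "B0 \<gamma> w z a \<zeta> =
     - (w *\<^sub>R vector [cos (a 0), sin (a 0)])
     + lam \<gamma> w z a *\<^sub>R (rot (a 0) *v vector [cos \<zeta>, sin \<zeta>])"

text \<open>\<open>Bvec \<gamma> n w i z a \<zeta> k\<close> is the component with index \<open>k < i + 2\<close> of \<open>B\<^sub>i(z\<^sup>i, \<zeta>)\<close>.\<close>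

primrec Bvec ::
  "real \<Rightarrow> nat \<Rightarrow> real \<Rightarrow> nat \<Rightarrow> (nat \<Rightarrow> real) \<Rightarrow> (nat \<Rightarrow> real) \<Rightarrow> real \<Rightarrow> nat \<Rightarrow> real"
where
  "Bvec \<gamma> n w 0 z a \<zeta> =
     (\<lambda>k. if k = 0 then B0 \<gamma> w z a \<zeta> $ 1 else if k = 1 then B0 \<gamma> w z a \<zeta> $ 2 else 0)"
| "Bvec \<gamma> n w (Suc i) z a \<zeta> =
     (Bvec \<gamma> n w i z a (z (i + 2)))
       (i + 2 := bcoef \<gamma> n w (i + 1) z a + beta \<gamma> n w (i + 1) z a * \<zeta>)"

definition Dvec ::
  "real \<Rightarrow> nat \<Rightarrow> real \<Rightarrow> nat \<Rightarrow> (nat \<Rightarrow> real) \<Rightarrow> (nat \<Rightarrow> real) \<Rightarrow> real \<Rightarrow> real \<Rightarrow> nat \<Rightarrow> real"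
where
  "Dvec \<gamma> n w i z a \<zeta> \<eta> k =
     (if \<zeta> \<noteq> \<eta> then (Bvec \<gamma> n w i z a \<zeta> k - Bvec \<gamma> n w i z a \<eta> k) / (\<zeta> - \<eta>)
      else deriv (\<lambda>t. Bvec \<gamma> n w i z a t k) \<zeta>)"

fun alpha ::
  "real \<Rightarrow> (nat \<Rightarrow> real) \<Rightarrow> nat \<Rightarrow> real \<Rightarrow> nat \<Rightarrow> (nat \<Rightarrow> real) \<Rightarrow> (nat \<Rightarrow> real) \<Rightarrow> real"
and V ::
  "real \<Rightarrow> (nat \<Rightarrow> real) \<Rightarrow> nat \<Rightarrow> real \<Rightarrow> nat \<Rightarrow> (nat \<Rightarrow> real) \<Rightarrow> (nat \<Rightarrow> real) \<Rightarrow> real"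
where
  "alpha \<gamma> \<delta> n w 0 z a = arctan (cvec \<gamma> w z a $ 2 / cvec \<gamma> w z a $ 1)"
| "alpha \<gamma> \<delta> n w (Suc i) z a =
     inverse (beta \<gamma> n w (Suc i) z a) *
       ((\<Sum>k<i+2. partial k (\<lambda>z'. alpha \<gamma> \<delta> n w i z' a) z * Bvec \<gamma> n w i z a (z (i + 2)) k)
        + w * (\<Sum>j\<le>i. partial j (\<lambda>a'. alpha \<gamma> \<delta> n w i z a') a * a (j + 1))
        - inverse (\<delta> (Suc i)) *
            (\<Sum>k<i+2. partial k (\<lambda>z'. V \<gamma> \<delta> n w i z' a) z *
               Dvec \<gamma> n w i z a (z (i + 2)) (alpha \<gamma> \<delta> n w i z a) k)
        - bcoef \<gamma> n w (Suc i) z a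
        - \<gamma> * (z (i + 2) - alpha \<gamma> \<delta> n w i z a))"
| "V \<gamma> \<delta> n w 0 z a = (sinh (\<gamma> * norm (xi_of z)))\<^sup>2"
| "V \<gamma> \<delta> n w (Suc i) z a =
     V \<gamma> \<delta> n w i z a + 1/2 * \<delta> (Suc i) * (z (i + 2) - alpha \<gamma> \<delta> n w i z a)\<^sup>2"

definition Psi ::
  "real \<Rightarrow> (nat \<Rightarrow> real) \<Rightarrow> nat \<Rightarrow>
   real^2 \<Rightarrow> (nat \<Rightarrow> real) \<Rightarrow> (nat \<Rightarrow> real) \<Rightarrow> real^2 \<Rightarrow> real^2" where
  "Psi \<gamma> \<delta> n \<xi> \<sigma> s v =
     (let z = (\<lambda>k. if k = 0 then \<xi> $ 1 else if k = 1 then \<xi> $ 2 else \<sigma> (k - 2));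
          a = s(n := v $ 2 / v $ 1);
          w = sgn (v $ 1)
      in vector [lam \<gamma> w z a, alpha \<gamma> \<delta> n w n z a])"


section \<open>The feedback function and the stabilization problem\<close>

definition Smap ::
  "('p, 'e::euclidean_space) chart set \<Rightarrow> ('p, 'e) vfield \<Rightarrow> ('p \<Rightarrow> real) \<Rightarrow> 'p \<Rightarrow> nat \<Rightarrow> real" where
  "Smap A h1 y1 y = (\<lambda>i. if i < DIM('e) then (lie_deriv A h1 ^^ i) y1 y else 0)"

definition Fmat ::
  "('p, 'e::euclidean_space) chart set \<Rightarrow> ('p, 'e) vfield \<Rightarrow> ('p, 'e) vfield \<Rightarrow> ('p \<Rightarrow> real) \<Rightarrow>
   'p \<Rightarrow> real^2^2" where
  "Fmat A h1 h2 y1 y =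
     vector [vector [1, 0],
             vector [(lie_deriv A h1 ^^ DIM('e)) y1 y,
                     lie_deriv A h2 ((lie_deriv A h1 ^^ (DIM('e) - 1)) y1) y]]"

definition F2mat ::
  "('p, 'e::euclidean_space) chart set \<Rightarrow> ('p, 'e) vfield \<Rightarrow> ('p, 'e) vfield \<Rightarrow> ('p \<Rightarrow> real) \<Rightarrow>
   'p \<Rightarrow> real^2^2" where
  "F2mat A h1 h2 y1 y = vector [vector [0, 0], vector [0, 1]] ** Fmat A h1 h2 y1 y"

definition Phi ::
  "('p, 'e::euclidean_space) chart set \<Rightarrow> ('p, 'e) vfield \<Rightarrow> ('p, 'e) vfield \<Rightarrow> ('p \<Rightarrow> real) \<Rightarrow>
   real \<Rightarrow> (nat \<Rightarrow> real) \<Rightarrow> (real^2) \<times> 'p \<Rightarrow> (real^2) \<times> 'p \<Rightarrow> real^2 \<Rightarrow> real^2" where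
  "Phi A h1 h2 y1 \<gamma> \<delta> q qD uD =
     (case (q, qD) of ((x, y), (xD, yD)) \<Rightarrow>
        matrix_inv (Fmat A h1 h2 y1 y) *v
          (\<bar>uD $ 1\<bar> *\<^sub>R
             Psi \<gamma> \<delta> DIM('e) (x - xD) (\<lambda>i. Smap A h1 y1 y i - Smap A h1 y1 yD i)
               (Smap A h1 y1 yD) (Fmat A h1 h2 y1 yD *v uD)
           + F2mat A h1 h2 y1 yD *v uD))"

text \<open>A control law \<open>u = U(t, q, x\<^sup>D)\<close>; the dependence on \<open>x\<^sup>D\<close> is on the whole function.\<close>

type_synonym 'p control_law = "real \<Rightarrow> (real^2) \<times> 'p \<Rightarrow> (real \<Rightarrow> real^2) \<Rightarrow> real^2"

definition maneuvering_control_law ::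
  "('p, 'e::euclidean_space) chart set \<Rightarrow> ('p, 'e) vfield \<Rightarrow> ('p, 'e) vfield \<Rightarrow> ('p \<Rightarrow> real) \<Rightarrow>
   real \<Rightarrow> (nat \<Rightarrow> real) \<Rightarrow> 'p operator \<Rightarrow> 'p control_law" where
  "maneuvering_control_law A h1 h2 y1 \<gamma> \<delta> M t q xD =
     (case M xD of (qD, uD) \<Rightarrow> Phi A h1 h2 y1 \<gamma> \<delta> q (qD t) (uD t))"

definition closed_loop_solution ::
  "'p topology \<Rightarrow> ('p, 'e::euclidean_space) chart set \<Rightarrow> 'p set \<Rightarrow> ('p \<Rightarrow> real) \<Rightarrow>
   ('p, 'e) vfield \<Rightarrow> ('p, 'e) vfield \<Rightarrow> 'p control_law \<Rightarrow> (real \<Rightarrow> real^2) \<Rightarrow>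
   real set \<Rightarrow> (real \<Rightarrow> (real^2) \<times> 'p) \<Rightarrow> bool" where
  "closed_loop_solution Y A Om y1 h1 h2 U xD J q \<longleftrightarrow>
     solves_system Y A Om y1 h1 h2 J (\<lambda>t. U t (q t) xD) q"

text \<open>
  For every initial value there is a solution on \<open>[0,\<infinity>)\<close>, it is the only one (every solution
  on some \<open>[0,T)\<close> is a restriction of it), and it has the required limits.
\<close>

definition stabilizes_point_trajectories ::
  "'p topology \<Rightarrow> ('p, 'e::euclidean_space) chart set \<Rightarrow> 'p set \<Rightarrow> ('p \<Rightarrow> real) \<Rightarrow>
   ('p, 'e) vfield \<Rightarrow> ('p, 'e) vfield \<Rightarrow> ('p \<Rightarrow> 'p \<Rightarrow> real) \<Rightarrow> 'p operator \<Rightarrow> 'p control_law \<Rightarrow> bool"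
where
  "stabilizes_point_trajectories Y A Om y1 h1 h2 d M U \<longleftrightarrow>
     (\<forall>xD qD uD. strongly_admissible DIM('e) xD \<and> M xD = (qD, uD) \<longrightarrow>
        (\<forall>q0 \<in> UNIV \<times> Om. \<exists>q.
           q 0 = q0 \<and>
           closed_loop_solution Y A Om y1 h1 h2 U xD {0..} q \<and>
           (\<forall>T>0. \<forall>q'. closed_loop_solution Y A Om y1 h1 h2 U xD {0..<T} q' \<and> q' 0 = q0
              \<longrightarrow> (\<forall>t\<in>{0..<T}. q' t = q t)) \<and>
           ((\<lambda>t. fst (q t) - xD t) \<longlongrightarrow> 0) at_top \<and>
           ((\<lambda>t. d (snd (q t)) (snd (qD t))) \<longlongrightarrow> 0) at_top \<and>
           ((\<lambda>t. U t (q t) xD - uD t) \<longlongrightarrow> 0) at_top))"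

end

theory Submission
  imports Defs
begin

text \<open>
  The functions \<open>s = S(y)\<close> and \<open>v = F(y) u\<close> turn the system into a chain: the planar point moves with
  speed \<open>v\<^sub>1\<close> in the direction of the angle \<open>s\<^sub>1\<close>, \<open>s\<^sub>i' = v\<^sub>1 s\<^sub>i\<^sub>+\<^sub>1\<close> for \<open>i < n\<close> and \<open>s\<^sub>n' = v\<^sub>2\<close>. That \<open>S\<close> is a
  global diffeomorphism follows from its bijectivity, since the relative degree condition makes the
  differentials of its components independent. In the errors \<open>\<xi> = x - x\<^sup>D\<close>, \<open>\<sigma> = s - s\<^sup>D\<close> the closed loop
  reads \<open>z' = |v\<^sub>1\<^sup>D| B\<^sub>n(z, \<alpha>\<^sub>n)\<close>, the reference entering through the parameters \<open>a\<close> only, and the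
  recursion for \<open>\<alpha>\<^sub>i\<close>, \<open>V\<^sub>i\<close> is a backstepping scheme designed so that \<open>V\<^sub>n' = -2 \<gamma> |v\<^sub>1\<^sup>D| V\<^sub>n\<close> along the
  solutions. Since \<open>V\<^sub>n\<close> controls the errors uniformly for bounded \<open>a\<^sub>2, \<dots>, a\<^sub>n\<^sub>+\<^sub>1\<close>, this gives both global
  existence and convergence of the errors to zero.

  The angle \<open>a\<^sub>1\<close> need not be bounded, but it enters only through its sine and cosine, and by
  hypothesis C nothing else depends on \<open>y\<^sub>1\<close>. Modulo translations of \<open>y\<^sub>1\<close> the solutions
  stay in a compact set, where uniform continuity turns convergence in the coordinates \<open>S\<close> into
  convergence in \<open>d\<close> and convergence of the inputs.
\<close>

section \<open>Smooth feedback expressions\<close>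

text \<open>The profile tanh in \<open>cvec\<close> and the profile sinh in \<open>V\<close> at
  index 0 belong together. If the heading error equals \<open>alpha\<close> at index 0, then in time
  rescaled by the reference speed \<xi>' = - tanh(\<gamma> |\<xi>|) \<xi> / |\<xi>|, so
  sinh(\<gamma> |\<xi>|)^2 decays at the exact rate 2 \<gamma>. Because tanh stays below 1, the
  first component of \<open>cvec\<close> never changes sign: the commanded speed cannot vanish, the
  division by it in the recursion is harmless, and its direction is a global arctan. Three obstacles
  shape the work. The recursion differentiates its own output repeatedly, while it is written with
  norms and difference quotients; hence a class of expressions that is closed under differentiation.
  The reference values need not converge, so every estimate near the origin has to be uniform in the
  parameters. Finally, boundedness of those parameters must be derived: they arise from the angle of
  the reference velocity by differentiating and dividing by the speed, which needs both the bounded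
  derivatives and the positive lower bound of the speed.\<close>

text \<open>
  A class of functions of the error coordinates \<open>z\<^sub>0, \<dots>, z\<^sub>p\<^sub>-\<^sub>1\<close> and the parameters \<open>a\<^sub>0, \<dots>, a\<^sub>q\<^sub>-\<^sub>1\<close>
  that contains the feedback and is closed under partial derivatives. The parameter \<open>a\<^sub>0\<close>, the \<open>a\<^sub>1\<close> of the
  paper, is only admitted under \<open>cos\<close> and \<open>sin\<close>, so that bounds on a box in the other variables are
  uniform in \<open>a\<^sub>0\<close>. Entire power series are admitted because \<open>sinh(\<gamma> |\<xi>|) / |\<xi>|\<close> and
  \<open>cosh(\<gamma> |\<xi>|)\<close> are entire functions of \<open>|\<xi>|\<^sup>2\<close>, although \<open>|\<xi>|\<close> is not smooth at the origin.
\<close>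

inductive smooth :: "nat \<Rightarrow> nat \<Rightarrow> ((nat \<Rightarrow> real) \<Rightarrow> (nat \<Rightarrow> real) \<Rightarrow> real) \<Rightarrow> bool"
  for p q :: nat where
  smooth_z: "k < p \<Longrightarrow> smooth p q (\<lambda>z a. z k)"
| smooth_a: "0 < j \<Longrightarrow> j < q \<Longrightarrow> smooth p q (\<lambda>z a. a j)"
| smooth_cos_a: "0 < q \<Longrightarrow> smooth p q (\<lambda>z a. cos (a 0))"
| smooth_sin_a: "0 < q \<Longrightarrow> smooth p q (\<lambda>z a. sin (a 0))"
| smooth_const: "smooth p q (\<lambda>z a. c)"
| smooth_add: "smooth p q f \<Longrightarrow> smooth p q g \<Longrightarrow> smooth p q (\<lambda>z a. f z a + g z a)"
| smooth_mult: "smooth p q f \<Longrightarrow> smooth p q g \<Longrightarrow> smooth p q (\<lambda>z a. f z a * g z a)"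
| smooth_inverse: "smooth p q f \<Longrightarrow> (\<And>z a. f z a \<noteq> 0) \<Longrightarrow> smooth p q (\<lambda>z a. inverse (f z a))"
| smooth_sqrt: "smooth p q f \<Longrightarrow> (\<And>z a. 0 < f z a) \<Longrightarrow> smooth p q (\<lambda>z a. sqrt (f z a))"
| smooth_arctan: "smooth p q f \<Longrightarrow> smooth p q (\<lambda>z a. arctan (f z a))"
| smooth_series: "smooth p q f \<Longrightarrow> (\<And>x::real. summable (\<lambda>m. c m * x ^ m)) \<Longrightarrow>
    smooth p q (\<lambda>z a. \<Sum>m. c m * f z a ^ m)"

lemma smooth_uminus: "smooth p q f \<Longrightarrow> smooth p q (\<lambda>z a. - f z a)"
  using smooth_mult[OF smooth_const[of p q "-1"], of f] by simp

lemma smooth_diff: "smooth p q f \<Longrightarrow> smooth p q g \<Longrightarrow> smooth p q (\<lambda>z a. f z a - g z a)"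
  using smooth_add[of p q f "\<lambda>z a. - g z a"] smooth_uminus[of p q g] by simp

lemma smooth_divide: "smooth p q f \<Longrightarrow> smooth p q g \<Longrightarrow> (\<And>z a. g z a \<noteq> 0) \<Longrightarrow> smooth p q (\<lambda>z a. f z a / g z a)"
  unfolding divide_inverse by (rule smooth_mult[OF _ smooth_inverse])

lemma smooth_sum: "(\<And>i. i \<in> I \<Longrightarrow> smooth p q (f i)) \<Longrightarrow> smooth p q (\<lambda>z a. \<Sum>i\<in>I. f i z a)"
  by (induction I rule: infinite_finite_induct) (simp_all add: smooth_const smooth_add)

lemma smooth_power: "smooth p q f \<Longrightarrow> smooth p q (\<lambda>z a. f z a ^ m)"
  by (induction m) (simp_all add: smooth_const smooth_mult)

lemma smooth_sin: "smooth p q f \<Longrightarrow> smooth p q (\<lambda>z a. sin (f z a))"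
proof -
  have "summable (\<lambda>m. sin_coeff m * x ^ m)" for x :: real
    using summable_norm_cancel[OF summable_norm_sin[of x]] by simp
  then show "smooth p q f \<Longrightarrow> ?thesis"
    using smooth_series[of p q f sin_coeff] by (simp add: sin_def)
qed

lemma smooth_cos: "smooth p q f \<Longrightarrow> smooth p q (\<lambda>z a. cos (f z a))"
proof -
  have "summable (\<lambda>m. cos_coeff m * x ^ m)" for x :: real
    using summable_norm_cancel[OF summable_norm_cos[of x]] by simp
  then show "smooth p q f \<Longrightarrow> ?thesis"
    using smooth_series[of p q f cos_coeff] by (simp add: cos_def)
qed

lemma smooth_mono: "smooth p q f \<Longrightarrow> p \<le> p' \<Longrightarrow> q \<le> q' \<Longrightarrow> smooth p' q' f"
  by (induction rule: smooth.induct) (rule smooth.intros; force)+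

text \<open>For \<open>a 0\<close> only cosine and sine are compared. This allows the angle to be
  replaced by a representative modulo 2 pi when bounds are sought.\<close>

lemma smooth_cong_coords:
  "smooth p q f \<Longrightarrow> (\<And>k. k < p \<Longrightarrow> z k = z' k) \<Longrightarrow> (\<And>j. 0 < j \<Longrightarrow> j < q \<Longrightarrow> a j = a' j) \<Longrightarrow>
    (0 < q \<Longrightarrow> cos (a 0) = cos (a' 0)) \<Longrightarrow> (0 < q \<Longrightarrow> sin (a 0) = sin (a' 0)) \<Longrightarrow> f z a = f z' a'"
  by (induction rule: smooth.induct) auto

lemma continuous_on_coordinates:
  "continuous_on UNIV (\<lambda>x::(nat \<Rightarrow> real) \<times> (nat \<Rightarrow> real). fst x k)"
  "continuous_on UNIV (\<lambda>x::(nat \<Rightarrow> real) \<times> (nat \<Rightarrow> real). snd x k)"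
  by (rule continuous_on_product_then_coordinatewise, intro continuous_intros)+

lemma smooth_continuous:
  "smooth p q f \<Longrightarrow> continuous_on UNIV (\<lambda>(z, a). f z a)"
proof (induction rule: smooth.induct)
  case (smooth_series f c)
  have "isCont (\<lambda>x::real. \<Sum>m. c m * x ^ m) x" for x
    using termdiffs_strong_converges_everywhere[OF smooth_series(2)] DERIV_isCont by blast
  then have "continuous_on UNIV (\<lambda>x::real. \<Sum>m. c m * x ^ m)"
    by (simp add: continuous_on_eq_continuous_at)
  from continuous_on_compose2[OF this smooth_series(3)] show ?case
    by (simp add: case_prod_unfold)
qed (auto simp: case_prod_unfold intro!: continuous_on_coordinates continuous_on_add continuous_on_mult
    continuous_on_cos continuous_on_sin continuous_on_inverse continuous_on_arctan
    continuous_on_real_sqrt)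

text \<open>Differentiability is expressed by a chain rule along curves whose relevant coordinates
  are differentiable, so no norm on infinite tuples is involved. Moving a single coordinate recovers
  the partial derivatives; the set \<open>S\<close> admits one-sided derivatives at time 0.\<close>

definition has_partials where
  "has_partials p q f D E \<longleftrightarrow> (\<forall>k. smooth p q (D k)) \<and> (\<forall>j. smooth p q (E j)) \<and>
    (\<forall>Z Z' a a' t S. (\<forall>k<p. ((\<lambda>s. Z s k) has_real_derivative Z' k) (at t within S)) \<longrightarrow>
      (\<forall>j<q. ((\<lambda>s. a s j) has_real_derivative a' j) (at t within S)) \<longrightarrow>
      ((\<lambda>s. f (Z s) (a s)) has_real_derivative
         (\<Sum>k<p. D k (Z t) (a t) * Z' k) + (\<Sum>j<q. E j (Z t) (a t) * a' j)) (at t within S))"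

lemma has_partialsI:
  assumes "\<And>k. smooth p q (D k)" "\<And>j. smooth p q (E j)"
    and "\<And>Z Z' a a' t S. (\<And>k. k < p \<Longrightarrow> ((\<lambda>s. Z s k) has_real_derivative Z' k) (at t within S)) \<Longrightarrow>
      (\<And>j. j < q \<Longrightarrow> ((\<lambda>s. a s j) has_real_derivative a' j) (at t within S)) \<Longrightarrow>
      ((\<lambda>s. f (Z s) (a s)) has_real_derivative
         (\<Sum>k<p. D k (Z t) (a t) * Z' k) + (\<Sum>j<q. E j (Z t) (a t) * a' j)) (at t within S)"
  shows "has_partials p q f D E"
  using assms unfolding has_partials_def by blast

lemma has_partialsD:
  assumes "has_partials p q f D E"
  shows "smooth p q (D k)" "smooth p q (E j)"
    "(\<And>k. k < p \<Longrightarrow> ((\<lambda>s. Z s k) has_real_derivative Z' k) (at t within S)) \<Longrightarrow>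
      (\<And>j. j < q \<Longrightarrow> ((\<lambda>s. a s j) has_real_derivative a' j) (at t within S)) \<Longrightarrow>
      ((\<lambda>s. f (Z s) (a s)) has_real_derivative
         (\<Sum>k<p. D k (Z t) (a t) * Z' k) + (\<Sum>j<q. E j (Z t) (a t) * a' j)) (at t within S)"
  using assms unfolding has_partials_def by blast+

lemma sum_delta_mult: "(i::nat) < p \<Longrightarrow> (\<Sum>k<p. (if k = i then c else 0) * g k) = c * (g i :: real)"
proof -
  assume "i < p"
  have "(\<Sum>k<p. (if k = i then c else 0) * g k) = (\<Sum>k<p. if k = i then c * g k else 0)"
    by (intro sum.cong) auto
  then show ?thesis using \<open>i < p\<close> by simp
qed

lemma has_partials_compose:
  assumes "has_partials p q f D E" "smooth p q d"
    and "\<And>z a. (g has_real_derivative d z a) (at (f z a))"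
  shows "has_partials p q (\<lambda>z a. g (f z a)) (\<lambda>k z a. d z a * D k z a) (\<lambda>j z a. d z a * E j z a)"
proof (rule has_partialsI, goal_cases)
  case (3 Z Z' a a' t S)
  note der = has_partialsD(3)[OF assms(1), of Z Z' t S a a', OF 3]
  show ?case
    using DERIV_chain2[OF assms(3) der]
    by (simp add: distrib_left sum_distrib_left mult.assoc)
qed (auto intro: smooth_mult assms has_partialsD)

text \<open>Closure under differentiation: the outer derivative of every generator is again built
  from generators. An everywhere convergent series passes to the series with coefficients
  \<open>diffs c\<close>, which also converges everywhere.\<close>

lemma smooth_chain_exists: "smooth p q f \<Longrightarrow> \<exists>D E. has_partials p q f D E"
proof (induction rule: smooth.induct)
  case (smooth_z k)
  have "has_partials p q (\<lambda>z a. z k) (\<lambda>i z a. if i = k then 1 else 0) (\<lambda>j z a. 0)"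
    using smooth_z by (intro has_partialsI) (auto simp: sum_delta_mult smooth_const)
  then show ?case by blast
next
  case (smooth_a k)
  have "has_partials p q (\<lambda>z a. a k) (\<lambda>i z a. 0) (\<lambda>j z a. if j = k then 1 else 0)"
    using smooth_a by (intro has_partialsI) (auto simp: sum_delta_mult smooth_const)
  then show ?case by blast
next
  case smooth_cos_a
  have "has_partials p q (\<lambda>z a. cos (a 0)) (\<lambda>i z a. 0) (\<lambda>j z a. if j = 0 then - sin (a 0) else 0)"
  proof (rule has_partialsI)
    show "smooth p q (\<lambda>z a. if j = 0 then - sin (a 0) else 0)" for j
      using smooth_cos_a by (cases "j = 0") (auto intro: smooth_const smooth_uminus smooth.smooth_sin_a)
  qed (use smooth_cos_a in \<open>auto simp: sum_delta_mult smooth_const intro!: derivative_eq_intros\<close>)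
  then show ?case by blast
next
  case smooth_sin_a
  have "has_partials p q (\<lambda>z a. sin (a 0)) (\<lambda>i z a. 0) (\<lambda>j z a. if j = 0 then cos (a 0) else 0)"
  proof (rule has_partialsI)
    show "smooth p q (\<lambda>z a. if j = 0 then cos (a 0) else 0)" for j
      using smooth_sin_a by (cases "j = 0") (auto intro: smooth_const smooth.smooth_cos_a)
  qed (use smooth_sin_a in \<open>auto simp: sum_delta_mult smooth_const intro!: derivative_eq_intros\<close>)
  then show ?case by blast
next
  case (smooth_const c)
  have "has_partials p q (\<lambda>z a. c) (\<lambda>i z a. 0) (\<lambda>j z a. 0)"
    by (intro has_partialsI) (auto simp: smooth.smooth_const)
  then show ?case by blast
next
  case (smooth_add f g)
  then obtain D E D' E' where 1: "has_partials p q f D E" and 2: "has_partials p q g D' E'"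
    by blast
  have "has_partials p q (\<lambda>z a. f z a + g z a) (\<lambda>k z a. D k z a + D' k z a) (\<lambda>k z a. E k z a + E' k z a)"
  proof (rule has_partialsI, goal_cases)
    case (3 Z Z' a a' t S)
    show ?case
      using DERIV_add[OF has_partialsD(3)[OF 1, of Z Z' t S a a', OF 3] has_partialsD(3)[OF 2, of Z Z' t S a a', OF 3]]
      by (simp add: distrib_right sum.distrib algebra_simps)
  qed (auto intro: smooth.smooth_add has_partialsD[OF 1] has_partialsD[OF 2])
  then show ?case by blast
next
  case (smooth_mult f g)
  then obtain D E D' E' where 1: "has_partials p q f D E" and 2: "has_partials p q g D' E'"
    by blast
  have "has_partials p q (\<lambda>z a. f z a * g z a) (\<lambda>k z a. D k z a * g z a + D' k z a * f z a)
     (\<lambda>k z a. E k z a * g z a + E' k z a * f z a)"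
  proof (rule has_partialsI, goal_cases)
    case (3 Z Z' a a' t S)
    have eq: "(\<Sum>k<m. (x k * v + y k * u) * w k) = (\<Sum>k<m. x k * w k) * v + (\<Sum>k<m. y k * w k) * u"
      for m :: nat and x y w :: "nat \<Rightarrow> real" and u v
      by (simp add: sum_distrib_left sum_distrib_right sum.distrib algebra_simps)
    show ?case
      using DERIV_mult[OF has_partialsD(3)[OF 1, of Z Z' t S a a', OF 3] has_partialsD(3)[OF 2, of Z Z' t S a a', OF 3]]
      unfolding eq by (simp add: algebra_simps)
  qed (auto intro!: smooth.smooth_add smooth.smooth_mult smooth_mult.hyps has_partialsD[OF 1] has_partialsD[OF 2])
  then show ?case by blast
next
  case (smooth_inverse f)
  then obtain D E where 1: "has_partials p q f D E"
    by blast
  have "has_partials p q (\<lambda>z a. inverse (f z a))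
     (\<lambda>k z a. - (inverse (f z a) ^ 2) * D k z a) (\<lambda>k z a. - (inverse (f z a) ^ 2) * E k z a)"
    using smooth_inverse by (intro has_partials_compose[OF 1])
      (auto intro!: smooth_uminus smooth_mult smooth.smooth_inverse derivative_eq_intros simp: power2_eq_square)
  then show ?case by blast
next
  case (smooth_sqrt f)
  then obtain D E where 1: "has_partials p q f D E"
    by blast
  have "has_partials p q (\<lambda>z a. sqrt (f z a))
     (\<lambda>k z a. inverse (sqrt (f z a)) / 2 * D k z a) (\<lambda>k z a. inverse (sqrt (f z a)) / 2 * E k z a)"
    using smooth_sqrt by (intro has_partials_compose[OF 1] DERIV_real_sqrt)
      (auto intro!: smooth_divide smooth.smooth_inverse smooth.smooth_sqrt smooth_const simp: less_imp_neq[symmetric])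
  then show ?case by blast
next
  case (smooth_arctan f)
  then obtain D E where 1: "has_partials p q f D E"
    by blast
  have nz: "1 + (x::real)\<^sup>2 \<noteq> 0" for x
    by (metis power_one sum_power2_eq_zero_iff zero_neq_one)
  have "has_partials p q (\<lambda>z a. arctan (f z a))
     (\<lambda>k z a. inverse (1 + (f z a)\<^sup>2) * D k z a) (\<lambda>k z a. inverse (1 + (f z a)\<^sup>2) * E k z a)"
    using smooth_arctan nz by (intro has_partials_compose[OF 1] DERIV_arctan)
      (auto intro!: smooth_power smooth.smooth_inverse smooth_const smooth_add)
  then show ?case by blast
next
  case (smooth_series f c)
  then obtain D E where 1: "has_partials p q f D E"
    by blast
  have "has_partials p q (\<lambda>z a. \<Sum>m. c m * f z a ^ m)
     (\<lambda>k z a. (\<Sum>m. diffs c m * f z a ^ m) * D k z a) (\<lambda>k z a. (\<Sum>m. diffs c m * f z a ^ m) * E k z a)"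
    using smooth_series by (intro has_partials_compose[OF 1] termdiffs_strong_converges_everywhere)
      (auto intro!: smooth.smooth_series termdiff_converges_all)
  then show ?case by blast
qed

lemma partial_eqI:
  "((\<lambda>t. f (x(k := t))) has_real_derivative D) (at (x k)) \<Longrightarrow> partial k f x = D"
  unfolding partial_def by (rule DERIV_imp_deriv)

lemma has_partials_partial:
  assumes "has_partials p q f D E"
  shows "k < p \<Longrightarrow> partial k (\<lambda>z. f z a) z = D k z a"
    and "j < q \<Longrightarrow> partial j (\<lambda>a. f z a) a = E j z a"
proof -
  assume "k < p"
  have "((\<lambda>t. f (z(k := t)) a) has_real_derivative
      (\<Sum>i<p. D i (z(k := z k)) a * (if i = k then 1 else 0)) + (\<Sum>j<q. E j (z(k := z k)) a * 0)) (at (z k))"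
    by (rule has_partialsD(3)[OF assms]) auto
  then show "partial k (\<lambda>z. f z a) z = D k z a"
    using \<open>k < p\<close> by (intro partial_eqI) (simp add: if_distrib cong: if_cong)
next
  assume "j < q"
  have "((\<lambda>t. f z (a(j := t))) has_real_derivative
      (\<Sum>i<p. D i z (a(j := a j)) * 0) + (\<Sum>i<q. E i z (a(j := a j)) * (if i = j then 1 else 0))) (at (a j))"
    by (rule has_partialsD(3)[OF assms]) auto
  then show "partial j (\<lambda>a. f z a) a = E j z a"
    using \<open>j < q\<close> by (intro partial_eqI) (simp add: if_distrib cong: if_cong)
qed

lemma smooth_partial_z_zero:
  assumes "smooth p q f" "p \<le> k"
  shows "partial k (\<lambda>z. f z a) z = 0"
proof -
  have "f (z(k := t)) a = f z a" for t
    using assms by (intro smooth_cong_coords[OF assms(1)]) auto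
  then show ?thesis
    by (intro partial_eqI) simp
qed

lemma smooth_partial_a_zero:
  assumes "smooth p q f" "q \<le> k"
  shows "partial k (\<lambda>a. f z a) a = 0"
proof -
  have "f z (a(k := t)) = f z a" for t
    using assms by (intro smooth_cong_coords[OF assms(1)]) auto
  then show ?thesis
    by (intro partial_eqI) simp
qed

lemma smooth_partial_z:
  assumes "smooth p q f" shows "smooth p q (\<lambda>z a. partial k (\<lambda>z'. f z' a) z)"
proof -
  obtain D E where *: "has_partials p q f D E" using smooth_chain_exists[OF assms] by blast
  show ?thesis
  proof (cases "k < p")
    case True
    then show ?thesis using has_partials_partial(1)[OF *] has_partialsD(1)[OF *] by simp
  next
    case False
    then show ?thesis using smooth_partial_z_zero[OF assms] by (simp add: smooth_const)
  qed
qed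

lemma smooth_partial_a:
  assumes "smooth p q f" shows "smooth p q (\<lambda>z a. partial j (\<lambda>a'. f z a') a)"
proof -
  obtain D E where *: "has_partials p q f D E" using smooth_chain_exists[OF assms] by blast
  show ?thesis
  proof (cases "j < q")
    case True
    then show ?thesis using has_partials_partial(2)[OF *] has_partialsD(2)[OF *] by simp
  next
    case False
    then show ?thesis using smooth_partial_a_zero[OF assms] by (simp add: smooth_const)
  qed
qed

lemma smooth_chain_rule:
  assumes "smooth p q f"
    and "\<And>k. k < p \<Longrightarrow> ((\<lambda>s. Z s k) has_real_derivative Z' k) (at t within S)"
    and "\<And>j. j < q \<Longrightarrow> ((\<lambda>s. a s j) has_real_derivative a' j) (at t within S)"
  shows "((\<lambda>s. f (Z s) (a s)) has_real_derivative
      (\<Sum>k<p. partial k (\<lambda>z. f z (a t)) (Z t) * Z' k) +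
      (\<Sum>j<q. partial j (f (Z t)) (a t) * a' j)) (at t within S)"
proof -
  obtain D E where *: "has_partials p q f D E" using smooth_chain_exists[OF assms(1)] by blast
  show ?thesis
    using has_partialsD(3)[OF *, of Z Z' t S a a', OF assms(2,3)] has_partials_partial[OF *] by simp
qed

lemma smooth_differentiable:
  assumes "smooth p q f"
  shows "(\<lambda>t. f (z(k := t)) a) differentiable (at x)" "(\<lambda>t. f z (a(j := t))) differentiable (at x)"
proof -
  obtain D E where *: "has_partials p q f D E" using smooth_chain_exists[OF assms] by blast
  have "((\<lambda>t. f (z(k := t)) a) has_real_derivative
      (\<Sum>i<p. D i (z(k := x)) a * (if i = k then 1 else 0)) + (\<Sum>j<q. E j (z(k := x)) a * 0)) (at x)"
    by (rule has_partialsD(3)[OF *]) auto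
  then show "(\<lambda>t. f (z(k := t)) a) differentiable (at x)"
    using real_differentiable_def by blast
  have "((\<lambda>t. f z (a(j := t))) has_real_derivative
      (\<Sum>i<p. D i z (a(j := x)) * 0) + (\<Sum>i<q. E i z (a(j := x)) * (if i = j then 1 else 0))) (at x)"
    by (rule has_partialsD(3)[OF *]) auto
  then show "(\<lambda>t. f z (a(j := t))) differentiable (at x)"
    using real_differentiable_def by blast
qed

section \<open>Bounds and Lipschitz constants that are uniform in the angle\<close>

definition zbox :: "nat \<Rightarrow> real \<Rightarrow> (nat \<Rightarrow> real) set" where
  "zbox m R = {z. \<forall>k<m. \<bar>z k\<bar> \<le> R}"

text \<open>Index 0 is left free: it is the heading angle, which may grow without bound along a
  reference.\<close>

definition abox :: "nat \<Rightarrow> real \<Rightarrow> (nat \<Rightarrow> real) set" where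
  "abox q K = {a. \<forall>j. 0 < j \<longrightarrow> j < q \<longrightarrow> \<bar>a j\<bar> \<le> K}"

lemma compact_PiE_UNIV:
  "compact (PiE UNIV (\<lambda>_::nat. {-R..R::real}))"
proof -
  have "compactin (product_topology (\<lambda>_::nat. euclidean) UNIV) (PiE UNIV (\<lambda>_. {-R..R::real}))"
    by (subst compactin_PiE) (auto simp: compactin_euclidean_iff)
  then show ?thesis
    by (simp add: euclidean_product_topology)
qed

text \<open>The boxes are not compact, since the angle and the coordinates beyond \<open>p\<close>
  and \<open>q\<close> are free. Reducing the angle to [0, 2 pi) and setting the irrelevant
  coordinates to 0 does not change \<open>f\<close> and leads into a product of compact intervals,
  compact by Tychonoff's theorem.\<close>

lemma smooth_bounded:
  assumes "smooth p q f"
  shows "\<exists>B\<ge>0. \<forall>z\<in>zbox p R. \<forall>a\<in>abox q K. \<bar>f z a\<bar> \<le> B"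
proof -
  define C where "C = PiE UNIV (\<lambda>_::nat. {-\<bar>R\<bar>..\<bar>R\<bar>}) \<times> PiE UNIV (\<lambda>_::nat. {- max \<bar>K\<bar> (2*pi)..max \<bar>K\<bar> (2*pi)})"
  have "compact C"
    unfolding C_def by (intro compact_Times compact_PiE_UNIV)
  then have "compact ((\<lambda>(z, a). f z a) ` C)"
    by (intro compact_continuous_image continuous_on_subset[OF smooth_continuous[OF assms]]) auto
  then have "bounded ((\<lambda>(z, a). f z a) ` C)"
    by (rule compact_imp_bounded)
  then obtain B where B: "\<And>x. x \<in> (\<lambda>(z, a). f z a) ` C \<Longrightarrow> \<bar>x\<bar> \<le> B"
    unfolding bounded_iff real_norm_def by blast
  have "\<bar>f z a\<bar> \<le> max B 0" if z: "z \<in> zbox p R" and a: "a \<in> abox q K" for z a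
  proof -
    obtain \<theta> where \<theta>: "0 \<le> \<theta>" "\<theta> < 2 * pi" "cos (a 0) = cos \<theta>" "sin (a 0) = sin \<theta>"
      using sincos_total_2pi[of "cos (a 0)" "sin (a 0)"] by (metis add.commute sin_cos_squared_add)
    define z' where "z' = (\<lambda>k. if k < p then z k else 0)"
    define a' where "a' = (\<lambda>j. if j = 0 then \<theta> else if j < q then a j else 0)"
    have "f z a = f z' a'"
      by (rule smooth_cong_coords[OF assms]) (auto simp: z'_def a'_def \<theta>)
    moreover have "(z', a') \<in> C"
    proof -
      have "z' k \<in> {-\<bar>R\<bar>..\<bar>R\<bar>}" for k
        using z by (cases "k < p") (force simp: zbox_def z'_def abs_le_iff)+
      moreover have "a' j \<in> {- max \<bar>K\<bar> (2*pi)..max \<bar>K\<bar> (2*pi)}" for j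
      proof -
        have "\<bar>a' j\<bar> \<le> max \<bar>K\<bar> (2*pi)"
        proof (cases "j \<noteq> 0 \<and> j < q")
          case True
          then have "\<bar>a j\<bar> \<le> K" using a by (simp add: abox_def)
          then show ?thesis using True by (simp add: a'_def)
        next
          case False
          then show ?thesis using \<theta>(1,2) by (auto simp: a'_def)
        qed
        then show ?thesis by (simp add: abs_le_iff)
      qed
      ultimately show ?thesis unfolding C_def by blast
    qed
    ultimately have "f z a \<in> (\<lambda>(z, a). f z a) ` C"
      by (intro image_eqI[of _ _ "(z', a')"]) simp_all
    from B[OF this] show ?thesis by simp
  qed
  then show ?thesis
    by (intro exI[of _ "max B 0"]) auto
qed

text \<open>Mean value theorem on the segment from \<open>z'\<close> to \<open>z\<close>, which
  stays in the box by convexity; \<open>L\<close> is the sum of the bounds of all partial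
  derivatives in \<open>z\<close>, so that one constant serves every coordinate.\<close>

lemma smooth_lipschitz:
  assumes "smooth p q f"
  shows "\<exists>L\<ge>0. \<forall>z\<in>zbox p R. \<forall>z'\<in>zbox p R. \<forall>a\<in>abox q K. \<bar>f z a - f z' a\<bar> \<le> L * (\<Sum>k<p. \<bar>z k - z' k\<bar>)"
proof -
  have "\<forall>k. \<exists>B\<ge>0. \<forall>z\<in>zbox p R. \<forall>a\<in>abox q K. \<bar>partial k (\<lambda>z'. f z' a) z\<bar> \<le> B"
    using smooth_bounded[OF smooth_partial_z[OF assms]] by blast
  then obtain B where B: "\<And>k. B k \<ge> 0" "\<And>k z a. z \<in> zbox p R \<Longrightarrow> a \<in> abox q K \<Longrightarrow> \<bar>partial k (\<lambda>z'. f z' a) z\<bar> \<le> B k"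
    by metis
  define L where "L = (\<Sum>k<p. B k)"
  have BL: "B k \<le> L" if "k < p" for k
    unfolding L_def using that B(1) by (intro member_le_sum) auto
  have "\<bar>f z a - f z' a\<bar> \<le> L * (\<Sum>k<p. \<bar>z k - z' k\<bar>)"
    if z: "z \<in> zbox p R" and z': "z' \<in> zbox p R" and a: "a \<in> abox q K" for z z' a
  proof -
    define Z where "Z s k = z' k + s * (z k - z' k)" for s k
    have Z01: "Z 1 = z" "Z 0 = z'" by (auto simp: Z_def)
    have der: "((\<lambda>s. f (Z s) a) has_real_derivative
       (\<Sum>k<p. partial k (\<lambda>z. f z a) (Z s) * (z k - z' k)) + (\<Sum>j<q. partial j (f (Z s)) a * 0)) (at s)" for s
      by (rule smooth_chain_rule[OF assms]) (auto simp: Z_def intro!: derivative_eq_intros)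
    obtain s where s: "0 < s" "s < 1" "f (Z 1) a - f (Z 0) a = (1 - 0) *
       ((\<Sum>k<p. partial k (\<lambda>z. f z a) (Z s) * (z k - z' k)) + (\<Sum>j<q. partial j (f (Z s)) a * 0))"
      using MVT2[of 0 1 "\<lambda>s. f (Z s) a", OF _ der] by auto
    have "Z s k \<in> {-R..R}" if "k < p" for k
    proof -
      have "z k \<in> {-R..R}" "z' k \<in> {-R..R}" using z z' that by (auto simp: zbox_def abs_le_iff)
      moreover have "Z s k = (1 - s) * z' k + s * z k" by (simp add: Z_def algebra_simps)
      ultimately show ?thesis
        using convexD[of "{-R..R}" "z' k" "z k" "1 - s" s] s by auto
    qed
    then have "\<bar>Z s k\<bar> \<le> R" if "k < p" for k
      using that by fastforce
    then have Zs: "Z s \<in> zbox p R" by (simp add: zbox_def)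
    have "\<bar>f z a - f z' a\<bar> = \<bar>\<Sum>k<p. partial k (\<lambda>z. f z a) (Z s) * (z k - z' k)\<bar>"
      using s(3) unfolding Z01 by simp
    also have "\<dots> \<le> (\<Sum>k<p. L * \<bar>z k - z' k\<bar>)"
      by (intro order.trans[OF sum_abs] sum_mono)
        (auto simp: abs_mult intro!: mult_right_mono order.trans[OF B(2)[OF Zs a] BL])
    finally show ?thesis by (simp add: sum_distrib_left)
  qed
  moreover have "L \<ge> 0" unfolding L_def by (intro sum_nonneg B)
  ultimately show ?thesis by blast
qed

section \<open>The backstepping construction\<close>

declare One_nat_def [simp del]

section \<open>Entire series in |\<xi>|^2 in place of functions of |\<xi>|\<close>

definition sinhc_coeff :: "real \<Rightarrow> nat \<Rightarrow> real" where
  "sinhc_coeff \<gamma> m = \<gamma> ^ (2 * m + 1) / fact (2 * m + 1)"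

definition coshc_coeff :: "real \<Rightarrow> nat \<Rightarrow> real" where
  "coshc_coeff \<gamma> m = \<gamma> ^ (2 * m) / fact (2 * m)"

text \<open>Convergence is known only at positive squares. Every \<open>x\<close> lies strictly
  inside the disc through such a point, namely (|x| + 1)^2, and a power series converges
  inside.\<close>

lemma summable_even_powers:
  assumes "\<And>s::real. s \<noteq> 0 \<Longrightarrow> summable (\<lambda>m. c m * (s\<^sup>2) ^ m)"
  shows "summable (\<lambda>m. c m * x ^ m)"
proof (rule powser_inside)
  show "summable (\<lambda>m. c m * ((\<bar>x\<bar> + 1)\<^sup>2) ^ m)"
    using assms[of "\<bar>x\<bar> + 1"] by auto
  have "\<bar>x\<bar> < (\<bar>x\<bar> + 1)\<^sup>2"
    unfolding power2_sum by (smt (verit) zero_le_power2 power_one)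
  then show "norm x < norm ((\<bar>x\<bar> + 1)\<^sup>2)"
    by simp
qed

lemma coshc_sums: "(\<lambda>m. coshc_coeff \<gamma> m * (s\<^sup>2) ^ m) sums cosh (\<gamma> * s)"
proof -
  have "(\<lambda>m. (\<lambda>n. if even n then (\<gamma> * s) ^ n /\<^sub>R fact n else 0) (2 * m)) sums cosh (\<gamma> * s)"
    by (subst sums_mono_reindex)
      (auto simp: strict_mono_def cosh_converges elim!: evenE)
  then show ?thesis
    by (simp add: coshc_coeff_def power_mult_distrib power_mult[symmetric] divide_inverse mult_ac)
qed

lemma sinhc_sums:
  assumes "s \<noteq> 0"
  shows "(\<lambda>m. sinhc_coeff \<gamma> m * (s\<^sup>2) ^ m) sums (sinh (\<gamma> * s) / s)"
proof -
  have "(\<lambda>m. (\<lambda>n. if even n then 0 else (\<gamma> * s) ^ n /\<^sub>R fact n) (2 * m + 1)) sums sinh (\<gamma> * s)"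
    by (subst sums_mono_reindex)
      (auto simp: strict_mono_def sinh_converges elim!: oddE)
  moreover have "sinhc_coeff \<gamma> m * (s\<^sup>2) ^ m =
      (\<lambda>n. if even n then 0 else (\<gamma> * s) ^ n /\<^sub>R fact n) (2 * m + 1) / s" for m
    using assms
    by (simp add: sinhc_coeff_def power_mult_distrib power_mult[symmetric] power_add field_simps
        del: fact_Suc)
  ultimately show ?thesis
    by (simp only: sums_divide)
qed

lemma summable_coshc: "summable (\<lambda>m. coshc_coeff \<gamma> m * x ^ m)"
  by (rule summable_even_powers) (rule sums_summable[OF coshc_sums])

lemma summable_sinhc: "summable (\<lambda>m. sinhc_coeff \<gamma> m * x ^ m)"
  by (rule summable_even_powers) (rule sums_summable[OF sinhc_sums])

lemma summable_sinc: "summable (\<lambda>m. sin_coeff (Suc m) * x ^ m)" for x :: real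
  using summable_norm_cancel[OF summable_norm_sin[of x]]
  by (simp add: summable_powser_split_head)

text \<open>The entire extension of sin x / x. It expresses the difference quotients of sine and
  cosine by a formula that stays valid when the two arguments coincide.\<close>

definition sinc :: "real \<Rightarrow> real" where
  "sinc x = (\<Sum>m. sin_coeff (Suc m) * x ^ m)"

lemma sin_eq_sinc: "sin x = sinc x * x"
proof -
  have "summable (\<lambda>m. sin_coeff m * x ^ m)"
    using summable_norm_cancel[OF summable_norm_sin[of x]] by simp
  from powser_split_head(1)[OF this] show ?thesis
    by (simp add: sinc_def sin_def sin_coeff_def)
qed

lemma sinc_0 [simp]: "sinc 0 = 1"
  unfolding sinc_def by (subst powser_zero) (simp add: sin_coeff_def)

lemma smooth_sinc: "smooth p q f \<Longrightarrow> smooth p q (\<lambda>z a. sinc (f z a))"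
  unfolding sinc_def by (rule smooth_series[OF _ summable_sinc])

lemma norm_xi_of: "norm (xi_of z) = sqrt ((z 0)\<^sup>2 + (z 1)\<^sup>2)"
  by (simp add: xi_of_def norm_eq_sqrt_inner inner_vec_def sum_2 power2_eq_square)

lemma norm_vector_2: "norm (v :: real^2) = sqrt ((v $ 1)\<^sup>2 + (v $ 2)\<^sup>2)"
  by (simp add: norm_eq_sqrt_inner inner_vec_def sum_2 power2_eq_square)

lemma matrix_inv_unique:
  fixes A B :: "real^'n^'n"
  assumes "A ** B = mat 1" "B ** A = mat 1"
  shows "matrix_inv A = B"
proof -
  have *: "A ** matrix_inv A = mat 1 \<and> matrix_inv A ** A = mat 1"
    unfolding matrix_inv_def by (rule someI[of _ B]) (use assms in auto)
  have "matrix_inv A = (B ** A) ** matrix_inv A" by (simp add: assms)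
  also have "\<dots> = B" by (simp add: matrix_mul_assoc[symmetric] *)
  finally show ?thesis .
qed

lemma matrix_inv_rot: "matrix_inv (rot \<theta>) = rot (- \<theta>)"
  by (rule matrix_inv_unique)
    (auto simp: rot_def matrix_matrix_mult_def vec_eq_iff forall_2 sum_2 mat_def
      sin_cos_squared_add3 algebra_simps)

text \<open>Smooth substitute for tanh(\<gamma> |\<xi>|) / |\<xi>|. At \<xi> = 0 it takes the limit
  value \<gamma> instead of the 0 produced by division by zero; \<open>cvec\<close> does not notice,
  as the factor multiplies the vector \<xi> there.\<close>

definition tanhc :: "real \<Rightarrow> (nat \<Rightarrow> real) \<Rightarrow> (nat \<Rightarrow> real) \<Rightarrow> real" where
  "tanhc \<gamma> z a = (\<Sum>m. sinhc_coeff \<gamma> m * ((z 0)\<^sup>2 + (z 1)\<^sup>2) ^ m) /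
     (\<Sum>m. coshc_coeff \<gamma> m * ((z 0)\<^sup>2 + (z 1)\<^sup>2) ^ m)"

lemma coshc_norm: "(\<Sum>m. coshc_coeff \<gamma> m * ((z 0)\<^sup>2 + (z 1)\<^sup>2) ^ m) = cosh (\<gamma> * norm (xi_of z))"
  using sums_unique[OF coshc_sums[of \<gamma> "norm (xi_of z)"]] by (simp add: norm_xi_of)

lemma sinhc_norm:
  assumes "xi_of z \<noteq> 0"
  shows "(\<Sum>m. sinhc_coeff \<gamma> m * ((z 0)\<^sup>2 + (z 1)\<^sup>2) ^ m) = sinh (\<gamma> * norm (xi_of z)) / norm (xi_of z)"
proof -
  have "(norm (xi_of z))\<^sup>2 = (z 0)\<^sup>2 + (z 1)\<^sup>2"
    by (simp add: norm_xi_of)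
  then show ?thesis
    using sums_unique[OF sinhc_sums[of "norm (xi_of z)" \<gamma>]] assms by simp
qed

lemma tanhc_eq:
  assumes "xi_of z \<noteq> 0"
  shows "tanhc \<gamma> z a = tanh (\<gamma> * norm (xi_of z)) / norm (xi_of z)"
  using assms by (simp add: tanhc_def coshc_norm sinhc_norm tanh_def)

lemma xi_of_eq_0_iff: "xi_of z = 0 \<longleftrightarrow> z 0 = 0 \<and> z 1 = 0"
  by (simp add: xi_of_def vec_eq_iff forall_2)

lemma smooth_norm_sq: "2 \<le> p \<Longrightarrow> smooth p q (\<lambda>z a. (z 0)\<^sup>2 + (z 1)\<^sup>2)"
  by (intro smooth_add smooth_power smooth_z) auto

lemma smooth_tanhc: "2 \<le> p \<Longrightarrow> smooth p q (tanhc \<gamma>)"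
proof -
  assume p: "2 \<le> p"
  have "smooth p q (\<lambda>z a. (\<Sum>m. sinhc_coeff \<gamma> m * ((z 0)\<^sup>2 + (z 1)\<^sup>2) ^ m) /
     (\<Sum>m. coshc_coeff \<gamma> m * ((z 0)\<^sup>2 + (z 1)\<^sup>2) ^ m))"
    using p by (intro smooth_divide smooth_series smooth_norm_sq summable_coshc summable_sinhc)
      (auto simp: coshc_norm)
  then show ?thesis
    by (simp add: tanhc_def[abs_def])
qed

lemma cvec_components:
  "cvec \<gamma> w z a $ 1 = w - tanhc \<gamma> z a * (cos (a 0) * z 0 + sin (a 0) * z 1)"
  "cvec \<gamma> w z a $ 2 = - (tanhc \<gamma> z a * (cos (a 0) * z 1 - sin (a 0) * z 0))"
proof -
  have "cvec \<gamma> w z a = - (tanhc \<gamma> z a *\<^sub>R (rot (- a 0) *v xi_of z)) + w *\<^sub>R vector [1, 0]"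
    by (cases "xi_of z = 0") (simp_all add: cvec_def matrix_inv_rot tanhc_eq)
  moreover have "(rot (- a 0) *v xi_of z) $ 1 = cos (a 0) * z 0 + sin (a 0) * z 1"
    "(rot (- a 0) *v xi_of z) $ 2 = cos (a 0) * z 1 - sin (a 0) * z 0"
    by (simp_all add: rot_def xi_of_def matrix_vector_mult_def sum_2)
  ultimately show "cvec \<gamma> w z a $ 1 = w - tanhc \<gamma> z a * (cos (a 0) * z 0 + sin (a 0) * z 1)"
    "cvec \<gamma> w z a $ 2 = - (tanhc \<gamma> z a * (cos (a 0) * z 1 - sin (a 0) * z 0))"
    by simp_all
qed

lemma rotated_component_le: "\<bar>cos \<theta> * x + sin \<theta> * y\<bar> \<le> sqrt (x\<^sup>2 + y\<^sup>2)"
proof (rule real_le_rsqrt)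
  have "(cos \<theta> * x + sin \<theta> * y)\<^sup>2 + (cos \<theta> * y - sin \<theta> * x)\<^sup>2 = ((sin \<theta>)\<^sup>2 + (cos \<theta>)\<^sup>2) * (x\<^sup>2 + y\<^sup>2)"
    by algebra
  moreover have "(cos \<theta> * y - sin \<theta> * x)\<^sup>2 \<ge> 0" by simp
  ultimately show "\<bar>cos \<theta> * x + sin \<theta> * y\<bar>\<^sup>2 \<le> x\<^sup>2 + y\<^sup>2"
    unfolding sin_cos_squared_add power2_abs by (metis le_add_same_cancel1 mult_1)
qed

locale chained_feedback =
  fixes \<gamma> :: real and \<delta> :: "nat \<Rightarrow> real" and n :: nat and w :: real
  assumes gamma_pos: "0 < \<gamma>" and w_cases: "w = 1 \<or> w = -1"
    and delta_pos: "\<And>i. i \<in> {1..n} \<Longrightarrow> 0 < \<delta> i"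
begin

lemma w_sq [simp]: "w * w = 1" and w_nz [simp]: "w \<noteq> 0"
  using w_cases by auto

abbreviation "c1 z a \<equiv> cvec \<gamma> w z a $ 1"
abbreviation "c2 z a \<equiv> cvec \<gamma> w z a $ 2"
abbreviation "\<alpha> \<equiv> alpha \<gamma> \<delta> n w"
abbreviation "Vf \<equiv> V \<gamma> \<delta> n w"
abbreviation "\<B> \<equiv> Bvec \<gamma> n w"
abbreviation "\<D> \<equiv> Dvec \<gamma> n w"

text \<open>The feedback term in \<open>c1\<close> is a component of a rotated copy of \<xi> scaled
  by tanh(\<gamma> r) / r, hence smaller than 1 in absolute value and unable to overturn the sign of
  \<open>w\<close>.\<close>

lemma w_c1_pos: "0 < w * c1 z a"
proof -
  define r where "r = norm (xi_of z)"
  have "\<bar>tanhc \<gamma> z a * (cos (a 0) * z 0 + sin (a 0) * z 1)\<bar> < 1"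
  proof (cases "xi_of z = 0")
    case True
    then show ?thesis by (simp add: xi_of_eq_0_iff)
  next
    case False
    then have r: "0 < r" by (simp add: r_def)
    have t: "0 \<le> tanh (\<gamma> * r)" "tanh (\<gamma> * r) < 1"
      using r gamma_pos tanh_real_lt_1 by (simp_all add: less_imp_le)
    have "\<bar>tanhc \<gamma> z a * (cos (a 0) * z 0 + sin (a 0) * z 1)\<bar> \<le> (tanh (\<gamma> * r) / r) * r"
      unfolding tanhc_eq[OF False] r_def[symmetric] abs_mult
      using rotated_component_le[of "a 0" "z 0" "z 1"] t r
      by (intro mult_mono) (auto simp: r_def norm_xi_of)
    also have "\<dots> < 1" using r t by simp
    finally show ?thesis .
  qed
  then have "\<bar>w * (tanhc \<gamma> z a * (cos (a 0) * z 0 + sin (a 0) * z 1))\<bar> < 1"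
    using w_cases by (auto simp: abs_mult)
  moreover have "w * c1 z a = 1 - w * (tanhc \<gamma> z a * (cos (a 0) * z 0 + sin (a 0) * z 1))"
    by (simp add: cvec_components algebra_simps)
  ultimately show ?thesis by linarith
qed

lemma c1_nz: "c1 z a \<noteq> 0"
  using w_c1_pos[of z a] by auto

lemma w_abs_c1: "w * \<bar>c1 z a\<bar> = c1 z a"
  using w_cases w_c1_pos[of z a] by auto

lemma norm_cvec_pos: "0 < (c1 z a)\<^sup>2 + (c2 z a)\<^sup>2"
  using c1_nz[of z a] by (simp add: add_pos_nonneg)

lemma lam_eq: "lam \<gamma> w z a = w * sqrt ((c1 z a)\<^sup>2 + (c2 z a)\<^sup>2)"
  by (simp add: lam_def norm_vector_2)

lemma lam_nz: "lam \<gamma> w z a \<noteq> 0"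
  using norm_cvec_pos[of z a] unfolding lam_eq by (metis mult_eq_0_iff real_sqrt_gt_0_iff less_irrefl w_nz)

lemma beta_nz: "beta \<gamma> n w i z a \<noteq> 0"
  by (simp add: beta_def lam_nz)

lemma smooth_c1: "2 \<le> p \<Longrightarrow> 0 < q \<Longrightarrow> smooth p q c1"
  unfolding cvec_components
  by (intro smooth_diff smooth_mult smooth_add smooth_tanhc smooth_cos_a smooth_sin_a smooth_z smooth_const) auto

lemma smooth_c2: "2 \<le> p \<Longrightarrow> 0 < q \<Longrightarrow> smooth p q c2"
  unfolding cvec_components
  by (intro smooth_uminus smooth_diff smooth_mult smooth_add smooth_tanhc smooth_cos_a smooth_sin_a smooth_z) auto

lemma smooth_lam: "2 \<le> p \<Longrightarrow> 0 < q \<Longrightarrow> smooth p q (lam \<gamma> w)"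
  using smooth_mult[OF smooth_const[of p q w] smooth_sqrt[OF smooth_add[OF smooth_power[OF smooth_c1, of p q 2] smooth_power[OF smooth_c2, of p q 2]]]]
    norm_cvec_pos
  by (simp add: lam_eq[abs_def])

lemma smooth_bcoef: "2 \<le> p \<Longrightarrow> i < q \<Longrightarrow> 0 < i \<Longrightarrow> smooth p q (bcoef \<gamma> n w i)"
  unfolding bcoef_def[abs_def]
  by (cases "i < n") (auto intro!: smooth_mult smooth_diff smooth_lam smooth_const smooth_a)

lemma smooth_beta: "2 \<le> p \<Longrightarrow> 0 < q \<Longrightarrow> smooth p q (beta \<gamma> n w i)"
  unfolding beta_def[abs_def]
  by (cases "i < n") (auto intro!: smooth_lam smooth_const)

lemma B0_components:
  "B0 \<gamma> w z a \<zeta> $ 1 = - (w * cos (a 0)) + lam \<gamma> w z a * (cos (a 0) * cos \<zeta> - sin (a 0) * sin \<zeta>)"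
  "B0 \<gamma> w z a \<zeta> $ 2 = - (w * sin (a 0)) + lam \<gamma> w z a * (sin (a 0) * cos \<zeta> + cos (a 0) * sin \<zeta>)"
  by (simp_all add: B0_def rot_def matrix_vector_mult_def sum_2)

lemma smooth_Bvec:
  "i + 2 \<le> p \<Longrightarrow> i < q \<Longrightarrow> smooth p q \<zeta> \<Longrightarrow> smooth p q (\<lambda>z a. \<B> i z a (\<zeta> z a) k)"
proof (induction i arbitrary: \<zeta> k)
  case 0
  then have "smooth p q (\<lambda>z a. sin (\<zeta> z a))" "smooth p q (\<lambda>z a. cos (\<zeta> z a))"
    by (auto intro: smooth_sin smooth_cos)
  with 0 show ?case
    by (cases "k = 0"; cases "k = 1")
      (auto simp: B0_components intro!: smooth_add smooth_mult smooth_diff smooth_uminus smooth_const smooth_cos_a smooth_sin_a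
         smooth_lam)
next
  case (Suc i)
  show ?case
  proof (cases "k = i + 2")
    case True
    then show ?thesis
      using Suc.prems by (auto intro!: smooth_add smooth_mult smooth_bcoef smooth_beta)
  next
    case False
    then show ?thesis
      using Suc.IH[OF _ _ smooth_z[of "i + 2"], of k] Suc.prems by simp
  qed
qed

lemma Bvec_diff: "\<B> i z a \<zeta> k - \<B> i z a \<eta> k = \<D> i z a \<zeta> \<eta> k * (\<zeta> - \<eta>)"
  by (simp add: Dvec_def)

lemma cos_diff_sinc: "cos \<zeta> - cos \<eta> = - (sin ((\<zeta> + \<eta>) / 2) * sinc ((\<zeta> - \<eta>) / 2)) * (\<zeta> - \<eta>)"
proof -
  have "cos \<zeta> - cos \<eta> = 2 * sin ((\<zeta> + \<eta>) / 2) * sin ((\<eta> - \<zeta>) / 2)"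
    by (rule cos_diff_cos)
  also have "sin ((\<eta> - \<zeta>) / 2) = - sin ((\<zeta> - \<eta>) / 2)"
    by (metis minus_diff_eq minus_divide_left sin_minus)
  also have "\<dots> = - (sinc ((\<zeta> - \<eta>) / 2) * ((\<zeta> - \<eta>) / 2))"
    by (subst sin_eq_sinc) simp
  finally show ?thesis by simp
qed

lemma sin_diff_sinc: "sin \<zeta> - sin \<eta> = cos ((\<zeta> + \<eta>) / 2) * sinc ((\<zeta> - \<eta>) / 2) * (\<zeta> - \<eta>)"
proof -
  have "sin \<zeta> - sin \<eta> = 2 * sin ((\<zeta> - \<eta>) / 2) * cos ((\<zeta> + \<eta>) / 2)"
    by (rule sin_diff_sin)
  also have "sin ((\<zeta> - \<eta>) / 2) = sinc ((\<zeta> - \<eta>) / 2) * ((\<zeta> - \<eta>) / 2)"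
    by (rule sin_eq_sinc)
  finally show ?thesis by simp
qed

text \<open>The sum-to-product formulas extract the factor \<zeta> - \<eta> from the differences of
  sine and cosine. The resulting expression covers both branches of the definition of
  \<open>Dvec\<close>, so \<open>Dvec\<close> remains in the smooth class on the diagonal.\<close>

lemma Dvec_0:
  "\<D> 0 z a \<zeta> \<eta> k =
    (if k = 0 then lam \<gamma> w z a * (cos (a 0) * - (sin ((\<zeta> + \<eta>) / 2) * sinc ((\<zeta> - \<eta>) / 2))
        - sin (a 0) * (cos ((\<zeta> + \<eta>) / 2) * sinc ((\<zeta> - \<eta>) / 2)))
     else if k = 1 then lam \<gamma> w z a * (sin (a 0) * - (sin ((\<zeta> + \<eta>) / 2) * sinc ((\<zeta> - \<eta>) / 2))
        + cos (a 0) * (cos ((\<zeta> + \<eta>) / 2) * sinc ((\<zeta> - \<eta>) / 2)))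
     else 0)" (is "_ = ?R k")
proof (cases "\<zeta> = \<eta>")
  case True
  have "((\<lambda>t. \<B> 0 z a t k) has_real_derivative ?R k) (at \<zeta>)"
    unfolding True
    by (cases "k = 0"; cases "k = 1")
      (auto simp: B0_components algebra_simps intro!: derivative_eq_intros)
  then show ?thesis
    using True by (simp add: Dvec_def DERIV_imp_deriv)
next
  case False
  have "\<B> 0 z a \<zeta> k - \<B> 0 z a \<eta> k = ?R k * (\<zeta> - \<eta>)"
  proof -
    have "\<B> 0 z a \<zeta> k - \<B> 0 z a \<eta> k =
      (if k = 0 then lam \<gamma> w z a * (cos (a 0) * (cos \<zeta> - cos \<eta>) - sin (a 0) * (sin \<zeta> - sin \<eta>))
       else if k = 1 then lam \<gamma> w z a * (sin (a 0) * (cos \<zeta> - cos \<eta>) + cos (a 0) * (sin \<zeta> - sin \<eta>))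
       else 0)"
      by (simp add: B0_components algebra_simps)
    then show ?thesis
      unfolding cos_diff_sinc sin_diff_sinc by (simp add: algebra_simps)
  qed
  then show ?thesis
    using False by (simp add: Dvec_def del: Bvec.simps)
qed

text \<open>From index 1 on, \<zeta> enters only the last component, and affinely; the difference
  quotient is therefore the slope.\<close>

lemma Dvec_Suc: "\<D> (Suc i) z a \<zeta> \<eta> k = (if k = i + 2 then beta \<gamma> n w (i + 1) z a else 0)"
proof (cases "\<zeta> = \<eta>")
  case True
  have "((\<lambda>t. \<B> (Suc i) z a t k) has_real_derivative (if k = i + 2 then beta \<gamma> n w (i + 1) z a else 0)) (at \<zeta>)"
    by (auto intro!: derivative_eq_intros)
  then show ?thesis
    using True by (simp add: Dvec_def DERIV_imp_deriv)
next
  case False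
  then show ?thesis
    by (auto simp: Dvec_def simp flip: right_diff_distrib)
qed

lemma smooth_Dvec:
  assumes "2 \<le> p" "i < q" "smooth p q \<zeta>" "smooth p q \<eta>"
  shows "smooth p q (\<lambda>z a. \<D> i z a (\<zeta> z a) (\<eta> z a) k)"
proof (cases i)
  case 0
  have S: "smooth p q (\<lambda>z a. - (sin ((\<zeta> z a + \<eta> z a) / 2) * sinc ((\<zeta> z a - \<eta> z a) / 2)))"
    and C: "smooth p q (\<lambda>z a. cos ((\<zeta> z a + \<eta> z a) / 2) * sinc ((\<zeta> z a - \<eta> z a) / 2))"
    using assms by (auto intro!: smooth_uminus smooth_mult smooth_sin smooth_cos smooth_sinc smooth_divide smooth_add smooth_diff smooth_const)
  have q: "0 < q" using assms by simp
  note lam = smooth_lam[OF assms(1) q] and cs = smooth_cos_a[OF q, of p] and sn = smooth_sin_a[OF q, of p]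
  consider "k = 0" | "k = 1" | "k \<noteq> 0" "k \<noteq> 1" by blast
  then show ?thesis
  proof cases
    case 1
    show ?thesis
      unfolding 0 Dvec_0 1 if_True simp_thms
      by (rule smooth_mult[OF lam smooth_diff[OF smooth_mult[OF cs S] smooth_mult[OF sn C]]])
  next
    case 2
    have "smooth p q (\<lambda>z a. lam \<gamma> w z a * (sin (a 0) * - (sin ((\<zeta> z a + \<eta> z a) / 2) * sinc ((\<zeta> z a - \<eta> z a) / 2))
        + cos (a 0) * (cos ((\<zeta> z a + \<eta> z a) / 2) * sinc ((\<zeta> z a - \<eta> z a) / 2))))"
      by (rule smooth_mult[OF lam smooth_add[OF smooth_mult[OF sn S] smooth_mult[OF cs C]]])
    then show ?thesis
      unfolding 0 Dvec_0 2 by (simp del: mult_minus_right)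
  next
    case 3
    then show ?thesis unfolding 0 Dvec_0 by (simp add: smooth_const)
  qed
next
  case (Suc j)
  then show ?thesis
    using assms unfolding Suc Dvec_Suc by (cases "k = j + 2") (auto intro: smooth_beta smooth_const)
qed

text \<open>The two counts of parameters differ by one: \<alpha> at index i+1 brings in
  \<open>a (i + 1)\<close> through the drift and \<open>bcoef\<close>, whereas \<open>Vf\<close> at
  index i+1 only uses \<alpha> at index i. The base case avoids the norm through sinh(x)^2 =
  (cosh(2x) - 1) / 2, an entire series in |\<xi>|^2.\<close>

lemma smooth_alpha_V: "smooth (i + 2) (i + 1) (\<alpha> i) \<and> smooth (i + 2) i (Vf i)"
proof (induction i)
  case 0
  have "smooth 2 0 (\<lambda>z a. (cosh (2 * \<gamma> * norm (xi_of z)) - 1) / 2)"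
    unfolding coshc_norm[symmetric]
    by (intro smooth_divide smooth_diff smooth_series smooth_norm_sq summable_coshc smooth_const) auto
  also have "(\<lambda>z a. (cosh (2 * \<gamma> * norm (xi_of z)) - 1) / 2) = Vf 0"
    using cosh_double[of "\<gamma> * norm (xi_of _)"]
    by (intro ext) (simp add: cosh_square_eq mult.assoc)
  finally show ?case
    by (auto simp: alpha.simps(1)[abs_def] c1_nz numeral_2_eq_2 simp del: V.simps
        intro!: smooth_arctan smooth_divide smooth_c1 smooth_c2)
next
  case (Suc i)
  have A: "smooth (i + 3) (i + 2) (\<alpha> i)" and A': "smooth (i + 3) (i + 1) (\<alpha> i)"
    and Vi: "smooth (i + 3) (i + 2) (Vf i)" and Vi': "smooth (i + 3) (i + 1) (Vf i)"
    using Suc by (auto intro: smooth_mono)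
  have "smooth (i + 3) (i + 2) (\<alpha> (Suc i))"
    unfolding alpha.simps(2)[abs_def]
    by (intro smooth_mult smooth_inverse smooth_diff smooth_add smooth_sum smooth_partial_z[OF A] smooth_partial_a[OF A]
        smooth_partial_z[OF Vi] smooth_const smooth_z smooth_a smooth_Bvec smooth_Dvec A smooth_beta smooth_bcoef beta_nz) auto
  moreover have "smooth (i + 3) (i + 1) (Vf (Suc i))"
    unfolding V.simps(2)[abs_def]
    by (intro smooth_add smooth_mult smooth_power smooth_diff smooth_const smooth_z A' Vi') auto
  ultimately show ?case by (simp add: numeral_3_eq_3 One_nat_def del: alpha.simps V.simps)
qed

lemmas smooth_alpha = smooth_alpha_V[THEN conjunct1] and smooth_V = smooth_alpha_V[THEN conjunct2]

section \<open>Decay of the functions \<open>Vf\<close>\<close>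

lemma smooth_DERIV_z:
  assumes "smooth p q f"
  shows "((\<lambda>t. f (z(k := t)) a) has_real_derivative partial k (\<lambda>z. f z a) z) (at (z k))"
  using smooth_differentiable(1)[OF assms] unfolding partial_def
  by (simp add: DERIV_deriv_iff_real_differentiable)

lemma smooth_DERIV_a:
  assumes "smooth p q f"
  shows "((\<lambda>t. f z (a(k := t))) has_real_derivative partial k (\<lambda>a. f z a) a) (at (a k))"
  using smooth_differentiable(2)[OF assms] unfolding partial_def
  by (simp add: DERIV_deriv_iff_real_differentiable)

text \<open>The arctan of a quotient gives the direction of \<open>cvec\<close> only up to sign. The
  factor \<open>w\<close> in \<open>lam\<close> supplies exactly the missing sign, since
  \<open>c1\<close> has the sign of \<open>w\<close>.\<close>

lemma lam_cos_sin_alpha_0: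
  "lam \<gamma> w z a * cos (\<alpha> 0 z a) = c1 z a" "lam \<gamma> w z a * sin (\<alpha> 0 z a) = c2 z a"
proof -
  let ?x = "c2 z a / c1 z a"
  have "1 + ?x\<^sup>2 = ((c1 z a)\<^sup>2 + (c2 z a)\<^sup>2) / (c1 z a)\<^sup>2"
    using c1_nz[of z a] by (simp add: power_divide field_simps)
  then have s: "sqrt (1 + ?x\<^sup>2) = sqrt ((c1 z a)\<^sup>2 + (c2 z a)\<^sup>2) / \<bar>c1 z a\<bar>"
    by (simp add: real_sqrt_divide)
  have nz: "sqrt ((c1 z a)\<^sup>2 + (c2 z a)\<^sup>2) \<noteq> 0"
    using norm_cvec_pos[of z a] by (metis real_sqrt_gt_0_iff less_irrefl)
  have "lam \<gamma> w z a / sqrt (1 + ?x\<^sup>2) = w * \<bar>c1 z a\<bar>"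
    unfolding s lam_eq using nz c1_nz[of z a] by simp
  then have *: "lam \<gamma> w z a / sqrt (1 + ?x\<^sup>2) = c1 z a"
    by (simp add: w_abs_c1)
  show "lam \<gamma> w z a * cos (\<alpha> 0 z a) = c1 z a"
    using * by (simp add: cos_arctan)
  show "lam \<gamma> w z a * sin (\<alpha> 0 z a) = c2 z a"
    using * c1_nz[of z a] by (simp add: sin_arctan field_simps)
qed

text \<open>In the frame rotated by \<open>a 0\<close> the commanded velocity is \<open>cvec\<close>
  itself. Its constant part \<open>w\<close> cancels the reference velocity, and only the radial
  feedback survives.\<close>

lemma Bvec_0_alpha_0:
  "\<B> 0 z a (\<alpha> 0 z a) 0 = - (tanhc \<gamma> z a * z 0)"
  "\<B> 0 z a (\<alpha> 0 z a) 1 = - (tanhc \<gamma> z a * z 1)"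
proof -
  define C S T where "C = cos (a 0)" and "S = sin (a 0)" and "T = tanhc \<gamma> z a"
  have CS: "C * C + S * S = 1" unfolding C_def S_def by (metis power2_eq_square sin_cos_squared_add2)
  have "\<B> 0 z a (\<alpha> 0 z a) 0 = - (w * C) + (C * (lam \<gamma> w z a * cos (\<alpha> 0 z a)) - S * (lam \<gamma> w z a * sin (\<alpha> 0 z a)))"
    by (simp add: B0_components C_def S_def algebra_simps del: alpha.simps)
  also have "\<dots> = - (w * C) + (C * (w - T * (C * z 0 + S * z 1)) - S * - (T * (C * z 1 - S * z 0)))"
    unfolding lam_cos_sin_alpha_0 cvec_components C_def S_def T_def ..
  also have "\<dots> = - (C * C + S * S) * (T * z 0)" by algebra
  finally show "\<B> 0 z a (\<alpha> 0 z a) 0 = - (tanhc \<gamma> z a * z 0)" by (simp add: CS T_def)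
  have "\<B> 0 z a (\<alpha> 0 z a) 1 = - (w * S) + (S * (lam \<gamma> w z a * cos (\<alpha> 0 z a)) + C * (lam \<gamma> w z a * sin (\<alpha> 0 z a)))"
    by (simp add: B0_components C_def S_def algebra_simps del: alpha.simps)
  also have "\<dots> = - (w * S) + (S * (w - T * (C * z 0 + S * z 1)) + C * - (T * (C * z 1 - S * z 0)))"
    unfolding lam_cos_sin_alpha_0 cvec_components C_def S_def T_def ..
  also have "\<dots> = - (C * C + S * S) * (T * z 1)" by algebra
  finally show "\<B> 0 z a (\<alpha> 0 z a) 1 = - (tanhc \<gamma> z a * z 1)" by (simp add: CS T_def)
qed

lemma partial_V_0:
  assumes "xi_of z \<noteq> 0" "k < 2"
  shows "partial k (\<lambda>z'. Vf 0 z' a) z =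
    2 * sinh (\<gamma> * norm (xi_of z)) * cosh (\<gamma> * norm (xi_of z)) * \<gamma> * z k / norm (xi_of z)"
proof -
  have pos: "0 < (z 0)\<^sup>2 + (z 1)\<^sup>2"
    using assms(1) by (auto simp: xi_of_eq_0_iff sum_power2_gt_zero_iff)
  from assms(2) consider "k = 0" | "k = 1" by linarith
  then show ?thesis
  proof cases
    case 1
    have "((\<lambda>t. (sinh (\<gamma> * sqrt (t\<^sup>2 + (z 1)\<^sup>2)))\<^sup>2) has_real_derivative
      2 * sinh (\<gamma> * norm (xi_of z)) * cosh (\<gamma> * norm (xi_of z)) * \<gamma> * z 0 / norm (xi_of z)) (at (z 0))"
      using pos by (auto intro!: derivative_eq_intros simp: norm_xi_of field_simps)
    then show ?thesis unfolding 1 by (intro partial_eqI) (simp add: norm_xi_of)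
  next
    case 2
    have "((\<lambda>t. (sinh (\<gamma> * sqrt ((z 0)\<^sup>2 + t\<^sup>2)))\<^sup>2) has_real_derivative
      2 * sinh (\<gamma> * norm (xi_of z)) * cosh (\<gamma> * norm (xi_of z)) * \<gamma> * z 1 / norm (xi_of z)) (at (z 1))"
      using pos by (auto intro!: derivative_eq_intros simp: norm_xi_of field_simps)
    then show ?thesis unfolding 2 by (intro partial_eqI) (simp add: norm_xi_of)
  qed
qed

lemma partial_V_Suc_z:
  "partial k (\<lambda>z'. Vf (Suc i) z' a) z = partial k (\<lambda>z'. Vf i z' a) z +
     \<delta> (Suc i) * (z (i + 2) - \<alpha> i z a) * ((if k = i + 2 then 1 else 0) - partial k (\<lambda>z'. \<alpha> i z' a) z)"
proof (rule partial_eqI)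
  have 1: "((\<lambda>t. (z(k := t)) (i + 2)) has_real_derivative (if k = i + 2 then 1 else 0)) (at (z k))"
    by (auto intro!: derivative_eq_intros)
  show "((\<lambda>t. Vf (Suc i) (z(k := t)) a) has_real_derivative
     partial k (\<lambda>z'. Vf i z' a) z + \<delta> (Suc i) * (z (i + 2) - \<alpha> i z a) *
       ((if k = i + 2 then 1 else 0) - partial k (\<lambda>z'. \<alpha> i z' a) z)) (at (z k))"
    unfolding V.simps
    by (rule derivative_eq_intros smooth_DERIV_z[OF smooth_V] smooth_DERIV_z[OF smooth_alpha] 1 refl)+ simp
qed

lemma partial_V_Suc_a:
  "partial k (\<lambda>a'. Vf (Suc i) z a') a = partial k (\<lambda>a'. Vf i z a') a -
     \<delta> (Suc i) * (z (i + 2) - \<alpha> i z a) * partial k (\<lambda>a'. \<alpha> i z a') a"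
proof (rule partial_eqI)
  show "((\<lambda>t. Vf (Suc i) z (a(k := t))) has_real_derivative
     partial k (\<lambda>a'. Vf i z a') a -
     \<delta> (Suc i) * (z (i + 2) - \<alpha> i z a) * partial k (\<lambda>a'. \<alpha> i z a') a) (at (a k))"
    unfolding V.simps
    by (rule derivative_eq_intros smooth_DERIV_a[OF smooth_V] smooth_DERIV_a[OF smooth_alpha] refl)+ simp
qed

lemma sum_lessThan_0_2: "(\<Sum>k<0+2. f k) = f 0 + (f 1 :: real)" for f :: "nat \<Rightarrow> real"
  by (simp add: numeral_2_eq_2 One_nat_def)

text \<open>
  The backstepping identity: if the last error \<open>\<sigma>\<^sub>i\<^sub>+\<^sub>1\<close> were equal to \<open>\<alpha>\<^sub>i\<close>, then \<open>V\<^sub>i\<close> would decay at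
  rate \<open>2 \<gamma>\<close> along the first \<open>i + 2\<close> error equations. The sum over \<open>j\<close> is the contribution of the drift
  \<open>a\<^sub>j' = w a\<^sub>j\<^sub>+\<^sub>1\<close>, and the term with \<open>D\<^sub>i\<close> in \<open>\<alpha>\<^sub>i\<^sub>+\<^sub>1\<close> cancels the cross term caused by
  \<open>\<sigma>\<^sub>i\<^sub>+\<^sub>1 \<noteq> \<alpha>\<^sub>i\<close>.
\<close>

lemma V_decay:
  assumes "i \<le> n"
  shows "(\<Sum>k<i+2. partial k (\<lambda>z'. Vf i z' a) z * \<B> i z a (\<alpha> i z a) k)
    + w * (\<Sum>j<i. partial j (\<lambda>a'. Vf i z a') a * a (j + 1)) = - 2 * \<gamma> * Vf i z a"
  using assms
proof (induction i)
  case 0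
  show ?case
  proof (cases "xi_of z = 0")
    \<comment> \<open>At the origin both sides are zero because the field vanishes there, so the
      derivative formula for \<open>Vf\<close> is used only at points where the norm is
      differentiable.\<close>
    case True
    then have "z 0 = 0" "z 1 = 0" by (auto simp: xi_of_eq_0_iff)
    with True show ?thesis
      unfolding sum_lessThan_0_2 Bvec_0_alpha_0 by simp
  next
    case False
    define r where "r = norm (xi_of z)"
    have r: "r > 0" "(z 0)\<^sup>2 + (z 1)\<^sup>2 = r\<^sup>2" using False
      by (simp add: r_def, simp add: r_def norm_xi_of)
    have P: "partial 0 (\<lambda>z'. Vf 0 z' a) z = 2 * sinh (\<gamma> * r) * cosh (\<gamma> * r) * \<gamma> * z 0 / r"
      "partial 1 (\<lambda>z'. Vf 0 z' a) z = 2 * sinh (\<gamma> * r) * cosh (\<gamma> * r) * \<gamma> * z 1 / r"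
      unfolding r_def by (rule partial_V_0[OF False], simp)+
    have "(\<Sum>k<0+2. partial k (\<lambda>z'. Vf 0 z' a) z * \<B> 0 z a (\<alpha> 0 z a) k)
       = partial 0 (\<lambda>z'. Vf 0 z' a) z * \<B> 0 z a (\<alpha> 0 z a) 0 + partial 1 (\<lambda>z'. Vf 0 z' a) z * \<B> 0 z a (\<alpha> 0 z a) 1"
      by (rule sum_lessThan_0_2)
    \<comment> \<open>The \<open>cosh\<close> cancels the denominator of \<open>tanh\<close> and the
      powers of \<open>r\<close> cancel as well, leaving -2 \<gamma> sinh^2 with no error
      term.\<close>
    also have "\<dots> = (2 * sinh (\<gamma> * r) * cosh (\<gamma> * r) * \<gamma> / r) * - ((tanh (\<gamma> * r) / r) * ((z 0)\<^sup>2 + (z 1)\<^sup>2))"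
      unfolding P Bvec_0_alpha_0 tanhc_eq[OF False] r_def[symmetric]
      by (simp add: power2_eq_square algebra_simps add_divide_distrib)
    also have "\<dots> = - 2 * \<gamma> * Vf 0 z a"
      unfolding r(2) using r(1) by (simp add: tanh_def r_def[symmetric] power2_eq_square)
    finally show ?thesis by simp
  qed
next
  case (Suc i)
  define e where "e = z (i + 2) - \<alpha> i z a"
  define d where "d = \<delta> (Suc i)"
  have d: "d \<noteq> 0" using delta_pos[of "Suc i"] Suc.prems by (auto simp: d_def)
  define PV where "PV = (\<lambda>k. partial k (\<lambda>z'. Vf i z' a) z)"
  define PA where "PA = (\<lambda>k. partial k (\<lambda>z'. \<alpha> i z' a) z)"
  define B where "B = (\<lambda>k. \<B> i z a (z (i + 2)) k)"
  define BA where "BA = (\<lambda>k. \<B> i z a (\<alpha> i z a) k)"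
  define DD where "DD = (\<lambda>k. \<D> i z a (z (i + 2)) (\<alpha> i z a) k)"
  define SA where "SA = (\<Sum>j\<le>i. partial j (\<lambda>a'. \<alpha> i z a') a * a (j + 1))"
  define SV where "SV = (\<Sum>j<i. partial j (\<lambda>a'. Vf i z a') a * a (j + 1))"
  define bb where "bb = bcoef \<gamma> n w (Suc i) z a"
  define be where "be = beta \<gamma> n w (Suc i) z a"
  have B: "B k = BA k + DD k * e" for k
    using Bvec_diff[of i z a "z (i + 2)" k "\<alpha> i z a"] by (simp add: B_def BA_def DD_def e_def)
  have IH: "(\<Sum>k<i+2. PV k * BA k) + w * SV = - 2 * \<gamma> * Vf i z a"
    using Suc by (simp add: PV_def BA_def SV_def)
  have al: "be * \<alpha> (Suc i) z a = (\<Sum>k<i+2. PA k * B k) + w * SA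
     - inverse d * (\<Sum>k<i+2. PV k * DD k) - bb - \<gamma> * e"
    using beta_nz[of "Suc i" z a]
    by (simp add: alpha.simps(2) PA_def B_def SA_def PV_def DD_def bb_def be_def d_def e_def)
  \<comment> \<open>Neither function sees the newly added coordinate, so the derivative of the next
    \<open>Vf\<close> in that direction comes only from the square.\<close>
  have z0: "partial (i + 2) (\<lambda>z'. Vf i z' a) z = 0" "partial (i + 2) (\<lambda>z'. \<alpha> i z' a) z = 0"
    by (rule smooth_partial_z_zero[OF smooth_V] smooth_partial_z_zero[OF smooth_alpha], simp)+
  \<comment> \<open>\<open>Vf\<close> at index \<open>i\<close> depends on the parameters below
    \<open>i\<close> only; its sum over j < i may be extended to j = i, to match the sum for
    \<alpha>.\<close>
  have a0: "partial i (\<lambda>a'. Vf i z a') a = 0"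
    by (rule smooth_partial_a_zero[OF smooth_V], simp)
  have "(\<Sum>k<Suc i+2. partial k (\<lambda>z'. Vf (Suc i) z' a) z * \<B> (Suc i) z a (\<alpha> (Suc i) z a) k)
     = (\<Sum>k<i+2. (PV k - d * e * PA k) * B k) + d * e * (bb + be * \<alpha> (Suc i) z a)"
    unfolding partial_V_Suc_z
    by (simp add: z0 z0[simplified] One_nat_def PV_def PA_def B_def d_def e_def bb_def be_def del: V.simps alpha.simps)
  also have "(\<Sum>k<i+2. (PV k - d * e * PA k) * B k) = (\<Sum>k<i+2. PV k * B k) - d * e * (\<Sum>k<i+2. PA k * B k)"
    by (simp add: algebra_simps sum_subtractf sum_distrib_left)
  also have "(\<Sum>k<i+2. PV k * B k) = (\<Sum>k<i+2. PV k * BA k) + (\<Sum>k<i+2. PV k * DD k) * e"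
    unfolding B by (simp add: algebra_simps sum.distrib sum_distrib_left)
  finally have 1: "(\<Sum>k<Suc i+2. partial k (\<lambda>z'. Vf (Suc i) z' a) z * \<B> (Suc i) z a (\<alpha> (Suc i) z a) k)
    = (\<Sum>k<i+2. PV k * BA k) + (\<Sum>k<i+2. PV k * DD k) * e - d * e * (\<Sum>k<i+2. PA k * B k)
      + d * e * (bb + be * \<alpha> (Suc i) z a)" .
  have 2: "(\<Sum>j<Suc i. partial j (\<lambda>a'. Vf (Suc i) z a') a * a (j + 1)) = SV - d * e * SA"
  proof -
    have "(\<Sum>j<Suc i. partial j (\<lambda>a'. Vf (Suc i) z a') a * a (j + 1)) =
      (\<Sum>j<Suc i. partial j (\<lambda>a'. Vf i z a') a * a (j + 1)) - d * e * (\<Sum>j<Suc i. partial j (\<lambda>a'. \<alpha> i z a') a * a (j + 1))"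
      unfolding partial_V_Suc_a sum_distrib_left
      by (simp add: d_def e_def left_diff_distrib sum_subtractf mult.assoc del: sum.lessThan_Suc)
    also have "(\<Sum>j<Suc i. partial j (\<lambda>a'. Vf i z a') a * a (j + 1)) = SV"
      by (simp add: SV_def a0)
    finally show ?thesis by (simp add: SA_def lessThan_Suc_atMost)
  qed
  have 3: "d * inverse d = 1" using d by simp
  have V: "Vf (Suc i) z a = Vf i z a + 1/2 * d * e\<^sup>2"
    by (simp add: d_def e_def)
  show ?case
  proof -
    define X Y P where "X = (\<Sum>k<i+2. PV k * BA k)" and "Y = (\<Sum>k<i+2. PV k * DD k)"
      and "P = (\<Sum>k<i+2. PA k * B k)"
    \<comment> \<open>The motion of \<alpha> is fed forward and drops out, the terms with
      \<open>Y\<close> cancel through the weight \<open>inverse d\<close>, and the new square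
      contributes - \<gamma> d e^2, which is -2 \<gamma> times its own value d e^2 / 2.\<close>
    have "X + Y * e - d * e * P + d * e * (bb + (P + w * SA - inverse d * Y - bb - \<gamma> * e))
        + w * (SV - d * e * SA)
      = (X + w * SV) + Y * e * (1 - d * inverse d) - \<gamma> * d * e\<^sup>2"
      by (simp add: algebra_simps power2_eq_square)
    also have "\<dots> = - 2 * \<gamma> * (Vf i z a + 1/2 * d * e\<^sup>2)"
      using IH 3 by (simp add: X_def algebra_simps)
    finally show ?thesis
      unfolding 1 2 al V X_def Y_def P_def .
  qed
qed

section \<open>The equilibrium, and what a bound on \<open>Vf\<close> says about the errors\<close>

lemma lam_origin: "z 0 = 0 \<Longrightarrow> z 1 = 0 \<Longrightarrow> lam \<gamma> w z a = w"
  using w_cases by (auto simp: lam_eq cvec_components)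

lemma Bvec_origin: "(\<And>k. k < i + 2 \<Longrightarrow> z k = 0) \<Longrightarrow> \<B> i z a 0 k = 0"
proof (induction i arbitrary: k)
  case 0
  then show ?case by (simp add: B0_components lam_origin)
next
  case (Suc i)
  then have "lam \<gamma> w z a = w" by (intro lam_origin) auto
  with Suc show ?case by (simp add: bcoef_def)
qed

lemma V_Suc_ge: "i < n \<Longrightarrow> Vf i z a \<le> Vf (Suc i) z a"
  using delta_pos[of "Suc i"] by simp

lemma V_mono: "i \<le> j \<Longrightarrow> j \<le> n \<Longrightarrow> Vf i z a \<le> Vf j z a"
proof (induction j rule: dec_induct)
  case (step j)
  then show ?case using V_Suc_ge[of j z a] by linarith
qed simp

lemma V_nonneg: "i \<le> n \<Longrightarrow> 0 \<le> Vf i z a"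
  using V_mono[of 0 i z a] by (simp add: order.trans[rotated])

text \<open>Every term of the recursion vanishes at zero error: \<alpha> is zero there for all
  parameters, hence so are its derivatives in \<open>a\<close>, and \<open>Vf\<close> attains its
  minimum 0 there, hence its gradient is zero. Generality in \<open>a\<close> is essential for the
  induction.\<close>

lemma alpha_V_origin:
  "i \<le> n \<Longrightarrow> (\<And>k. k < i + 2 \<Longrightarrow> z k = 0) \<Longrightarrow> \<alpha> i z a = 0 \<and> Vf i z a = 0"
proof (induction i arbitrary: a)
  case 0
  then have "z 0 = 0" "z 1 = 0" by auto
  then show ?case by (simp add: cvec_components xi_of_eq_0_iff[THEN iffD2])
next
  case (Suc i)
  have IH: "\<alpha> i z a' = 0" "Vf i z a' = 0" for a'
    using Suc by auto
  have z: "z (i + 2) = 0" and lam: "lam \<gamma> w z a = w"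
    using Suc.prems by (auto intro: lam_origin)
  have 1: "partial j (\<lambda>a'. \<alpha> i z a') a = 0" for j
    by (rule partial_eqI) (simp add: IH)
  have 2: "partial k (\<lambda>z'. Vf i z' a) z = 0" for k
  proof (rule DERIV_local_min[OF smooth_DERIV_z[OF smooth_V], of 1])
    show "\<forall>y. \<bar>z k - y\<bar> < 1 \<longrightarrow> Vf i (z(k := z k)) a \<le> Vf i (z(k := y)) a"
      using V_nonneg Suc.prems(1) by (simp add: IH)
  qed simp
  have 3: "\<B> i z a (z (i + 2)) k = 0" for k
    unfolding z using Suc.prems by (intro Bvec_origin) auto
  have 4: "bcoef \<gamma> n w (Suc i) z a = 0"
    by (simp add: bcoef_def lam)
  have "\<alpha> (Suc i) z a = 0"
    unfolding alpha.simps(2) 1 2 3 4 IH by (simp add: z[simplified])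
  moreover have "Vf (Suc i) z a = 0"
    unfolding V.simps(2) IH z by simp
  ultimately show ?case by blast
qed

lemma le_sinh: "0 \<le> x \<Longrightarrow> x \<le> sinh (x::real)"
proof (cases "x = 0")
  case False
  assume "0 \<le> x"
  with False have "0 < x" by simp
  moreover have "(sinh has_real_derivative cosh y) (at y)" for y :: real
    by (auto intro!: derivative_eq_intros)
  ultimately obtain c where "sinh x - sinh 0 = (x - 0) * cosh c"
    using MVT2[of 0 x sinh cosh] by blast
  then show ?thesis
    using mult_left_mono[OF cosh_real_ge_1[of c] \<open>0 \<le> x\<close>] by simp
qed simp

text \<open>By x \<le> sinh x, the size of \<xi> is controlled by the square root of the first
  summand of \<open>Vf n\<close>.\<close>

lemma xi_le_V:
  assumes "k < 2" shows "\<bar>z k\<bar> \<le> sqrt (Vf n z a) / \<gamma>"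
proof -
  define r where "r = norm (xi_of z)"
  have "\<bar>z k\<bar> \<le> r"
  proof -
    have "k = 0 \<or> k = 1" using assms by auto
    then show ?thesis by (auto simp: r_def norm_xi_of intro: real_le_rsqrt)
  qed
  also have "r \<le> sinh (\<gamma> * r) / \<gamma>"
    using le_sinh[of "\<gamma> * r"] gamma_pos by (simp add: r_def field_simps)
  also have "sinh (\<gamma> * r) = sqrt (Vf 0 z a)"
    using gamma_pos by (simp add: r_def)
  also have "\<dots> / \<gamma> \<le> sqrt (Vf n z a) / \<gamma>"
    using V_mono[of 0 n z a] gamma_pos by (intro divide_right_mono real_sqrt_le_mono) auto
  finally show ?thesis .
qed

lemma sigma_le_V:
  assumes "i < n" shows "\<bar>z (i + 2) - \<alpha> i z a\<bar> \<le> sqrt (2 * Vf n z a / \<delta> (Suc i))"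
proof (rule real_le_rsqrt)
  have d: "0 < \<delta> (Suc i)" using delta_pos assms by auto
  have "\<delta> (Suc i) / 2 * (z (i + 2) - \<alpha> i z a)\<^sup>2 \<le> Vf n z a"
    using V_mono[of "Suc i" n z a] V_nonneg[of i z a] assms by (simp del: alpha.simps)
  with d show "\<bar>z (i + 2) - \<alpha> i z a\<bar>\<^sup>2 \<le> 2 * Vf n z a / \<delta> (Suc i)"
    by (simp add: field_simps)
qed

lemma abox_mono: "a \<in> abox q K \<Longrightarrow> q' \<le> q \<Longrightarrow> a \<in> abox q' K"
  by (auto simp: abox_def)

text \<open>\<open>Vf\<close> measures \<sigma> only relative to \<alpha>, so the bounds are
  obtained in the order of the recursion: on the box found so far \<alpha> is bounded uniformly in
  the angle, and adding the deviation permitted by \<open>Vf\<close> bounds the next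
  coordinate.\<close>

lemma V_bounded_imp_zbox:
  "\<exists>R\<ge>0. \<forall>z. \<forall>a\<in>abox (n + 1) K. Vf n z a \<le> v \<longrightarrow> z \<in> zbox (n + 2) R"
proof -
  have "\<exists>R\<ge>0. \<forall>z. \<forall>a\<in>abox (n + 1) K. Vf n z a \<le> v \<longrightarrow> z \<in> zbox (i + 2) R" if "i \<le> n" for i
    using that
  proof (induction i)
    case 0
    have "z \<in> zbox (0 + 2) (sqrt \<bar>v\<bar> / \<gamma>)" if "Vf n z a \<le> v" for z a
    proof -
      have "sqrt (Vf n z a) / \<gamma> \<le> sqrt \<bar>v\<bar> / \<gamma>"
        using that gamma_pos by (intro divide_right_mono real_sqrt_le_mono) auto
      then show ?thesis
        using order.trans[OF xi_le_V[of _ z a]] unfolding zbox_def by simp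
    qed
    then show ?case
      using gamma_pos by (intro exI[of _ "sqrt \<bar>v\<bar> / \<gamma>"]) auto
  next
    case (Suc i)
    then obtain R where R: "R \<ge> 0" "\<And>z a. a \<in> abox (n + 1) K \<Longrightarrow> Vf n z a \<le> v \<Longrightarrow> z \<in> zbox (i + 2) R"
      by force
    obtain B where B: "B \<ge> 0" "\<And>z a. z \<in> zbox (i + 2) R \<Longrightarrow> a \<in> abox (i + 1) K \<Longrightarrow> \<bar>\<alpha> i z a\<bar> \<le> B"
      using smooth_bounded[OF smooth_alpha[of i], where R = R and K = K] by blast
    define R' where "R' = max R (B + sqrt (2 * \<bar>v\<bar> / \<delta> (Suc i)))"
    have "z \<in> zbox (Suc i + 2) R'" if a: "a \<in> abox (n + 1) K" and v: "Vf n z a \<le> v" for z a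
    proof -
      have z: "z \<in> zbox (i + 2) R" using R a v by blast
      have "sqrt (2 * Vf n z a / \<delta> (Suc i)) \<le> sqrt (2 * \<bar>v\<bar> / \<delta> (Suc i))"
        using v delta_pos[of "Suc i"] Suc.prems by (intro real_sqrt_le_mono divide_right_mono) auto
      moreover have "\<bar>\<alpha> i z a\<bar> \<le> B"
        using B(2)[OF z abox_mono[OF a]] Suc.prems by simp
      moreover have "\<bar>z (i + 2) - \<alpha> i z a\<bar> \<le> sqrt (2 * Vf n z a / \<delta> (Suc i))"
        by (rule sigma_le_V) (use Suc.prems in simp)
      ultimately have "\<bar>z (i + 2)\<bar> \<le> B + sqrt (2 * \<bar>v\<bar> / \<delta> (Suc i))"
        by linarith
      then have "\<bar>z (i + 2)\<bar> \<le> R'"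
        unfolding R'_def by (rule order.trans) simp
      moreover have "\<bar>z k\<bar> \<le> R'" if "k < i + 2" for k
        using z that unfolding zbox_def R'_def by (auto simp: le_max_iff_disj)
      ultimately show ?thesis
        unfolding zbox_def by (auto simp: less_Suc_eq)
    qed
    moreover have "R' \<ge> 0" using R(1) by (simp add: R'_def)
    ultimately show ?case by blast
  qed
  then show ?thesis by blast
qed

text \<open>The parameters \<open>A t\<close> need not converge, so continuity of \<open>f\<close>
  is not enough; the Lipschitz estimate in \<open>z\<close>, uniform over \<open>abox\<close>,
  replaces it.\<close>

lemma smooth_tendsto_origin:
  assumes f: "smooth p q f" and f0: "\<And>z a. (\<And>k. k < p \<Longrightarrow> z k = 0) \<Longrightarrow> f z a = c"
    and z: "\<And>k. k < p \<Longrightarrow> ((\<lambda>t. Z t k) \<longlongrightarrow> 0) F" and a: "\<forall>\<^sub>F t in F. A t \<in> abox q K"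
  shows "((\<lambda>t. f (Z t) (A t)) \<longlongrightarrow> c) F"
proof -
  obtain L where L: "\<And>z z' a. z \<in> zbox p 1 \<Longrightarrow> z' \<in> zbox p 1 \<Longrightarrow> a \<in> abox q K \<Longrightarrow>
      \<bar>f z a - f z' a\<bar> \<le> L * (\<Sum>k<p. \<bar>z k - z' k\<bar>)"
    using smooth_lipschitz[OF f, of 1 K] by blast
  have "((\<lambda>t. L * (\<Sum>k<p. \<bar>Z t k\<bar>)) \<longlongrightarrow> L * (\<Sum>k<p. \<bar>0\<bar>)) F"
    using z by (intro tendsto_intros) auto
  then have lim: "((\<lambda>t. L * (\<Sum>k<p. \<bar>Z t k\<bar>)) \<longlongrightarrow> 0) F" by simp
  have "\<forall>\<^sub>F t in F. \<forall>k\<in>{..<p}. \<bar>Z t k\<bar> < 1"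
    using tendstoD[OF z, of _ 1] by (intro eventually_ball_finite) (auto simp: dist_real_def)
  with a have "\<forall>\<^sub>F t in F. norm (f (Z t) (A t) - c) \<le> L * (\<Sum>k<p. \<bar>Z t k\<bar>)"
  proof eventually_elim
    case (elim t)
    then have "\<bar>f (Z t) (A t) - f (\<lambda>_. 0) (A t)\<bar> \<le> L * (\<Sum>k<p. \<bar>Z t k - 0\<bar>)"
      by (intro L) (auto simp: zbox_def less_imp_le)
    then show ?case using f0[of "\<lambda>_. 0" "A t"] by simp
  qed
  from Lim_null_comparison[OF this lim] show ?thesis
    by (rule LIM_zero_cancel)
qed

text \<open>Same order as for the bounds: once the earlier coordinates tend to 0, so does \<alpha>,
  because it vanishes at the origin uniformly in the parameters, and \<open>Vf\<close> forces the
  next coordinate to follow \<alpha>.\<close>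

lemma V_tendsto_0_imp:
  assumes V: "((\<lambda>t. Vf n (Z t) (A t)) \<longlongrightarrow> 0) F" and a: "\<forall>\<^sub>F t in F. A t \<in> abox (n + 1) K"
    and k: "k < n + 2"
  shows "((\<lambda>t. Z t k) \<longlongrightarrow> 0) F"
proof -
  have "\<forall>k<i + 2. ((\<lambda>t. Z t k) \<longlongrightarrow> 0) F" if "i \<le> n" for i
    using that
  proof (induction i)
    case 0
    have "((\<lambda>t. sqrt (Vf n (Z t) (A t)) / \<gamma>) \<longlongrightarrow> sqrt 0 / \<gamma>) F"
      using V gamma_pos by (intro tendsto_intros) auto
    then show ?case
      by (auto intro!: Lim_null_comparison[of _ "\<lambda>t. sqrt (Vf n (Z t) (A t)) / \<gamma>"] always_eventually xi_le_V)
  next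
    case (Suc i)
    have "((\<lambda>t. sqrt (2 * Vf n (Z t) (A t) / \<delta> (Suc i))) \<longlongrightarrow> sqrt (2 * 0 / \<delta> (Suc i))) F"
      using V delta_pos[of "Suc i"] Suc.prems by (intro tendsto_intros) auto
    then have "((\<lambda>t. sqrt (2 * Vf n (Z t) (A t) / \<delta> (Suc i))) \<longlongrightarrow> 0) F"
      by simp
    moreover have "\<forall>\<^sub>F t in F. norm (Z t (i + 2) - \<alpha> i (Z t) (A t)) \<le> sqrt (2 * Vf n (Z t) (A t) / \<delta> (Suc i))"
      unfolding real_norm_def by (intro always_eventually allI sigma_le_V) (use Suc.prems in simp)
    ultimately have "((\<lambda>t. Z t (i + 2) - \<alpha> i (Z t) (A t)) \<longlongrightarrow> 0) F"
      by (rule Lim_null_comparison[rotated])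
    moreover have "((\<lambda>t. \<alpha> i (Z t) (A t)) \<longlongrightarrow> 0) F"
    proof (rule smooth_tendsto_origin[OF smooth_alpha])
      show "\<forall>\<^sub>F t in F. A t \<in> abox (i + 1) K"
        using a by eventually_elim (rule abox_mono, use Suc.prems in auto)
    qed (use Suc alpha_V_origin[of i] in \<open>simp_all del: alpha.simps V.simps\<close>)
    ultimately have "((\<lambda>t. (Z t (i + 2) - \<alpha> i (Z t) (A t)) + \<alpha> i (Z t) (A t)) \<longlongrightarrow> 0 + 0) F"
      by (rule tendsto_add)
    then have "((\<lambda>t. Z t (i + 2)) \<longlongrightarrow> 0) F"
      by simp
    then show ?case
      using Suc by (auto simp: less_Suc_eq)
  qed
  then show ?thesis using k by blast
qed

end

section \<open>The error system\<close>

lemma integral_has_vector_derivative_halfline: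
  fixes f :: "real \<Rightarrow> 'a::banach"
  assumes "continuous_on {0..} f" "0 \<le> t"
  shows "((\<lambda>u. integral {0..u} f) has_vector_derivative f t) (at t within {0..})"
proof -
  have "((\<lambda>u. integral {0..u} f) has_vector_derivative f t) (at t within {0..t+1})"
    using assms by (intro integral_has_vector_derivative) (auto intro: continuous_on_subset)
  moreover have "at t within {0..t+1} = at t within {0..}"
    by (rule at_within_nhd[of t "{..<t+1}"]) auto
  ultimately show ?thesis by simp
qed

text \<open>
  In the norm \<open>sup\<^sub>t e\<^bsup>-2Lt\<^esup> |x(t)|\<close> the Picard operator is a contraction on the whole half-line. Below,
  \<open>\<phi>\<close> is the weighted function, that is, \<open>x(t) = e\<^bsup>2Lt\<^esup> \<phi>(t)\<close>.
\<close>

lemma picard_global: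
  fixes g :: "real \<Rightarrow> 'v::euclidean_space \<Rightarrow> 'v"
  assumes cont: "continuous_on ({0..} \<times> UNIV) (\<lambda>(t, x). g t x)"
    and bnd: "\<And>t x. 0 \<le> t \<Longrightarrow> norm (g t x) \<le> B"
    and L: "0 < L"
    and lip: "\<And>t x y. 0 \<le> t \<Longrightarrow> norm (g t x - g t y) \<le> L * norm (x - y)"
  shows "\<exists>x. x 0 = x0 \<and> (\<forall>t\<ge>0. (x has_vector_derivative g t (x t)) (at t within {0..}))"
proof -
  define h where "h \<phi> s = g s (exp (2 * L * s) *\<^sub>R apply_bcontfun \<phi> s)" for \<phi> :: "real \<Rightarrow>\<^sub>C 'v" and s
  define I where "I \<phi> t = x0 + integral {0..t} (h \<phi>)" for \<phi> t
  have hcont: "continuous_on {0..} (h \<phi>)" for \<phi>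
  proof -
    have "continuous_on {0..} (\<lambda>s. (s, exp (2 * L * s) *\<^sub>R apply_bcontfun \<phi> s))"
      by (intro continuous_intros continuous_on_apply_bcontfun)
    then have "continuous_on {0..} (\<lambda>s. case (s, exp (2 * L * s) *\<^sub>R apply_bcontfun \<phi> s) of (t, x) \<Rightarrow> g t x)"
      by (rule continuous_on_compose2[OF cont]) auto
    then show ?thesis by (simp add: h_def[abs_def])
  qed
  have Ider: "(I \<phi> has_vector_derivative h \<phi> t) (at t within {0..})" if "0 \<le> t" for \<phi> t
    unfolding I_def[abs_def]
    using has_vector_derivative_add[OF has_vector_derivative_const
        integral_has_vector_derivative_halfline[OF hcont that], of x0 \<phi>] by simp
  have Icont: "continuous_on {0..} (I \<phi>)" for \<phi>
    using Ider by (auto intro: has_vector_derivative_continuous simp: continuous_on_eq_continuous_within)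
  have hint: "h \<phi> integrable_on {0..t}" for \<phi> t
    by (intro integrable_continuous_real continuous_on_subset[OF hcont]) auto
  have B0: "0 \<le> B" using order.trans[OF norm_ge_zero bnd[of 0 0]] by simp
  \<comment> \<open>Bounded continuous functions are defined on the whole real line, so the operator
    is extended to negative times by its value at 0. Boundedness holds because the exponential
    weight beats the linear growth of the integral.\<close>
  define Q where "Q \<phi> t = exp (- 2 * L * max 0 t) *\<^sub>R I \<phi> (max 0 t)" for \<phi> t
  have Qb: "norm (Q \<phi> t) \<le> norm x0 + B / (2 * L)" for \<phi> t
  proof -
    define s where "s = max 0 t"
    have s: "0 \<le> s" by (simp add: s_def)
    have "norm (integral {0..s} (h \<phi>)) \<le> integral {0..s} (\<lambda>_. B)"
      by (intro Henstock_Kurzweil_Integration.integral_norm_bound_integral hint) (auto simp: h_def bnd)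
    then have "norm (I \<phi> s) \<le> norm x0 + s * B"
      unfolding I_def using s by (intro norm_triangle_le) simp
    then have "norm (Q \<phi> t) \<le> exp (- 2 * L * s) * (norm x0 + s * B)"
      unfolding Q_def s_def[symmetric] by simp
    also have "\<dots> = exp (- 2 * L * s) * norm x0 + (exp (- 2 * L * s) * s) * B"
      by (simp add: algebra_simps)
    also have "\<dots> \<le> 1 * norm x0 + (1 / (2 * L)) * B"
    proof (intro add_mono mult_right_mono B0)
      have "2 * L * s \<le> exp (2 * L * s)"
        using exp_ge_add_one_self[of "2 * L * s"] by linarith
      then show "exp (- 2 * L * s) * s \<le> 1 / (2 * L)"
        using L by (simp add: exp_minus field_simps)
    qed (use L s in auto)
    finally show ?thesis by simp
  qed
  have Qc: "continuous_on UNIV (Q \<phi>)" for \<phi>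
  proof -
    have "continuous_on UNIV (\<lambda>t. I \<phi> (max 0 t))"
    proof (rule continuous_on_compose2[OF Icont])
      show "(\<lambda>t. max 0 t) ` UNIV \<subseteq> {0::real..}" by (rule image_subsetI) simp
    qed (intro continuous_intros)
    then show ?thesis
      unfolding Q_def[abs_def] by (intro continuous_intros)
  qed
  have "Q \<phi> \<in> bcontfun" for \<phi>
    using Qb Qc unfolding bcontfun_def by (auto intro: boundedI)
  then have P: "apply_bcontfun (Bcontfun (Q \<phi>)) t = Q \<phi> t" for \<phi> t
    by (simp add: Bcontfun_inverse)
  define P where "P \<phi> = Bcontfun (Q \<phi>)" for \<phi>
  note P = P[folded P_def]
  \<comment> \<open>The factor 2 in the weight produces the contraction constant: the integral of L
    exp(2 L r) over [0, s] is at most exp(2 L s) / 2.\<close>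
  have "dist (P \<phi>) (P \<psi>) \<le> 1/2 * dist \<phi> \<psi>" for \<phi> \<psi>
  proof (rule dist_bound)
    fix t :: real
    define s where "s = max 0 t"
    define D where "D = dist \<phi> \<psi>"
    have s: "0 \<le> s" by (simp add: s_def)
    have D: "0 \<le> D" by (simp add: D_def)
    have "((\<lambda>r. L * (exp (2 * L * r) * D)) has_integral (exp (2 * L * s) * D / 2 - exp (2 * L * 0) * D / 2)) {0..s}"
    proof (rule fundamental_theorem_of_calculus[OF s])
      fix r
      have "((\<lambda>r. exp (2 * L * r) * D / 2) has_real_derivative L * (exp (2 * L * r) * D)) (at r within {0..s})"
        by (auto intro!: derivative_eq_intros)
      then show "((\<lambda>r. exp (2 * L * r) * D / 2) has_vector_derivative L * (exp (2 * L * r) * D)) (at r within {0..s})"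
        by (simp add: has_real_derivative_iff_has_vector_derivative)
    qed
    note int = this
    have "I \<phi> s - I \<psi> s = integral {0..s} (\<lambda>r. h \<phi> r - h \<psi> r)"
      unfolding I_def by (simp add: Henstock_Kurzweil_Integration.integral_diff hint)
    also have "norm \<dots> \<le> integral {0..s} (\<lambda>r. L * (exp (2 * L * r) * D))"
    proof (intro Henstock_Kurzweil_Integration.integral_norm_bound_integral integrable_diff hint)
      show "(\<lambda>r. L * (exp (2 * L * r) * D)) integrable_on {0..s}"
        using int by blast
      fix r assume "r \<in> {0..s}"
      then have "norm (h \<phi> r - h \<psi> r) \<le>
          L * norm (exp (2 * L * r) *\<^sub>R apply_bcontfun \<phi> r - exp (2 * L * r) *\<^sub>R apply_bcontfun \<psi> r)"
        unfolding h_def by (intro lip) auto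
      also have "\<dots> = L * (exp (2 * L * r) * dist (apply_bcontfun \<phi> r) (apply_bcontfun \<psi> r))"
        by (simp add: dist_norm flip: scaleR_right_diff_distrib)
      also have "\<dots> \<le> L * (exp (2 * L * r) * D)"
        unfolding D_def using L by (intro mult_left_mono dist_bounded) auto
      finally show "norm (h \<phi> r - h \<psi> r) \<le> L * (exp (2 * L * r) * D)" .
    qed
    also have "\<dots> = exp (2 * L * s) * D / 2 - D / 2"
      using integral_unique[OF int] by simp
    finally have "norm (I \<phi> s - I \<psi> s) \<le> exp (2 * L * s) * D / 2"
      using D by linarith
    then have "exp (- 2 * L * s) * norm (I \<phi> s - I \<psi> s) \<le> exp (- 2 * L * s) * (exp (2 * L * s) * D / 2)"
      by (intro mult_left_mono) auto
    also have "\<dots> = 1/2 * D"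
      by (simp add: exp_minus)
    finally show "dist (apply_bcontfun (P \<phi>) t) (apply_bcontfun (P \<psi>) t) \<le> 1/2 * dist \<phi> \<psi>"
      unfolding P Q_def s_def[symmetric] D_def[symmetric]
      by (simp add: dist_norm flip: scaleR_right_diff_distrib)
  qed
  then have "\<exists>!\<phi>. P \<phi> = \<phi>"
    by (intro banach_fix_type[of "1/2"]) auto
  then obtain \<phi> where \<phi>: "P \<phi> = \<phi>" by blast
  have "exp (2 * L * t) *\<^sub>R apply_bcontfun \<phi> t = I \<phi> t" if "0 \<le> t" for t
  proof -
    have "apply_bcontfun \<phi> t = exp (- 2 * L * t) *\<^sub>R I \<phi> t"
      using P[of \<phi> t] that by (simp add: \<phi> Q_def)
    then show ?thesis by (simp add: exp_minus)
  qed
  then have "(I \<phi> has_vector_derivative g t (I \<phi> t)) (at t within {0..})" if "0 \<le> t" for t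
    using Ider[OF that, of \<phi>] that by (simp add: h_def)
  moreover have "I \<phi> 0 = x0" by (simp add: I_def)
  ultimately show ?thesis by blast
qed

text \<open>Tuples are identified with vectors of \<open>'v\<close> through an enumeration of its
  basis. Padding the coordinates with zeros beyond \<open>N\<close> makes the passage from vectors
  to tuples continuous for the product topology, in which \<open>g\<close> is assumed
  continuous.\<close>

lemma picard_coordinates:
  fixes g :: "real \<Rightarrow> (nat \<Rightarrow> real) \<Rightarrow> nat \<Rightarrow> real"
  assumes N: "DIM('v::euclidean_space) = N"
    and cont: "\<And>k. k < N \<Longrightarrow> continuous_on ({0..} \<times> UNIV) (\<lambda>(t, z). g t z k)"
    and bnd: "\<And>t z k. k < N \<Longrightarrow> 0 \<le> t \<Longrightarrow> \<bar>g t z k\<bar> \<le> B"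
    and L: "0 < L"
    and lip: "\<And>t z z' k. k < N \<Longrightarrow> 0 \<le> t \<Longrightarrow> \<bar>g t z k - g t z' k\<bar> \<le> L * (\<Sum>i<N. \<bar>z i - z' i\<bar>)"
  shows "\<exists>Z. (\<forall>k<N. Z 0 k = z0 k) \<and>
    (\<forall>t\<ge>0. \<forall>k<N. ((\<lambda>s. Z s k) has_real_derivative g t (Z t) k) (at t within {0..}))"
proof -
  obtain b :: "nat \<Rightarrow> 'v" where b: "bij_betw b {0..<N} Basis"
    using ex_bij_betw_nat_finite[of "Basis :: 'v set"] N by auto
  have bB: "b k \<in> Basis" if "k < N" for k
    using b that by (auto simp: bij_betw_def)
  have bb: "b i \<bullet> b k = (if i = k then 1 else 0)" if "i < N" "k < N" for i k
    using that bB b by (auto simp: inner_Basis bij_betw_def inj_on_def)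
  define co where "co v k = (if k < N then v \<bullet> b k else 0)" for v k
  define ve where "ve c = (\<Sum>k<N. c k *\<^sub>R b k)" for c :: "nat \<Rightarrow> real"
  have co_ve: "ve c \<bullet> b k = c k" if "k < N" for c k
  proof -
    have "ve c \<bullet> b k = (\<Sum>i<N. c i * (if i = k then 1 else 0))"
      unfolding ve_def inner_sum_left using that by (intro sum.cong) (auto simp: bb)
    then show ?thesis using that by (simp add: if_distrib cong: if_cong)
  qed
  have co_cont: "continuous_on UNIV co"
  proof (rule continuous_on_coordinatewise_then_product)
    show "continuous_on UNIV (\<lambda>v. co v i)" for i
      unfolding co_def by (cases "i < N") (auto intro!: continuous_intros)
  qed
  define G where "G t v = ve (g t (co v))" for t v
  have n1: "norm (ve c) \<le> real N * M" if "\<And>k. k < N \<Longrightarrow> \<bar>c k\<bar> \<le> M" for c M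
  proof -
    have "norm (ve c) \<le> (\<Sum>k<N. M)"
      unfolding ve_def using that bB by (intro sum_norm_le) auto
    then show ?thesis by simp
  qed
  have "\<exists>x. x 0 = ve z0 \<and> (\<forall>t\<ge>0. (x has_vector_derivative G t (x t)) (at t within {0..}))"
  proof (rule picard_global)
    have "continuous_on ({0..} \<times> UNIV) (\<lambda>p. g (fst p) (co (snd p)) k)" if "k < N" for k
    proof -
      have "continuous_on ({0..} \<times> UNIV) (\<lambda>p::real \<times> 'v. (fst p, co (snd p)))"
        by (intro continuous_intros continuous_on_compose2[OF co_cont]) auto
      moreover have "(\<lambda>p::real \<times> 'v. (fst p, co (snd p))) ` ({0..} \<times> UNIV) \<subseteq> {0..} \<times> UNIV"
        by auto
      ultimately have "continuous_on ({0..} \<times> UNIV)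
          (\<lambda>p::real \<times> 'v. case (fst p, co (snd p)) of (t, z) \<Rightarrow> g t z k)"
        by (rule continuous_on_compose2[OF cont[OF that]])
      then show ?thesis by simp
    qed
    then show "continuous_on ({0..} \<times> UNIV) (\<lambda>(t, x). G t x)"
      unfolding G_def ve_def case_prod_unfold by (intro continuous_intros) auto
    show "norm (G t x) \<le> real N * B" if "0 \<le> t" for t x
      unfolding G_def by (rule n1) (use that bnd in auto)
    show "0 < real N * (L * real N)"
      using L DIM_positive[where 'a='v] unfolding N by simp
    show "norm (G t x - G t y) \<le> real N * (L * real N) * norm (x - y)" if "0 \<le> t" for t x y
    proof -
      have "(\<Sum>i<N. \<bar>co x i - co y i\<bar>) \<le> (\<Sum>i<N. norm (x - y))"
        by (intro sum_mono) (auto simp: co_def bB Basis_le_norm simp flip: inner_diff_left)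
      then have *: "(\<Sum>i<N. \<bar>co x i - co y i\<bar>) \<le> real N * norm (x - y)" by simp
      have "G t x - G t y = ve (\<lambda>k. g t (co x) k - g t (co y) k)"
        by (simp add: G_def ve_def scaleR_left_diff_distrib sum_subtractf)
      also have "norm \<dots> \<le> real N * (L * (real N * norm (x - y)))"
      proof (rule n1)
        show "\<bar>g t (co x) k - g t (co y) k\<bar> \<le> L * (real N * norm (x - y))" if "k < N" for k
          by (rule order.trans[OF lip[OF that \<open>0 \<le> t\<close>]]) (use * L in auto)
      qed
      finally show ?thesis by (simp add: mult_ac)
    qed
  qed
  then obtain x where x: "x 0 = ve z0" "\<And>t. 0 \<le> t \<Longrightarrow> (x has_vector_derivative G t (x t)) (at t within {0..})"
    by blast
  have "((\<lambda>s. co (x s) k) has_real_derivative g t (co (x t)) k) (at t within {0..})" if "0 \<le> t" "k < N" for t k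
  proof -
    have "((\<lambda>s. x s \<bullet> b k) has_vector_derivative G t (x t) \<bullet> b k) (at t within {0..})"
      by (rule bounded_linear.has_vector_derivative[OF bounded_linear_inner_left x(2)[OF that(1)]])
    then show ?thesis
      using that by (simp add: co_def co_ve G_def has_real_derivative_iff_has_vector_derivative)
  qed
  then show ?thesis
    using x(1) by (intro exI[of _ "\<lambda>t. co (x t)"]) (auto simp: co_def co_ve)
qed

lemma nonincreasing_on_Icc:
  fixes W :: "real \<Rightarrow> real"
  assumes "a \<le> b" "\<And>s. s \<in> {a..b} \<Longrightarrow> (W has_real_derivative W' s) (at s within {a..b})"
    and "\<And>s. s \<in> {a..b} \<Longrightarrow> W' s \<le> 0"
  shows "W b \<le> W a"
proof -
  have "(W has_derivative (\<lambda>h. W' s * h)) (at s within {a..b})" if "a \<le> s" "s \<le> b" for s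
    using assms(2)[of s] that unfolding has_field_derivative_def by simp
  from mvt_very_simple[OF assms(1) this]
  obtain x where "x \<in> {a..b}" "W b - W a = W' x * (b - a)"
    by blast
  moreover have "W' x * (b - a) \<le> 0"
    using assms calculation by (intro mult_nonpos_nonneg) auto
  ultimately show ?thesis by simp
qed

section \<open>A priori bounds, uniqueness and global existence for the errors\<close>

definition error_field ::
  "real \<Rightarrow> (nat \<Rightarrow> real) \<Rightarrow> nat \<Rightarrow> real \<Rightarrow> (nat \<Rightarrow> real) \<Rightarrow> (nat \<Rightarrow> real) \<Rightarrow> nat \<Rightarrow> real" where
  "error_field \<gamma> \<delta> n w z a k = Bvec \<gamma> n w n z a (alpha \<gamma> \<delta> n w n z a) k"

text \<open>The reference is prescribed, so the errors obey a nonautonomous equation with the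
  coefficients \<rho> and \<open>a\<close>. The last parameter \<open>a t n\<close> has no
  differential equation: it is the ratio of the transformed reference inputs and merely
  continuous.\<close>

locale error_system = chained_feedback +
  fixes \<rho> :: "real \<Rightarrow> real" and a :: "real \<Rightarrow> nat \<Rightarrow> real" and c C K :: real
  assumes rho_cont: "continuous_on {0..} \<rho>"
    and c_pos: "0 < c" and rho_ge: "\<And>t. 0 \<le> t \<Longrightarrow> c \<le> \<rho> t" and rho_le: "\<And>t. 0 \<le> t \<Longrightarrow> \<rho> t \<le> C"
    and a_deriv: "\<And>t j. 0 \<le> t \<Longrightarrow> j < n \<Longrightarrow>
      ((\<lambda>s. a s j) has_real_derivative \<rho> t * w * a t (j + 1)) (at t within {0..})"
    and a_cont: "\<And>j. continuous_on {0..} (\<lambda>t. a t j)"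
    and a_box: "\<And>t. 0 \<le> t \<Longrightarrow> a t \<in> abox (n + 1) K"
begin

abbreviation rhs :: "(nat \<Rightarrow> real) \<Rightarrow> (nat \<Rightarrow> real) \<Rightarrow> nat \<Rightarrow> real" where
  "rhs \<equiv> error_field \<gamma> \<delta> n w"

definition sol :: "real set \<Rightarrow> (real \<Rightarrow> nat \<Rightarrow> real) \<Rightarrow> bool" where
  "sol J Z \<longleftrightarrow> (\<forall>t\<in>J. \<forall>k<n+2.
     ((\<lambda>s. Z s k) has_real_derivative \<rho> t * rhs (Z t) (a t) k) (at t within J))"

lemma smooth_rhs: "smooth (n + 2) (n + 1) (\<lambda>z b. rhs z b k)"
  unfolding error_field_def by (rule smooth_Bvec[OF _ _ smooth_alpha]) auto

lemma sol_subset: "sol J Z \<Longrightarrow> I \<subseteq> J \<Longrightarrow> sol I Z"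
  unfolding sol_def by (meson DERIV_subset subsetD)

text \<open>The chain rule applies since \<open>Vf n\<close> involves only the parameters with index
  below \<open>n\<close>, precisely those that are differentiable in time. Their drift and the error
  field carry the same factor \<rho>, so \<open>V_decay\<close> is multiplied by it.\<close>

lemma V_along_sol:
  assumes "sol J Z" "J \<subseteq> {0..}" "t \<in> J"
  shows "((\<lambda>s. Vf n (Z s) (a s)) has_real_derivative - 2 * \<gamma> * \<rho> t * Vf n (Z t) (a t)) (at t within J)"
proof -
  have t: "0 \<le> t" using assms by auto
  have "((\<lambda>s. Vf n (Z s) (a s)) has_real_derivative
     (\<Sum>k<n+2. partial k (\<lambda>z. Vf n z (a t)) (Z t) * (\<rho> t * rhs (Z t) (a t) k)) +
     (\<Sum>j<n. partial j (Vf n (Z t)) (a t) * (\<rho> t * w * a t (j + 1)))) (at t within J)"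
    by (rule smooth_chain_rule[OF smooth_V])
      (use assms DERIV_subset[OF a_deriv[OF t] assms(2)] in \<open>auto simp: sol_def\<close>)
  also have "(\<Sum>k<n+2. partial k (\<lambda>z. Vf n z (a t)) (Z t) * (\<rho> t * rhs (Z t) (a t) k)) +
     (\<Sum>j<n. partial j (Vf n (Z t)) (a t) * (\<rho> t * w * a t (j + 1))) =
     \<rho> t * ((\<Sum>k<n+2. partial k (\<lambda>z. Vf n z (a t)) (Z t) * rhs (Z t) (a t) k) +
     w * (\<Sum>j<n. partial j (Vf n (Z t)) (a t) * a t (j + 1)))"
    unfolding distrib_left sum_distrib_left by (simp add: mult_ac)
  also have "\<dots> = - 2 * \<gamma> * \<rho> t * Vf n (Z t) (a t)"
    using V_decay[of n "a t" "Z t"] unfolding error_field_def by simp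
  finally show ?thesis .
qed

text \<open>Weighting with the lower bound \<open>c\<close> of the speed leaves the derivative 2
  \<gamma> (c - \<rho>) W, which is nonpositive.\<close>

lemma V_exp_decay:
  assumes "sol J Z" "J \<subseteq> {0..}" "{0..t} \<subseteq> J" "0 \<le> t"
  shows "Vf n (Z t) (a t) \<le> Vf n (Z 0) (a 0) * exp (- 2 * \<gamma> * c * t)"
proof -
  define W where "W s = Vf n (Z s) (a s) * exp (2 * \<gamma> * c * s)" for s
  have "W t \<le> W 0"
  proof (rule nonincreasing_on_Icc[OF assms(4)])
    fix s assume s: "s \<in> {0..t}"
    show "(W has_real_derivative 2 * \<gamma> * (c - \<rho> s) * W s) (at s within {0..t})"
      unfolding W_def using V_along_sol[OF sol_subset[OF assms(1,3)] _ s]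
      by (auto intro!: derivative_eq_intros simp: algebra_simps simp del: V.simps)
    have "0 \<le> W s" unfolding W_def using V_nonneg[of n "Z s" "a s"] by simp
    then show "2 * \<gamma> * (c - \<rho> s) * W s \<le> 0"
      using gamma_pos rho_ge[of s] s by (intro mult_nonpos_nonneg mult_nonneg_nonpos) auto
  qed
  then have "Vf n (Z t) (a t) * exp (2 * \<gamma> * c * t) \<le> Vf n (Z 0) (a 0)"
    by (simp add: W_def)
  then show ?thesis
    by (simp add: exp_minus field_simps)
qed

lemma V_le_along_sol:
  assumes "sol J Z" "J \<subseteq> {0..}" "{0..t} \<subseteq> J" "0 \<le> t"
  shows "Vf n (Z t) (a t) \<le> Vf n (Z 0) (a 0)"
proof -
  have "Vf n (Z 0) (a 0) * exp (- 2 * \<gamma> * c * t) \<le> Vf n (Z 0) (a 0) * 1"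
    using V_nonneg[of n] gamma_pos c_pos assms(4) by (intro mult_left_mono) auto
  with V_exp_decay[OF assms] show ?thesis by linarith
qed

lemma rhs_lipschitz:
  "\<exists>L>0. \<forall>z\<in>zbox (n + 2) R. \<forall>z'\<in>zbox (n + 2) R. \<forall>b\<in>abox (n + 1) K. \<forall>k<n+2.
     \<bar>rhs z b k - rhs z' b k\<bar> \<le> L * (\<Sum>i<n+2. \<bar>z i - z' i\<bar>)"
proof -
  obtain L where L: "\<And>k. 0 \<le> L k" "\<And>k z z' b. z \<in> zbox (n + 2) R \<Longrightarrow> z' \<in> zbox (n + 2) R \<Longrightarrow>
      b \<in> abox (n + 1) K \<Longrightarrow> \<bar>rhs z b k - rhs z' b k\<bar> \<le> L k * (\<Sum>i<n+2. \<bar>z i - z' i\<bar>)"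
    using smooth_lipschitz[OF smooth_rhs, where R = R and K = K] by metis
  define M where "M = 1 + (\<Sum>k<n+2. L k)"
  have "L k \<le> M" if "k < n + 2" for k
  proof -
    have "L k \<le> (\<Sum>k<n+2. L k)" using that L(1) by (intro member_le_sum) auto
    then show ?thesis by (simp add: M_def)
  qed
  then have "\<bar>rhs z b k - rhs z' b k\<bar> \<le> M * (\<Sum>i<n+2. \<bar>z i - z' i\<bar>)"
    if "z \<in> zbox (n + 2) R" "z' \<in> zbox (n + 2) R" "b \<in> abox (n + 1) K" "k < n + 2" for z z' b k
    using that by (intro order.trans[OF L(2)[OF that(1-3)]] mult_right_mono sum_nonneg) auto
  moreover have "0 < M" unfolding M_def using L(1) by (intro add_pos_nonneg sum_nonneg) auto
  ultimately show ?thesis by blast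
qed

lemma C_pos: "0 < C"
  using c_pos rho_ge[of 0] rho_le[of 0] by linarith

text \<open>A Gronwall argument for the squared distance. As \<open>Vf n\<close> does not increase,
  both solutions remain in one box, on which a single Lipschitz constant is available.\<close>

lemma sol_unique:
  assumes "sol J Z" "sol J Z'" "J \<subseteq> {0..}" "{0..t} \<subseteq> J" "0 \<le> t"
    and init: "\<And>k. k < n + 2 \<Longrightarrow> Z 0 k = Z' 0 k" and k: "k < n + 2"
  shows "Z t k = Z' t k"
proof -
  define v where "v = max (Vf n (Z 0) (a 0)) (Vf n (Z' 0) (a 0))"
  obtain R where R: "\<And>z b. b \<in> abox (n + 1) K \<Longrightarrow> Vf n z b \<le> v \<Longrightarrow> z \<in> zbox (n + 2) R"
    using V_bounded_imp_zbox[of K v] by blast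
  obtain L where L: "0 < L" "\<And>z z' b k. z \<in> zbox (n + 2) R \<Longrightarrow> z' \<in> zbox (n + 2) R \<Longrightarrow>
      b \<in> abox (n + 1) K \<Longrightarrow> k < n + 2 \<Longrightarrow> \<bar>rhs z b k - rhs z' b k\<bar> \<le> L * (\<Sum>i<n+2. \<bar>z i - z' i\<bar>)"
    using rhs_lipschitz[of R] by blast
  define m where "m = n + 2"
  define d where "d s i = Z s i - Z' s i" for s i
  define E where "E s = (\<Sum>i<m. (d s i)\<^sup>2)" for s
  \<comment> \<open>The factor \<open>m\<close> arises from bounding the square of a sum of
    \<open>m\<close> terms by \<open>m\<close> times the sum of squares; the factor 2 from
    differentiating the squares.\<close>
  define Q where "Q = 2 * C * L * m"
  define E' where "E' s = (\<Sum>i<m. 2 * d s i * (\<rho> s * (rhs (Z s) (a s) i - rhs (Z' s) (a s) i)))" for s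
  have E_der: "(E has_real_derivative E' s) (at s within {0..t})" if "s \<in> {0..t}" for s
  proof -
    have "((\<lambda>s. d s i) has_real_derivative \<rho> s * (rhs (Z s) (a s) i - rhs (Z' s) (a s) i)) (at s within {0..t})"
      if "i < m" for i
      using sol_subset[OF assms(1,4)] sol_subset[OF assms(2,4)] \<open>s \<in> {0..t}\<close> that
      unfolding sol_def d_def m_def right_diff_distrib by (intro DERIV_diff) auto
    then show ?thesis
      unfolding E_def[abs_def] E'_def
      by (intro DERIV_sum) (auto intro!: derivative_eq_intros)
  qed
  have E'_le: "E' s \<le> Q * E s" if s: "s \<in> {0..t}" for s
  proof -
    have "{0..s} \<subseteq> J" using s assms(4) by auto
    then have "Vf n (Z s) (a s) \<le> v" "Vf n (Z' s) (a s) \<le> v"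
      using V_le_along_sol[OF assms(1,3)] V_le_along_sol[OF assms(2,3)] s
      by (fastforce simp: v_def simp del: V.simps)+
    then have zb: "Z s \<in> zbox (n + 2) R" "Z' s \<in> zbox (n + 2) R"
      using R[OF a_box] s by auto
    have "E' s \<le> (\<Sum>i<m. 2 * \<bar>d s i\<bar> * (C * (L * (\<Sum>j<m. \<bar>d s j\<bar>))))"
      unfolding E'_def
    proof (rule sum_mono)
      fix i assume i: "i \<in> {..<m}"
      have "2 * d s i * (\<rho> s * (rhs (Z s) (a s) i - rhs (Z' s) (a s) i))
        \<le> \<bar>2 * d s i * (\<rho> s * (rhs (Z s) (a s) i - rhs (Z' s) (a s) i))\<bar>" by simp
      also have "\<dots> = 2 * \<bar>d s i\<bar> * (\<bar>\<rho> s\<bar> * \<bar>rhs (Z s) (a s) i - rhs (Z' s) (a s) i\<bar>)"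
        by (simp add: abs_mult)
      also have "\<dots> \<le> 2 * \<bar>d s i\<bar> * (C * (L * (\<Sum>j<m. \<bar>d s j\<bar>)))"
      proof (intro mult_left_mono mult_mono)
        show "\<bar>\<rho> s\<bar> \<le> C" using rho_ge[of s] rho_le[of s] c_pos s by auto
        show "\<bar>rhs (Z s) (a s) i - rhs (Z' s) (a s) i\<bar> \<le> L * (\<Sum>j<m. \<bar>d s j\<bar>)"
          unfolding d_def m_def by (rule L(2)[OF zb a_box]) (use s i in \<open>auto simp: m_def\<close>)
      qed (use C_pos in auto)
      finally show "2 * d s i * (\<rho> s * (rhs (Z s) (a s) i - rhs (Z' s) (a s) i))
        \<le> 2 * \<bar>d s i\<bar> * (C * (L * (\<Sum>j<m. \<bar>d s j\<bar>)))" .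
    qed
    also have "\<dots> = 2 * C * L * (\<Sum>j<m. \<bar>d s j\<bar>)\<^sup>2"
      by (simp add: power2_eq_square sum_distrib_left sum_distrib_right mult_ac)
    also have "\<dots> \<le> 2 * C * L * (E s * real m)"
      using sum_squared_le_sum_of_squares[of "\<lambda>j. \<bar>d s j\<bar>" "{..<m}"] C_pos L(1)
      unfolding E_def by (intro mult_left_mono) auto
    finally show ?thesis by (simp add: Q_def mult_ac)
  qed
  define W where "W s = E s * exp (- Q * s)" for s
  have "W t \<le> W 0"
  proof (rule nonincreasing_on_Icc[OF assms(5)])
    fix s assume s: "s \<in> {0..t}"
    show "(W has_real_derivative (E' s - Q * E s) * exp (- Q * s)) (at s within {0..t})"
      unfolding W_def[abs_def] by (rule derivative_eq_intros E_der[OF s] refl)+ (simp add: algebra_simps)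
    show "(E' s - Q * E s) * exp (- Q * s) \<le> 0"
      using E'_le[OF s] by (intro mult_nonpos_nonneg) auto
  qed
  also have "W 0 = 0"
    using init by (simp add: W_def E_def d_def m_def)
  finally have "E t \<le> 0"
    unfolding W_def using exp_gt_zero[of "- Q * t"] by (simp add: mult_le_0_iff)
  moreover have "0 \<le> E t" unfolding E_def by (intro sum_nonneg) simp
  ultimately have "E t = 0" by simp
  then have "d t k = 0"
    using k unfolding E_def m_def by (subst (asm) sum_nonneg_eq_0_iff) auto
  then show ?thesis by (simp add: d_def)
qed

text \<open>
  The field composed with the projection to a box is globally Lipschitz; decay of \<open>V\<^sub>n\<close> keeps its
  solution in the interior of a suitable box, where both fields agree.
\<close>

definition clip :: "real \<Rightarrow> (nat \<Rightarrow> real) \<Rightarrow> nat \<Rightarrow> real" where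
  "clip R z k = max (- R) (min R (z k))"

lemma clip_zbox: "0 \<le> R \<Longrightarrow> clip R z \<in> zbox m R"
  by (auto simp: clip_def zbox_def)

lemma clip_eq: "\<bar>z k\<bar> \<le> R \<Longrightarrow> clip R z k = z k"
  by (auto simp: clip_def)

lemma clip_lip: "\<bar>clip R z k - clip R z' k\<bar> \<le> \<bar>z k - z' k\<bar>"
  by (auto simp: clip_def)

lemma rhs_clip:
  assumes "z \<in> zbox (n + 2) R" shows "rhs (clip R z) b k = rhs z b k"
  using smooth_cong_coords[OF smooth_rhs[of k], of "clip R z" z b b] assms
  by (auto simp: zbox_def clip_eq)

text \<open>
  The type \<^typ>\<open>'v\<close> only provides a Euclidean space of dimension \<open>n + 2\<close> in which the existence theorem
  can be applied.
\<close>

lemma clipped_solution: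
  assumes dim: "DIM('v::euclidean_space) = n + 2" and R: "0 \<le> R"
  shows "\<exists>Z. (\<forall>k<n+2. Z 0 k = z0 k) \<and> (\<forall>t\<ge>0. \<forall>k<n+2.
     ((\<lambda>s. Z s k) has_real_derivative \<rho> t * rhs (clip R (Z t)) (a t) k) (at t within {0..}))"
proof -
  obtain L where L: "0 < L" "\<And>z z' b k. z \<in> zbox (n + 2) R \<Longrightarrow> z' \<in> zbox (n + 2) R \<Longrightarrow>
      b \<in> abox (n + 1) K \<Longrightarrow> k < n + 2 \<Longrightarrow> \<bar>rhs z b k - rhs z' b k\<bar> \<le> L * (\<Sum>i<n+2. \<bar>z i - z' i\<bar>)"
    using rhs_lipschitz[of R] by blast
  obtain B where B: "\<And>k. 0 \<le> B k" "\<And>k z b. z \<in> zbox (n + 2) R \<Longrightarrow> b \<in> abox (n + 1) K \<Longrightarrow> \<bar>rhs z b k\<bar> \<le> B k"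
    using smooth_bounded[OF smooth_rhs, where R = R and K = K] by metis
  have rho: "\<bar>\<rho> t\<bar> \<le> C" if "0 \<le> t" for t
    using rho_ge[OF that] rho_le[OF that] c_pos by auto
  show ?thesis
  proof (rule picard_coordinates[OF dim])
    fix k assume k: "k < n + 2"
    have 1: "continuous_on ({0..} \<times> UNIV) (\<lambda>p. (clip R (snd p), a (fst p)))"
    proof (intro continuous_on_Pair continuous_on_coordinatewise_then_product)
      show "continuous_on ({0..} \<times> UNIV) (\<lambda>p. clip R (snd p) i)" for i
        unfolding clip_def
        by (intro continuous_intros continuous_on_subset[OF continuous_on_product_then_coordinatewise[OF continuous_on_snd[OF continuous_on_id]]]) auto
      show "continuous_on ({0..} \<times> UNIV) (\<lambda>p. a (fst p) i)" for i
        by (intro continuous_on_compose2[OF a_cont] continuous_intros) auto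
    qed
    have "continuous_on ({0..} \<times> UNIV) (\<lambda>p. rhs (clip R (snd p)) (a (fst p)) k)"
      using continuous_on_compose2[OF smooth_continuous[OF smooth_rhs[of k]] 1] by simp
    moreover have "continuous_on ({0..} \<times> UNIV) (\<lambda>p. \<rho> (fst p))"
      by (intro continuous_on_compose2[OF rho_cont] continuous_intros) auto
    ultimately show "continuous_on ({0..} \<times> UNIV) (\<lambda>(t, z). \<rho> t * rhs (clip R z) (a t) k)"
      unfolding case_prod_unfold by (intro continuous_intros)
    show "\<bar>\<rho> t * rhs (clip R z) (a t) k\<bar> \<le> C * (\<Sum>k<n+2. B k)" if t: "0 \<le> t" for t z
    proof -
      have "B k \<le> (\<Sum>k<n+2. B k)"
        using k B(1) by (intro member_le_sum) auto
      then show ?thesis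
        unfolding abs_mult using B(2)[OF clip_zbox[OF R] a_box[OF t], of z k] rho[OF t] C_pos
        by (intro mult_mono) auto
    qed
    show "\<bar>\<rho> t * rhs (clip R z) (a t) k - \<rho> t * rhs (clip R z') (a t) k\<bar> \<le> C * L * (\<Sum>i<n + 2. \<bar>z i - z' i\<bar>)"
      if t: "0 \<le> t" for t z z'
    proof -
      have "\<bar>\<rho> t * rhs (clip R z) (a t) k - \<rho> t * rhs (clip R z') (a t) k\<bar> =
        \<bar>\<rho> t\<bar> * \<bar>rhs (clip R z) (a t) k - rhs (clip R z') (a t) k\<bar>"
        by (simp add: abs_mult flip: right_diff_distrib)
      also have "\<dots> \<le> C * (L * (\<Sum>i<n + 2. \<bar>clip R z i - clip R z' i\<bar>))"
        using rho[OF t] C_pos by (intro mult_mono L(2) clip_zbox R a_box t k) auto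
      also have "\<dots> \<le> C * (L * (\<Sum>i<n + 2. \<bar>z i - z' i\<bar>))"
        using C_pos L(1) by (intro mult_left_mono sum_mono clip_lip) auto
      finally show ?thesis by (simp add: mult.assoc)
    qed
  qed (use C_pos L in auto)
qed

lemma sol_exists:
  assumes dim: "DIM('v::euclidean_space) = n + 2"
  shows "\<exists>Z. (\<forall>k<n+2. Z 0 k = z0 k) \<and> sol {0..} Z"
proof -
  define v where "v = Vf n z0 (a 0)"
  obtain R where R: "0 \<le> R" "\<And>z b. b \<in> abox (n + 1) K \<Longrightarrow> Vf n z b \<le> v \<Longrightarrow> z \<in> zbox (n + 2) R"
    using V_bounded_imp_zbox[of K v] by blast
  define R1 where "R1 = R + 1"
  obtain Z where Z0: "\<And>k. k < n + 2 \<Longrightarrow> Z 0 k = z0 k" and Zd: "\<And>t k. 0 \<le> t \<Longrightarrow> k < n + 2 \<Longrightarrow>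
     ((\<lambda>s. Z s k) has_real_derivative \<rho> t * rhs (clip R1 (Z t)) (a t) k) (at t within {0..})"
    using clipped_solution[OF dim, of R1 z0] R(1) unfolding R1_def by auto
  have v0: "Vf n (Z 0) (a 0) \<le> v"
    using smooth_cong_coords[OF smooth_V[of n], of "Z 0" z0 "a 0" "a 0"] Z0 by (simp add: v_def)
  have Zc: "continuous_on {0..} (\<lambda>s. Z s k)" if "k < n + 2" for k
    using Zd that by (intro DERIV_continuous_on) auto
  have solI: "sol {0..t} Z" if "\<And>s. s \<in> {0..t} \<Longrightarrow> Z s \<in> zbox (n + 2) R1" for t
    unfolding sol_def
  proof (intro ballI allI impI)
    fix s k assume s: "s \<in> {0..t}" and k: "k < n + 2"
    show "((\<lambda>s. Z s k) has_real_derivative \<rho> s * rhs (Z s) (a s) k) (at s within {0..t})"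
      using DERIV_subset[OF Zd[OF _ k], of s "{0..t}"] s by (simp add: rhs_clip[OF that[OF s]])
  qed
  \<comment> \<open>\<open>h\<close> measures the excess over the inner box of radius
    \<open>R\<close>. While it is at most 1 the clipping is inactive, and then decay of
    \<open>Vf n\<close> forces it to be 0; continuity excludes the gap between 0 and 1.\<close>
  define h where "h s = (\<Sum>k<n+2. max 0 (\<bar>Z s k\<bar> - R))" for s
  have hc: "continuous_on {0..} h"
    unfolding h_def using Zc by (intro continuous_intros) auto
  have h1: "Z s \<in> zbox (n + 2) R1" if "h s \<le> 1" for s
  proof -
    have "\<bar>Z s k\<bar> \<le> R1" if "k < n + 2" for k
    proof -
      have "max 0 (\<bar>Z s k\<bar> - R) \<le> h s"
        unfolding h_def using that by (intro member_le_sum) auto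
      then show ?thesis using \<open>h s \<le> 1\<close> by (simp add: R1_def)
    qed
    then show ?thesis by (simp add: zbox_def)
  qed
  have h0: "h s = 0" if "Z s \<in> zbox (n + 2) R" for s
    using that unfolding h_def zbox_def by (intro sum.neutral) auto
  have step: "h t = 0" if t: "0 \<le> t" and le: "\<And>s. s \<in> {0..t} \<Longrightarrow> h s \<le> 1" for t
  proof (rule h0, rule R(2)[OF a_box[OF t]])
    have "sol {0..t} Z" using h1 le by (intro solI) auto
    from V_le_along_sol[OF this, of t] show "Vf n (Z t) (a t) \<le> v"
      using t v0 by auto
  qed
  have h00: "h 0 = 0"
    using h0[OF R(2)[OF a_box v0]] by simp
  have hle: "h t \<le> 1" if t: "0 \<le> t" for t
  proof (rule ccontr)
    assume nle: "\<not> h t \<le> 1"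
    \<comment> \<open>The infimum of \<open>T\<close> is the first time with h \<ge> 1. There h = 1
      by the intermediate value theorem, while \<open>step\<close>, applicable up to that time,
      yields h = 0.\<close>
    define T where "T = {0..t} \<inter> h -` {1..}"
    have "T \<noteq> {}" using nle t by (auto simp: T_def intro!: exI[of _ t])
    moreover have "closed T"
      unfolding T_def using continuous_on_subset[OF hc, of "{0..t}"]
      by (intro continuous_closed_preimage) auto
    moreover have bdd: "bdd_below T" by (auto simp: T_def)
    ultimately have "Inf T \<in> T" by (intro closed_contains_Inf)
    then have i: "0 \<le> Inf T" "1 \<le> h (Inf T)" "Inf T \<le> t" by (auto simp: T_def)
    have below: "s = Inf T" if "s \<in> {0..Inf T}" "1 \<le> h s" for s
    proof -
      have "s \<in> T" using that i by (auto simp: T_def)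
      then show ?thesis using cInf_lower[OF _ bdd, of s] that by auto
    qed
    obtain s where s: "0 \<le> s" "s \<le> Inf T" "h s = 1"
      using IVT'[of h 0 1 "Inf T"] i h00 continuous_on_subset[OF hc, of "{0..Inf T}"] by auto
    then have h_Inf: "h (Inf T) = 1" using below[of s] by auto
    have "h s \<le> 1" if "s \<in> {0..Inf T}" for s
      using below[OF that] h_Inf by (cases "1 \<le> h s") auto
    from step[OF i(1) this] h_Inf show False by simp
  qed
  have "sol {0..} Z"
    unfolding sol_def using Zd h1[OF hle] by (auto simp: rhs_clip)
  then show ?thesis using Z0 by blast
qed

lemma sol_limit:
  assumes "sol {0..} Z"
  shows "k < n + 2 \<Longrightarrow> ((\<lambda>t. Z t k) \<longlongrightarrow> 0) at_top"
    and "((\<lambda>t. \<alpha> n (Z t) (a t)) \<longlongrightarrow> 0) at_top"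
    and "((\<lambda>t. lam \<gamma> w (Z t) (a t)) \<longlongrightarrow> w) at_top"
proof -
  have abox: "\<forall>\<^sub>F t in at_top. a t \<in> abox (n + 1) K"
    using eventually_ge_at_top[of 0] by eventually_elim (rule a_box)
  have "\<forall>\<^sub>F t in at_top. norm (Vf n (Z t) (a t)) \<le> Vf n (Z 0) (a 0) * exp (- 2 * \<gamma> * c * t)"
    using eventually_ge_at_top[of 0]
  proof eventually_elim
    case (elim t)
    then show ?case using V_exp_decay[OF assms, of t] V_nonneg[of n "Z t" "a t"] by auto
  qed
  moreover have "((\<lambda>t. Vf n (Z 0) (a 0) * exp (- 2 * \<gamma> * c * t)) \<longlongrightarrow> 0) at_top"
  proof -
    have "filterlim (\<lambda>t. (- 2 * \<gamma> * c) * t) at_bot at_top"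
      using gamma_pos c_pos by (intro filterlim_tendsto_neg_mult_at_bot[OF tendsto_const _ filterlim_ident]) simp
    then have "((\<lambda>t. exp (- 2 * \<gamma> * c * t)) \<longlongrightarrow> 0) at_top"
      by (rule filterlim_compose[OF exp_at_bot])
    from tendsto_mult_right_zero[OF this] show ?thesis .
  qed
  ultimately have "((\<lambda>t. Vf n (Z t) (a t)) \<longlongrightarrow> 0) at_top"
    by (rule Lim_null_comparison)
  from V_tendsto_0_imp[OF this abox] show Z: "((\<lambda>t. Z t k) \<longlongrightarrow> 0) at_top" if "k < n + 2" for k
    using that by simp
  show "((\<lambda>t. \<alpha> n (Z t) (a t)) \<longlongrightarrow> 0) at_top"
    by (rule smooth_tendsto_origin[OF smooth_alpha _ Z abox]) (use alpha_V_origin[of n] in auto)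
  show "((\<lambda>t. lam \<gamma> w (Z t) (a t)) \<longlongrightarrow> w) at_top"
    by (rule smooth_tendsto_origin[OF smooth_lam _ Z abox]) (auto intro: lam_origin)
qed

end

section \<open>Differential calculus and iterated brackets\<close>

abbreviation Ck :: "nat \<Rightarrow> ('e::euclidean_space \<Rightarrow> 'f::real_normed_vector) \<Rightarrow> 'e set \<Rightarrow> bool" where
  "Ck \<equiv> Ck_on UNIV"

abbreviation Df :: "('e::real_normed_vector \<Rightarrow> 'f::real_normed_vector) \<Rightarrow> 'e \<Rightarrow> 'e \<Rightarrow> 'f" where
  "Df f x \<equiv> frechet_derivative f (at x)"

lemma Df_eqI: "(f has_derivative f') (at x) \<Longrightarrow> Df f x = f'"
  by (rule frechet_derivative_at[symmetric])

lemma Df_works: "f differentiable at x \<Longrightarrow> (f has_derivative Df f x) (at x)"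
  by (simp add: frechet_derivative_works)

lemma Ck_Suc_differentiable: "Ck (Suc k) f W \<Longrightarrow> x \<in> W \<Longrightarrow> f differentiable at x"
  by simp

lemma Ck_cong:
  assumes "open W" "\<And>x. x \<in> W \<Longrightarrow> f x = g x"
  shows "Ck k f W \<Longrightarrow> Ck k g W"
  using assms
proof (induction k arbitrary: f g)
  case 0
  then show ?case using continuous_on_cong[of W W f g] by simp
next
  case (Suc k)
  have d: "g differentiable at x" if "x \<in> W" for x
    using Suc.prems that has_derivative_transform_within_open[of f _ x UNIV W g]
    unfolding differentiable_def by (meson Ck_Suc_differentiable differentiable_def)
  moreover have "Ck k (\<lambda>x. Df g x v) W" for v
  proof (rule Suc.IH[of "\<lambda>x. Df f x v"])
    show "Df f x v = Df g x v" if "x \<in> W" for x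
      using frechet_derivative_transform_within_open[of f x W g] Suc.prems that by simp
  qed (use Suc.prems in auto)
  ultimately show ?case by simp
qed

lemma Ck_subset: "Ck k f W \<Longrightarrow> W' \<subseteq> W \<Longrightarrow> Ck k f W'"
proof (induction k arbitrary: f)
  case 0
  then show ?case using continuous_on_subset by auto
qed auto

lemma Ck_local:
  assumes "\<And>x. x \<in> W \<Longrightarrow> \<exists>U. open U \<and> x \<in> U \<and> Ck k f U"
  shows "Ck k f W"
  using assms
proof (induction k arbitrary: f)
  case 0
  have "continuous (at x) f" if x: "x \<in> W" for x
  proof -
    obtain U where "open U" "x \<in> U" "continuous_on U f" using 0 x by auto
    then show ?thesis using continuous_on_eq_continuous_at by blast
  qed
  then show ?case by (simp add: continuous_at_imp_continuous_on)
next
  case (Suc k)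
  have "f differentiable at x" if x: "x \<in> W" for x
    using Suc.prems[OF x] by auto
  moreover have "Ck k (\<lambda>x. Df f x v) W" for v
    by (rule Suc.IH) (use Suc.prems in fastforce)
  ultimately show ?case by simp
qed

lemma Ck_Suc_imp: "Ck (Suc k) f W \<Longrightarrow> Ck k f W"
proof (induction k arbitrary: f)
  case 0
  then have "continuous (at x within W) f" if "x \<in> W" for x
    using differentiable_imp_continuous_within[of f x UNIV] that
    by (auto intro: continuous_at_imp_continuous_at_within)
  then show ?case by (simp add: continuous_on_eq_continuous_within)
next
  case (Suc k)
  then show ?case by (metis Ck_on.simps(2))
qed

lemma Ck_le:
  assumes "Ck k f W" "k' \<le> k" shows "Ck k' f W"
  using assms(2,1) by (induction rule: dec_induct) (auto dest: Ck_Suc_imp simp del: Ck_on.simps)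

lemma Ck_const: "Ck k (\<lambda>x. c) W"
  by (induction k arbitrary: c) (auto simp: differentiable_const)

lemma Ck_add:
  assumes "open W" shows "Ck k f W \<Longrightarrow> Ck k g W \<Longrightarrow> Ck k (\<lambda>x. f x + g x) W"
proof (induction k arbitrary: f g)
  case 0
  then show ?case by (auto intro: continuous_intros)
next
  case (Suc k)
  have "Ck k (\<lambda>x. Df (\<lambda>x. f x + g x) x v) W" for v
  proof (rule Ck_cong[OF assms])
    show "Ck k (\<lambda>x. Df f x v + Df g x v) W" using Suc by auto
    show "Df f x v + Df g x v = Df (\<lambda>x. f x + g x) x v" if "x \<in> W" for x
      using Df_eqI[OF has_derivative_add[OF Df_works Df_works]] Suc.prems that by fastforce
  qed
  with Suc.prems show ?case by (auto intro: differentiable_add)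
qed

lemma Ck_sum:
  assumes "open W" shows "(\<And>i. i \<in> I \<Longrightarrow> Ck k (f i) W) \<Longrightarrow> Ck k (\<lambda>x. \<Sum>i\<in>I. f i x) W"
proof (induction I rule: infinite_finite_induct)
  case (insert i F)
  then show ?case using Ck_add[OF assms, of k "f i" "\<lambda>x. \<Sum>i\<in>F. f i x"] by (simp del: Ck_on.simps)
qed (use Ck_const in auto)

lemma Ck_linear:
  assumes "open W" "bounded_linear L" shows "Ck k f W \<Longrightarrow> Ck k (\<lambda>x. L (f x)) W"
proof (induction k arbitrary: f)
  case 0
  then show ?case using bounded_linear.continuous_on[OF assms(2), of W f] by simp
next
  case (Suc k)
  have d: "((\<lambda>x. L (f x)) has_derivative (\<lambda>v. L (Df f x v))) (at x)" if "x \<in> W" for x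
    using bounded_linear.has_derivative[OF assms(2) Df_works] Suc.prems that by auto
  have "Ck k (\<lambda>x. Df (\<lambda>x. L (f x)) x v) W" for v
  proof (rule Ck_cong[OF assms(1)])
    show "Ck k (\<lambda>x. L (Df f x v)) W" using Suc by auto
    show "L (Df f x v) = Df (\<lambda>x. L (f x)) x v" if "x \<in> W" for x
      using Df_eqI[OF d[OF that]] by simp
  qed
  with d show ?case by (auto simp: differentiable_def)
qed

lemma Ck_scaleR:
  assumes "open W"
  shows "Ck k (f :: _ \<Rightarrow> real) W \<Longrightarrow> Ck k g W \<Longrightarrow> Ck k (\<lambda>x. f x *\<^sub>R g x) W"
proof (induction k arbitrary: f g)
  case 0
  then show ?case by (auto intro: continuous_intros)
next
  case (Suc k)
  have d: "((\<lambda>x. f x *\<^sub>R g x) has_derivative (\<lambda>v. f x *\<^sub>R Df g x v + Df f x v *\<^sub>R g x)) (at x)" if "x \<in> W" for x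
    using has_derivative_scaleR[OF Df_works Df_works, of f x g] Suc.prems that by auto
  have "Ck k (\<lambda>x. Df (\<lambda>x. f x *\<^sub>R g x) x v) W" for v
  proof (rule Ck_cong[OF assms(1)])
    have "Ck k f W" "Ck k g W" using Suc.prems Ck_Suc_imp by blast+
    then show "Ck k (\<lambda>x. f x *\<^sub>R Df g x v + Df f x v *\<^sub>R g x) W"
      using Suc by (intro Ck_add[OF assms] Suc.IH) auto
    show "f x *\<^sub>R Df g x v + Df f x v *\<^sub>R g x = Df (\<lambda>x. f x *\<^sub>R g x) x v" if "x \<in> W" for x
      using Df_eqI[OF d[OF that]] by simp
  qed
  with d show ?case by (auto simp: differentiable_def)
qed

lemma linear_expand:
  fixes L :: "'e::euclidean_space \<Rightarrow> 'f::real_normed_vector"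
  assumes "linear L" shows "L v = (\<Sum>b\<in>Basis. (v \<bullet> b) *\<^sub>R L b)"
proof -
  have "L v = L (\<Sum>b\<in>Basis. (v \<bullet> b) *\<^sub>R b)" by (simp add: euclidean_representation)
  also have "\<dots> = (\<Sum>b\<in>Basis. (v \<bullet> b) *\<^sub>R L b)"
    by (simp add: linear_sum[OF assms] linear_cmul[OF assms])
  finally show ?thesis .
qed

lemma Df_linear: "f differentiable at x \<Longrightarrow> linear (Df f x)"
  by (rule linear_frechet_derivative)

text \<open>\<open>Ck_on\<close> controls derivatives in fixed directions only. Expanding the moving
  direction \<open>H x\<close> in the basis reduces the claim to sums of products.\<close>

lemma Ck_directional:
  assumes "open W" "Ck (Suc k) f W" "Ck k H W"
  shows "Ck k (\<lambda>x. Df f x (H x)) W"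
proof (rule Ck_cong[OF assms(1)])
  show "Ck k (\<lambda>x. \<Sum>b\<in>Basis. (H x \<bullet> b) *\<^sub>R Df f x b) W"
    using assms by (intro Ck_sum Ck_scaleR Ck_linear[OF _ bounded_linear_inner_left]) auto
  show "(\<Sum>b\<in>Basis. (H x \<bullet> b) *\<^sub>R Df f x b) = Df f x (H x)" if "x \<in> W" for x
    using linear_expand[OF Df_linear, of f x "H x"] assms that by auto
qed

lemma DERIV_along_line:
  fixes f :: "'e::real_normed_vector \<Rightarrow> real"
  assumes "f differentiable at (x + s *\<^sub>R v)"
  shows "((\<lambda>s. f (x + s *\<^sub>R v)) has_real_derivative Df f (x + s *\<^sub>R v) v) (at s)"
proof -
  have "((\<lambda>s. x + s *\<^sub>R v) has_derivative (\<lambda>h. h *\<^sub>R v)) (at s)"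
    by (auto intro!: derivative_eq_intros)
  from has_derivative_compose[OF this Df_works[OF assms]]
  have "((\<lambda>s. f (x + s *\<^sub>R v)) has_derivative (\<lambda>h. Df f (x + s *\<^sub>R v) (h *\<^sub>R v))) (at s)" .
  also have "(\<lambda>h. Df f (x + s *\<^sub>R v) (h *\<^sub>R v)) = (*) (Df f (x + s *\<^sub>R v) v)"
    by (simp add: fun_eq_iff linear_cmul[OF Df_linear[OF assms]] mult.commute)
  finally show ?thesis unfolding has_field_derivative_def .
qed

text \<open>The mean value theorem is applied along \<open>v\<close> to a difference in direction
  \<open>w\<close>, and then along \<open>w\<close>. The extra \<open>+ h\<close> in the radius
  keeps the membership in the open ball strict, even for zero vectors.\<close>

lemma second_difference:
  fixes f :: "'e::euclidean_space \<Rightarrow> real"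
  assumes f: "Ck 2 f (ball x r)" and h: "0 < h" "h * (norm v + norm w) < r"
  shows "\<exists>y\<in>ball x (h * (norm v + norm w) + h). 
    f (x + h *\<^sub>R v + h *\<^sub>R w) - f (x + h *\<^sub>R v) - f (x + h *\<^sub>R w) + f x =
      h * h * Df (\<lambda>y. Df f y v) y w"
proof -
  have inb: "x + s *\<^sub>R v + t *\<^sub>R w \<in> ball x r" if "0 \<le> s" "s \<le> h" "0 \<le> t" "t \<le> h" for s t
  proof -
    have "norm (s *\<^sub>R v + t *\<^sub>R w) \<le> s * norm v + t * norm w"
      using norm_triangle_ineq[of "s *\<^sub>R v" "t *\<^sub>R w"] that by simp
    also have "\<dots> \<le> h * norm v + h * norm w"
      using that by (intro add_mono mult_right_mono) auto
    also have "\<dots> < r" using h(2) by (simp add: algebra_simps)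
    also have "norm (s *\<^sub>R v + t *\<^sub>R w) = dist (x + s *\<^sub>R v + t *\<^sub>R w) x"
      by (simp add: dist_norm)
    finally show ?thesis by (simp add: dist_commute)
  qed
  have d1: "f differentiable at y" if "y \<in> ball x r" for y
    using f that by (simp add: numeral_2_eq_2)
  have d2: "(\<lambda>y. Df f y v) differentiable at y" if "y \<in> ball x r" for y
    using f that by (simp add: numeral_2_eq_2)
  define \<phi> where "\<phi> s = f (x + h *\<^sub>R w + s *\<^sub>R v) - f (x + s *\<^sub>R v)" for s
  have "(\<phi> has_real_derivative Df f (x + h *\<^sub>R w + s *\<^sub>R v) v - Df f (x + s *\<^sub>R v) v) (at s)"
    if "0 \<le> s" "s \<le> h" for s
    unfolding \<phi>_def[abs_def] using inb[of s h] inb[of s 0] that h(1)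
    by (intro DERIV_diff DERIV_along_line d1) (auto simp: algebra_simps)
  from MVT2[OF h(1) this] obtain s where s: "0 < s" "s < h"
    "\<phi> h - \<phi> 0 = h * (Df f (x + h *\<^sub>R w + s *\<^sub>R v) v - Df f (x + s *\<^sub>R v) v)"
    by auto
  have "((\<lambda>t. Df f (x + s *\<^sub>R v + t *\<^sub>R w) v) has_real_derivative
      Df (\<lambda>y. Df f y v) (x + s *\<^sub>R v + t *\<^sub>R w) w) (at t)" if "0 \<le> t" "t \<le> h" for t
    using inb[of s t] that s by (intro DERIV_along_line[of "\<lambda>y. Df f y v"] d2) auto
  from MVT2[OF h(1) this] obtain t where t: "0 < t" "t < h"
    "Df f (x + s *\<^sub>R v + h *\<^sub>R w) v - Df f (x + s *\<^sub>R v) v = h * Df (\<lambda>y. Df f y v) (x + s *\<^sub>R v + t *\<^sub>R w) w"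
    by auto
  define y where "y = x + s *\<^sub>R v + t *\<^sub>R w"
  have "norm (s *\<^sub>R v + t *\<^sub>R w) \<le> s * norm v + t * norm w"
    using norm_triangle_ineq[of "s *\<^sub>R v" "t *\<^sub>R w"] s t by simp
  also have "\<dots> \<le> h * norm v + h * norm w"
    using s t by (intro add_mono mult_right_mono) auto
  also have "\<dots> < h * (norm v + norm w) + h"
    using h(1) by (simp add: algebra_simps)
  also have "norm (s *\<^sub>R v + t *\<^sub>R w) = dist y x"
    by (simp add: y_def dist_norm)
  finally have "y \<in> ball x (h * (norm v + norm w) + h)"
    by (simp add: dist_commute)
  moreover have "f (x + h *\<^sub>R v + h *\<^sub>R w) - f (x + h *\<^sub>R v) - f (x + h *\<^sub>R w) + f x = \<phi> h - \<phi> 0"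
    by (simp add: \<phi>_def algebra_simps)
  moreover have "\<phi> h - \<phi> 0 = h * h * Df (\<lambda>y. Df f y v) y w"
    unfolding s(3) y_def using t(3) by (simp add: add.commute add.left_commute)
  ultimately show ?thesis by auto
qed

text \<open>Clairaut's theorem. The second difference is symmetric in \<open>v\<close> and
  \<open>w\<close>, so the two mixed derivatives agree at some pair of points arbitrarily close to
  \<open>x\<close>; continuity then excludes a gap at \<open>x\<close>.\<close>

lemma second_derivative_symmetric:
  fixes f :: "'e::euclidean_space \<Rightarrow> real"
  assumes W: "open W" "x \<in> W" and f: "Ck 2 f W"
  shows "Df (\<lambda>y. Df f y v) x w = Df (\<lambda>y. Df f y w) x v"
proof (rule ccontr)
  define P where "P y = Df (\<lambda>y. Df f y v) y w" for y
  define Q where "Q y = Df (\<lambda>y. Df f y w) y v" for y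
  assume "\<not> ?thesis"
  then have ne: "P x \<noteq> Q x" by (simp add: P_def Q_def)
  define \<epsilon> where "\<epsilon> = \<bar>P x - Q x\<bar> / 2"
  have e: "0 < \<epsilon>" using ne by (simp add: \<epsilon>_def)
  have "continuous_on W P" "continuous_on W Q"
    using f unfolding P_def Q_def by (auto simp: numeral_2_eq_2)
  then have "isCont P x" "isCont Q x"
    using W by (simp_all add: continuous_on_eq_continuous_at)
  then have "\<forall>\<^sub>F y in nhds x. dist (P y) (P x) < \<epsilon>" "\<forall>\<^sub>F y in nhds x. dist (Q y) (Q x) < \<epsilon>"
    using e tendstoD unfolding isCont_def tendsto_at_iff_tendsto_nhds by blast+
  then have "\<forall>\<^sub>F y in nhds x. dist (P y) (P x) < \<epsilon> \<and> dist (Q y) (Q x) < \<epsilon> \<and> y \<in> W"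
    using W by (intro eventually_conj eventually_nhds_in_open)
  then obtain r where r: "0 < r" "\<And>y. y \<in> ball x r \<Longrightarrow> dist (P y) (P x) < \<epsilon> \<and> dist (Q y) (Q x) < \<epsilon> \<and> y \<in> W"
    unfolding eventually_nhds_metric by (auto simp: dist_commute)
  \<comment> \<open>Chosen so that the radius occurring in \<open>second_difference\<close> becomes
    r / 2.\<close>
  define h where "h = r / (2 * (norm v + norm w + 1))"
  have nn: "0 < 2 * (norm v + norm w + 1)" by (simp add: add_nonneg_pos)
  have h: "0 < h" using r nn by (simp add: h_def)
  have "h * (2 * (norm v + norm w + 1)) = r" unfolding h_def using nn by simp
  then have hr: "h * (norm v + norm w) + h = r / 2" by (simp add: algebra_simps)
  then have hr': "h * (norm v + norm w) < r" "h * (norm w + norm v) < r"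
    using h r(1) by (auto simp: add.commute)
  have fb: "Ck 2 f (ball x r)" using f r(2) by (intro Ck_subset[OF f]) auto
  obtain y where y: "y \<in> ball x (r / 2)"
    "f (x + h *\<^sub>R v + h *\<^sub>R w) - f (x + h *\<^sub>R v) - f (x + h *\<^sub>R w) + f x = h * h * P y"
    using second_difference[OF fb h hr'(1)] unfolding hr P_def by blast
  obtain y' where y': "y' \<in> ball x (r / 2)"
    "f (x + h *\<^sub>R w + h *\<^sub>R v) - f (x + h *\<^sub>R w) - f (x + h *\<^sub>R v) + f x = h * h * Q y'"
    using second_difference[OF fb h hr'(2)] hr unfolding Q_def by (metis add.commute)
  have "h * h * P y = h * h * Q y'"
    using y(2) y'(2) by (simp add: algebra_simps)
  then have "P y = Q y'" using h by simp
  moreover have "dist (P y) (P x) < \<epsilon>" "dist (Q y') (Q x) < \<epsilon>"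
    using r(1) r(2)[of y] r(2)[of y'] y(1) y'(1) by auto
  ultimately show False
    unfolding \<epsilon>_def dist_real_def by argo
qed

lemma Df_directional:
  fixes f :: "'e::euclidean_space \<Rightarrow> real"
  assumes W: "open W" "x \<in> W" and f: "Ck 2 f W" and g: "Ck 1 g W"
  shows "Df (\<lambda>y. Df f y (g y)) x u = Df f x (Df g x u) + Df (\<lambda>y. Df f y (g x)) x u"
proof -
  have df: "f differentiable at y" if "y \<in> W" for y
    using f that by (simp add: numeral_2_eq_2)
  have dg: "(g has_derivative Df g x) (at x)"
    using g W by (intro Df_works) (auto simp: One_nat_def)
  have db: "((\<lambda>y. Df f y b) has_derivative Df (\<lambda>y. Df f y b) x) (at x)" for b
    using f W by (intro Df_works) (simp add: numeral_2_eq_2)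
  have 1: "((\<lambda>y. Df f y (g y)) has_derivative
     (\<lambda>u. \<Sum>b\<in>Basis. (g x \<bullet> b) * Df (\<lambda>y. Df f y b) x u + (Df g x u \<bullet> b) * Df f x b)) (at x)"
  proof (rule has_derivative_transform_within_open[OF _ W])
    show "((\<lambda>y. \<Sum>b\<in>Basis. (g y \<bullet> b) * Df f y b) has_derivative
     (\<lambda>u. \<Sum>b\<in>Basis. (g x \<bullet> b) * Df (\<lambda>y. Df f y b) x u + (Df g x u \<bullet> b) * Df f x b)) (at x)"
      by (intro has_derivative_sum has_derivative_mult has_derivative_inner_left dg db)
    show "(\<Sum>b\<in>Basis. (g y \<bullet> b) * Df f y b) = Df f y (g y)" if "y \<in> W" for y
      using linear_expand[OF Df_linear[OF df[OF that]], of "g y"] by simp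
  qed
  have 2: "((\<lambda>y. Df f y (g x)) has_derivative
     (\<lambda>u. \<Sum>b\<in>Basis. (g x \<bullet> b) * Df (\<lambda>y. Df f y b) x u)) (at x)"
  proof (rule has_derivative_transform_within_open[OF _ W])
    show "((\<lambda>y. \<Sum>b\<in>Basis. (g x \<bullet> b) * Df f y b) has_derivative
     (\<lambda>u. \<Sum>b\<in>Basis. (g x \<bullet> b) * Df (\<lambda>y. Df f y b) x u)) (at x)"
      by (intro has_derivative_sum has_derivative_mult_right db)
    show "(\<Sum>b\<in>Basis. (g x \<bullet> b) * Df f y b) = Df f y (g x)" if "y \<in> W" for y
      using linear_expand[OF Df_linear[OF df[OF that]], of "g x"] by simp
  qed
  show ?thesis
    unfolding Df_eqI[OF 1] Df_eqI[OF 2] sum.distrib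
    using linear_expand[OF Df_linear[OF df[OF W(2)]], of "Df g x u"] by simp
qed

section \<open>Lie brackets and independence of the differentials\<close>

definition bracket :: "('e \<Rightarrow> 'e) \<Rightarrow> ('e \<Rightarrow> 'e) \<Rightarrow> 'e \<Rightarrow> 'e::euclidean_space" where
  "bracket H g x = Df g x (H x) - Df H x (g x)"

text \<open>The commutator identity for derivations: the terms with second derivatives of
  \<open>f\<close> cancel by symmetry.\<close>

lemma Df_bracket:
  fixes f :: "'e::euclidean_space \<Rightarrow> real"
  assumes W: "open W" "x \<in> W" and f: "Ck 2 f W" and g: "Ck 1 g W" and H: "Ck 1 H W"
  shows "Df f x (bracket H g x) = Df (\<lambda>y. Df f y (g y)) x (H x) - Df (\<lambda>y. Df f y (H y)) x (g x)"
proof -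
  have "linear (Df f x)" using f W by (intro Df_linear) (simp add: numeral_2_eq_2)
  then have "Df f x (bracket H g x) = Df f x (Df g x (H x)) - Df f x (Df H x (g x))"
    unfolding bracket_def by (rule linear_diff)
  then show ?thesis
    unfolding Df_directional[OF W f g] Df_directional[OF W f H]
    using second_derivative_symmetric[OF W f, of "g x" "H x"] by simp
qed

lemma Ck_bracket:
  assumes W: "open W" and g: "Ck (Suc k) g W" and H: "Ck (Suc k) H W"
  shows "Ck k (bracket H g) W"
proof -
  have "Ck k (\<lambda>x. Df g x (H x) + - Df H x (g x)) W"
    by (rule Ck_add[OF W Ck_directional[OF W g Ck_Suc_imp[OF H]]
          Ck_linear[OF W bounded_linear_minus[OF bounded_linear_ident] Ck_directional[OF W H Ck_Suc_imp[OF g]]]])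
  then show ?thesis by (simp add: bracket_def[abs_def])
qed

text \<open>
  The iterated brackets \<open>g\<^sub>k\<close> of \<open>H\<close> with \<open>g\<close> satisfy \<open>L\<^bsub>g\<^sub>k\<^esub> \<phi>\<^sub>i = 0\<close> for \<open>i + k < n - 1\<close> and
  \<open>L\<^bsub>g\<^sub>k\<^esub> \<phi>\<^sub>i \<noteq> 0\<close> for \<open>i + k = n - 1\<close>. This triangular structure makes the differentials of
  \<open>\<phi>\<^sub>0, \<dots>, \<phi>\<^sub>n\<^sub>-\<^sub>1\<close> independent.
\<close>

lemma relative_degree_brackets:
  fixes \<phi> :: "nat \<Rightarrow> 'e::euclidean_space \<Rightarrow> real"
  assumes W: "open W" and \<phi>: "\<And>i. i < n \<Longrightarrow> Ck 2 (\<phi> i) W"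
    and H: "Ck n H W" and g: "Ck n g W"
    and next_: "\<And>i x. Suc i < n \<Longrightarrow> x \<in> W \<Longrightarrow> \<phi> (Suc i) x = Df (\<phi> i) x (H x)"
    and zero: "\<And>i x. Suc i < n \<Longrightarrow> x \<in> W \<Longrightarrow> Df (\<phi> i) x (g x) = 0"
    and nonzero: "\<And>i x. Suc i = n \<Longrightarrow> x \<in> W \<Longrightarrow> Df (\<phi> i) x (g x) \<noteq> 0"
  shows "k < n \<Longrightarrow> Ck (n - k) ((bracket H ^^ k) g) W \<and>
    (\<forall>i x. x \<in> W \<longrightarrow> (Suc (i + k) < n \<longrightarrow> Df (\<phi> i) x ((bracket H ^^ k) g x) = 0) \<and>
      (Suc (i + k) = n \<longrightarrow> Df (\<phi> i) x ((bracket H ^^ k) g x) \<noteq> 0))"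
proof (induction k)
  case 0
  show ?case
    unfolding funpow.simps id_apply diff_zero add_0_right using g zero nonzero by blast
next
  case (Suc k)
  let ?G = "(bracket H ^^ k) g"
  have n: "n - k = Suc (n - Suc k)" "Suc k < n" using Suc.prems by auto
  have G: "Ck (Suc (n - Suc k)) ?G W" and IH0: "\<And>i x. x \<in> W \<Longrightarrow> Suc (i + k) < n \<Longrightarrow> Df (\<phi> i) x (?G x) = 0"
    and IH1: "\<And>i x. x \<in> W \<Longrightarrow> Suc (i + k) = n \<Longrightarrow> Df (\<phi> i) x (?G x) \<noteq> 0"
    using Suc.IH[OF Suc_lessD[OF n(2)]] unfolding n(1) by simp_all
  have G1: "Ck 1 ?G W" and H1: "Ck 1 H W" and H': "Ck (Suc (n - Suc k)) H W"
    by (rule Ck_le[OF G], simp, rule Ck_le[OF H], use n in simp, rule Ck_le[OF H], use n in simp)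
  \<comment> \<open>Of the two terms of the commutator, the first differentiates a function that
    vanishes on all of \<open>W\<close> by the induction hypothesis; the second is the derivative of
    the next \<phi> along the previous bracket. Thus a bracket shifts the index at the cost of a
    sign.\<close>
  have step: "Df (\<phi> i) x (bracket H ?G x) = - Df (\<phi> (Suc i)) x (?G x)"
    if x: "x \<in> W" and i: "Suc (i + Suc k) \<le> n" for i x
  proof -
    have i2: "Ck 2 (\<phi> i) W" by (rule \<phi>) (use i in simp)
    have E1: "Df (\<lambda>y. 0) x = Df (\<lambda>y. Df (\<phi> i) y (?G y)) x"
    proof (rule frechet_derivative_transform_within_open[OF _ W x])
      show "0 = Df (\<phi> i) y (?G y)" if "y \<in> W" for y
        using IH0[OF that, of i] i by simp
    qed simp
    have E2: "Df (\<phi> (Suc i)) x = Df (\<lambda>y. Df (\<phi> i) y (H y)) x"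
    proof (rule frechet_derivative_transform_within_open[OF _ W x])
      have "Ck 2 (\<phi> (Suc i)) W" by (rule \<phi>) (use i in simp)
      then show "\<phi> (Suc i) differentiable at x" using x by (simp add: numeral_2_eq_2)
      show "\<phi> (Suc i) y = Df (\<phi> i) y (H y)" if "y \<in> W" for y
        by (rule next_[OF _ that]) (use i in simp)
    qed
    show ?thesis
      unfolding Df_bracket[OF W x i2 G1 H1] E1[symmetric] E2 by simp
  qed
  have A: "Ck (n - Suc k) (bracket H ?G) W"
    by (rule Ck_bracket[OF W G H'])
  have B: "Df (\<phi> i) x (bracket H ?G x) = 0" if "x \<in> W" "Suc (i + Suc k) < n" for i x
  proof -
    have "Df (\<phi> (Suc i)) x (?G x) = 0" by (rule IH0[OF that(1)]) (use that(2) in simp)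
    then show ?thesis by (subst step[OF that(1)]) (use that(2) in simp_all)
  qed
  have C: "Df (\<phi> i) x (bracket H ?G x) \<noteq> 0" if "x \<in> W" "Suc (i + Suc k) = n" for i x
  proof -
    have "Df (\<phi> (Suc i)) x (?G x) \<noteq> 0" by (rule IH1[OF that(1)]) (use that(2) in simp)
    then show ?thesis by (subst step[OF that(1)]) (use that(2) in simp_all)
  qed
  show ?case
    unfolding funpow.simps o_apply by (intro conjI allI impI A; (erule (1) B | erule (1) C))
qed

text \<open>The derivatives of the \<phi> i along the iterated brackets form a matrix that is
  triangular with respect to the antidiagonal, with nonzero antidiagonal. Hence the brackets are
  independent, and being as many as the dimension they span. A vector in their span that is
  annihilated by all differentials is zero.\<close>

lemma relative_degree_independent:
  fixes \<phi> :: "nat \<Rightarrow> 'e::euclidean_space \<Rightarrow> real"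
  assumes W: "open W" and n: "n = DIM('e)" and \<phi>: "\<And>i. i < n \<Longrightarrow> Ck 2 (\<phi> i) W"
    and H: "Ck n H W" and g: "Ck n g W"
    and next_: "\<And>i x. Suc i < n \<Longrightarrow> x \<in> W \<Longrightarrow> \<phi> (Suc i) x = Df (\<phi> i) x (H x)"
    and zero: "\<And>i x. Suc i < n \<Longrightarrow> x \<in> W \<Longrightarrow> Df (\<phi> i) x (g x) = 0"
    and nonzero: "\<And>i x. Suc i = n \<Longrightarrow> x \<in> W \<Longrightarrow> Df (\<phi> i) x (g x) \<noteq> 0"
    and x: "x \<in> W" and v: "\<And>i. i < n \<Longrightarrow> Df (\<phi> i) x v = 0"
  shows "v = 0"
proof -
  obtain b :: "nat \<Rightarrow> 'e" where b: "bij_betw b {0..<n} Basis"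
    using ex_bij_betw_nat_finite[of "Basis :: 'e set"] n by auto
  define G where "G k = (bracket H ^^ k) g x" for k
  have G0: "Df (\<phi> i) x (G k) = 0" if "Suc (i + k) < n" for i k
    using relative_degree_brackets[where W = W and \<phi> = \<phi> and n = n and H = H and g = g,
        OF W \<phi> H g next_ zero nonzero, of k] that x
    by (simp add: G_def)
  have G1: "Df (\<phi> i) x (G k) \<noteq> 0" if "Suc (i + k) = n" for i k
    using relative_degree_brackets[where W = W and \<phi> = \<phi> and n = n and H = H and g = g,
        OF W \<phi> H g next_ zero nonzero, of k] that x
    by (simp add: G_def)
  define T where "T c = (\<Sum>k<n. (c \<bullet> b k) *\<^sub>R G k)" for c
  have lin: "linear (Df (\<phi> i) x)" if "i < n" for i
    using \<phi>[OF that] x by (intro Df_linear) (simp add: numeral_2_eq_2)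
  have key: "c = 0" if c: "\<And>i. i < n \<Longrightarrow> Df (\<phi> i) x (T c) = 0" for c
  proof (rule ccontr)
    assume "c \<noteq> 0"
    then obtain d where "d \<in> Basis" "c \<bullet> d \<noteq> 0"
      using euclidean_eq_iff[of c 0] by auto
    then obtain k where k: "k < n" "c \<bullet> b k \<noteq> 0"
      using b unfolding bij_betw_def by force
    define M where "M = {k. k < n \<and> c \<bullet> b k \<noteq> 0}"
    define m where "m = Max M"
    have fin: "finite M" unfolding M_def by simp
    have "m \<in> M"
      unfolding m_def by (rule Max_in[OF fin]) (use k in \<open>auto simp: M_def\<close>)
    then have m: "m < n" "c \<bullet> b m \<noteq> 0" by (auto simp: M_def)
    have above: "c \<bullet> b k = 0" if "m < k" "k < n" for k
    proof (rule ccontr)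
      assume "c \<bullet> b k \<noteq> 0"
      then have "k \<in> M" using that by (simp add: M_def)
      from Max_ge[OF fin this] that show False by (simp add: m_def)
    qed
    \<comment> \<open>The row paired with \<open>m\<close> on the antidiagonal: the terms with k < m
      vanish by \<open>G0\<close>, those with k > m by maximality of \<open>m\<close>, so a single
      nonzero term is left.\<close>
    define i where "i = n - Suc m"
    have i: "i < n" "Suc (i + m) = n" using m by (auto simp: i_def)
    have "Df (\<phi> i) x (T c) = (\<Sum>k<n. (c \<bullet> b k) * Df (\<phi> i) x (G k))"
      unfolding T_def by (simp add: linear_sum[OF lin[OF i(1)]] linear_cmul[OF lin[OF i(1)]])
    also have "\<dots> = (\<Sum>k<n. if k = m then (c \<bullet> b m) * Df (\<phi> i) x (G m) else 0)"
    proof (rule sum.cong)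
      fix k assume "k \<in> {..<n}"
      then show "(c \<bullet> b k) * Df (\<phi> i) x (G k) = (if k = m then (c \<bullet> b m) * Df (\<phi> i) x (G m) else 0)"
        using above[of k] G0[of i k] i by (cases k m rule: linorder_cases) auto
    qed simp
    also have "\<dots> = (c \<bullet> b m) * Df (\<phi> i) x (G m)" using m by simp
    finally show False using m G1[OF i(2)] c[OF i(1)] by simp
  qed
  have "linear T"
    unfolding T_def by (rule linearI) (simp_all add: inner_add_left scaleR_add_left sum.distrib scaleR_sum_right)
  moreover have "inj T"
  proof -
    have "c = 0" if "T c = 0" for c
      using key[of c] lin linear_0 that by metis
    then show ?thesis using linear_injective_0[OF \<open>linear T\<close>] by blast
  qed
  ultimately have "surj T" by (rule linear_inj_imp_surj)
  then obtain c where c: "v = T c" by (metis surjD)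
  then have "c = 0" using key v by blast
  then show ?thesis using c by (simp add: T_def)
qed

section \<open>Flat coordinates on the manifold\<close>

lemma
  assumes "is_chart E X c"
  shows chart_openin: "openin X (chart_dom c)"
    and chart_image: "openin (top_of_set E) (chart_map c ` chart_dom c)"
    and chart_inv_map: "\<And>p. p \<in> chart_dom c \<Longrightarrow> chart_inv c (chart_map c p) = p"
    and chart_map_continuous: "continuous_map (subtopology X (chart_dom c)) euclidean (chart_map c)"
    and chart_open_map: "\<And>U. openin X U \<Longrightarrow> openin (top_of_set E) (chart_map c ` (chart_dom c \<inter> U))"
proof -
  let ?X = "subtopology X (chart_dom c)" and ?Y = "top_of_set (chart_map c ` chart_dom c)"
  have o: "openin X (chart_dom c)" and im: "openin (top_of_set E) (chart_map c ` chart_dom c)"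
    and h: "homeomorphic_map ?X ?Y (chart_map c)"
    using assms by (auto simp: is_chart_def)
  show "openin X (chart_dom c)" "openin (top_of_set E) (chart_map c ` chart_dom c)" by fact+
  have top: "topspace ?X = chart_dom c"
    using openin_subset[OF o] by (auto simp: topspace_subtopology)
  have inj: "inj_on (chart_map c) (chart_dom c)"
    using homeomorphic_imp_injective_map[OF h] by (simp only: top)
  show "chart_inv c (chart_map c p) = p" if "p \<in> chart_dom c" for p
    unfolding chart_inv_def using inj that by (rule inv_into_f_f)
  show "continuous_map ?X euclidean (chart_map c)"
    using homeomorphic_imp_continuous_map[OF h] by (rule continuous_map_into_fulltopology)
  show "openin (top_of_set E) (chart_map c ` (chart_dom c \<inter> U))" if "openin X U" for U
  proof -
    have "openin ?X (chart_dom c \<inter> U)"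
      using that by (auto simp: openin_subtopology)
    then have "openin ?Y (chart_map c ` (chart_dom c \<inter> U))"
      using homeomorphic_imp_open_map[OF h] by (simp add: open_map_def)
    then show ?thesis using openin_trans im by blast
  qed
qed

lemma eventually_in_open_along:
  assumes "continuous_map (top_of_set J) X y" "openin X U" "t \<in> J" "y t \<in> U"
  shows "\<forall>\<^sub>F s in at t within J. y s \<in> U"
proof -
  have "openin (top_of_set J) {s \<in> J. y s \<in> U}"
    using assms(1,2) unfolding continuous_map_def by simp
  then obtain O' where "open O'" "{s \<in> J. y s \<in> U} = J \<inter> O'"
    unfolding openin_open by blast
  then show ?thesis
    unfolding eventually_at_topological using assms(3,4) by (intro exI[of _ O']) auto
qed

definition basis_enum :: "nat \<Rightarrow> 'e::euclidean_space" where
  "basis_enum = (SOME b. bij_betw b {..<DIM('e)} Basis)"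

lemma bij_basis_enum: "bij_betw (basis_enum :: nat \<Rightarrow> 'e::euclidean_space) {..<DIM('e)} Basis"
proof -
  have "\<exists>b. bij_betw b {..<DIM('e)} (Basis :: 'e set)"
    using ex_bij_betw_nat_finite[of "Basis :: 'e set"] by (simp add: atLeast0LessThan)
  then show ?thesis unfolding basis_enum_def by (rule someI_ex)
qed

lemma basis_enum_in_Basis: "k < DIM('e::euclidean_space) \<Longrightarrow> (basis_enum k :: 'e) \<in> Basis"
  using bij_basis_enum[where 'e = 'e] by (auto simp: bij_betw_def)

lemma inner_basis_enum:
  assumes "i < DIM('e::euclidean_space)" "k < DIM('e)"
  shows "(basis_enum i :: 'e) \<bullet> basis_enum k = (if i = k then 1 else 0)"
proof -
  have "(basis_enum i :: 'e) = basis_enum k \<longleftrightarrow> i = k"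
    using bij_basis_enum[where 'e = 'e] assms by (auto simp: bij_betw_def inj_on_def)
  then show ?thesis
    using assms by (simp add: inner_Basis basis_enum_in_Basis)
qed

definition from_coords :: "(nat \<Rightarrow> real) \<Rightarrow> 'e::euclidean_space" where
  "from_coords f = (\<Sum>i<DIM('e). f i *\<^sub>R basis_enum i)"

lemma from_coords_inner:
  assumes "k < DIM('e)" shows "(from_coords f :: 'e::euclidean_space) \<bullet> basis_enum k = f k"
proof -
  have "(from_coords f :: 'e) \<bullet> basis_enum k = (\<Sum>i<DIM('e). if i = k then f k else 0)"
    unfolding from_coords_def inner_sum_left
    by (intro sum.cong) (auto simp: inner_basis_enum assms)
  then show ?thesis using assms by simp
qed

lemma eq_from_coords: "from_coords (\<lambda>i. v \<bullet> basis_enum i) = (v :: 'e::euclidean_space)"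
  unfolding from_coords_def
  using sum.reindex_bij_betw[OF bij_basis_enum, of "\<lambda>b::'e. (v \<bullet> b) *\<^sub>R b"]
  by (simp add: euclidean_representation)

lemma from_coords_cong:
  "(\<And>i. i < DIM('e) \<Longrightarrow> f i = g i) \<Longrightarrow> from_coords f = (from_coords g :: 'e::euclidean_space)"
  unfolding from_coords_def by (intro sum.cong) auto

locale flat_system =
  fixes Y :: "'p topology" and A :: "('p, 'e::euclidean_space) chart set"
    and h1 h2 :: "('p, 'e) vfield"
    and Om :: "'p set" and Yc :: "'c topology" and Ac :: "('c, 'e) chart set"
    and e :: 'e and y1 :: "'p \<Rightarrow> real" and pc :: "'p \<Rightarrow> 'c"
  assumes mani: "smooth_manifold (UNIV :: 'e set) Y A"
    and C1: "Ck_vector_field DIM('e) A h1" and C2: "Ck_vector_field DIM('e) A h2"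
    and splitting: "line_splitting Y A Om Yc Ac e y1 pc"
    and rel_zero: "\<And>i y. i + 2 \<le> DIM('e) \<Longrightarrow> y \<in> Om \<Longrightarrow> lie_deriv A h2 ((lie_deriv A h1 ^^ i) y1) y = 0"
    and rel_nonzero: "\<And>y. y \<in> Om \<Longrightarrow> lie_deriv A h2 ((lie_deriv A h1 ^^ (DIM('e) - 1)) y1) y \<noteq> 0"
    and S_bij: "bij_betw (Smap A h1 y1) Om (topspace (Euclidean_space DIM('e)))"
    and ind1: "independent_of_line_coordinate Om Ac e y1 pc h1"
    and ind2: "independent_of_line_coordinate Om Ac e y1 pc h2"
begin

lemma Om_open: "openin Y Om" and e_Basis: "e \<in> Basis"
  and Yc_mani: "smooth_manifold {v. v \<bullet> e = 0} Yc Ac"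
  and split_bij: "bij_betw (\<lambda>p. (y1 p, pc p)) Om (UNIV \<times> topspace Yc)"
  and product_chart_in: "c \<in> Ac \<Longrightarrow> product_chart Om y1 pc e c \<in> A"
  using splitting by (auto simp: line_splitting_def)

lemma chart: "c \<in> A \<Longrightarrow> is_chart UNIV Y c"
  using mani by (auto simp: smooth_manifold_def)

lemma chart_c: "c \<in> Ac \<Longrightarrow> is_chart {v. v \<bullet> e = 0} Yc c"
  using Yc_mani by (auto simp: smooth_manifold_def)

lemma Om_chart: assumes "p \<in> Om" obtains c where "c \<in> A" "p \<in> chart_dom c"
proof -
  have "p \<in> \<Union> (chart_dom ` A)"
    using mani assms openin_subset[OF Om_open] by (auto simp: smooth_manifold_def)
  then show ?thesis using that by blast
qed

lemma Om_pc_chart: assumes "p \<in> Om" obtains c where "c \<in> Ac" "pc p \<in> chart_dom c"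
proof -
  have "pc p \<in> topspace Yc"
    using split_bij assms by (auto simp: bij_betw_def)
  then have "pc p \<in> \<Union> (chart_dom ` Ac)"
    using Yc_mani by (auto simp: smooth_manifold_def)
  then show ?thesis using that by blast
qed

abbreviation img :: "('p, 'e) chart \<Rightarrow> 'e set" where
  "img c \<equiv> chart_map c ` (chart_dom c \<inter> Om)"

lemma img_open: "c \<in> A \<Longrightarrow> open (img c)"
  using chart_open_map[OF chart Om_open] by simp

lemma img_inv:
  assumes "c \<in> A" "x \<in> img c"
  shows "chart_inv c x \<in> chart_dom c" "chart_inv c x \<in> Om" "chart_map c (chart_inv c x) = x"
  using assms(2) chart_inv_map[OF chart[OF assms(1)]] by auto

text \<open>Regularity is demanded only over \<open>Om\<close>, where \<open>y1\<close> is a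
  coordinate.\<close>

definition Ck_fun :: "nat \<Rightarrow> ('p \<Rightarrow> real) \<Rightarrow> bool" where
  "Ck_fun k f \<longleftrightarrow> (\<forall>c\<in>A. Ck k (f \<circ> chart_inv c) (img c))"

lemma Ck_fun_le: "Ck_fun k f \<Longrightarrow> k' \<le> k \<Longrightarrow> Ck_fun k' f"
  unfolding Ck_fun_def using Ck_le by blast

lemma Ck_fun_differentiable:
  assumes "Ck_fun 1 f" "c \<in> A" "p \<in> chart_dom c" "p \<in> Om"
  shows "(f \<circ> chart_inv c) differentiable at (chart_map c p)"
proof -
  have "Ck (Suc 0) (f \<circ> chart_inv c) (img c)"
    using assms by (simp add: Ck_fun_def One_nat_def del: Ck_on.simps)
  then show ?thesis using assms by (intro Ck_Suc_differentiable[of 0 _ "img c"]) auto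
qed

lemma product_chart_e:
  assumes "c \<in> Ac" "pc p \<in> chart_dom c"
  shows "chart_map (product_chart Om y1 pc e c) p \<bullet> e = y1 p"
proof -
  have "chart_map c (pc p) \<in> {v. v \<bullet> e = 0}"
    using openin_subset[OF chart_image[OF chart_c[OF assms(1)]]] assms(2) by auto
  then show ?thesis
    using e_Basis by (simp add: product_chart_def inner_add_left)
qed

lemma transition_Ck:
  assumes "c \<in> A" "c' \<in> A"
  shows "Ck k (chart_map c' \<circ> chart_inv c) (chart_map c ` (chart_dom c \<inter> chart_dom c'))"
    and "open (chart_map c ` (chart_dom c \<inter> chart_dom c'))"
proof -
  show "Ck k (chart_map c' \<circ> chart_inv c) (chart_map c ` (chart_dom c \<inter> chart_dom c'))"
    using mani assms by (simp add: smooth_manifold_def smooth_transition_def)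
  show "open (chart_map c ` (chart_dom c \<inter> chart_dom c'))"
    using chart_open_map[OF chart[OF assms(1)] chart_openin[OF chart[OF assms(2)]]] by simp
qed

text \<open>In a product chart \<open>y1\<close> is the inner product with \<open>e\<close>, because
  the charts of the other factor take values orthogonal to \<open>e\<close>. Smooth transitions
  carry this over to all charts.\<close>

lemma Ck_fun_y1: "Ck_fun k y1"
  unfolding Ck_fun_def
proof
  fix c assume c: "c \<in> A"
  show "Ck k (y1 \<circ> chart_inv c) (img c)"
  proof (rule Ck_local)
    fix x assume x: "x \<in> img c"
    define p where "p = chart_inv c x"
    have p: "p \<in> chart_dom c" "p \<in> Om" "chart_map c p = x"
      using img_inv[OF c x] by (auto simp: p_def)
    obtain c' where c': "c' \<in> Ac" "pc p \<in> chart_dom c'" using Om_pc_chart[OF p(2)] .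
    define P where "P = product_chart Om y1 pc e c'"
    have P: "P \<in> A" using product_chart_in[OF c'(1)] by (simp add: P_def)
    define U where "U = chart_map c ` (chart_dom c \<inter> chart_dom P)"
    have oU: "open U" unfolding U_def by (rule transition_Ck(2)[OF c P])
    have 1: "Ck k (\<lambda>x. (chart_map P \<circ> chart_inv c) x \<bullet> e) U"
      unfolding U_def by (rule Ck_linear[OF transition_Ck(2)[OF c P] bounded_linear_inner_left transition_Ck(1)[OF c P]])
    have 2: "(chart_map P \<circ> chart_inv c) x \<bullet> e = (y1 \<circ> chart_inv c) x" if "x \<in> U" for x
      using that c' product_chart_e[OF c'(1)] chart_inv_map[OF chart[OF c]]
      by (auto simp: U_def P_def product_chart_def)
    have "Ck k (y1 \<circ> chart_inv c) U"
      by (rule Ck_cong[OF oU 2 1])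
    moreover have "x \<in> U"
      using p c' by (auto simp: U_def P_def product_chart_def)
    ultimately show "\<exists>U. open U \<and> x \<in> U \<and> Ck k (y1 \<circ> chart_inv c) U"
      using oU by blast
  qed
qed

text \<open>The definition evaluates in an arbitrarily chosen chart. The chain rule for the
  transition map and the transformation law of the components of \<open>h\<close> compensate each
  other, so any chart gives the same value.\<close>

lemma lie_deriv_chart:
  assumes f: "Ck_fun 1 f" and h: "Ck_vector_field k A h" and c: "c \<in> A" and p: "p \<in> chart_dom c" "p \<in> Om"
  shows "lie_deriv A h f p = Df (f \<circ> chart_inv c) (chart_map c p) (h c p)"
proof -
  define c0 where "c0 = (SOME c. c \<in> A \<and> p \<in> chart_dom c)"
  have c0: "c0 \<in> A" "p \<in> chart_dom c0"
    using someI[of "\<lambda>c. c \<in> A \<and> p \<in> chart_dom c" c] c p by (auto simp: c0_def)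
  define T where "T = chart_map c \<circ> chart_inv c0"
  define U where "U = chart_map c0 ` (chart_dom c0 \<inter> chart_dom c)"
  have x: "chart_map c0 p \<in> U" using c0 p by (auto simp: U_def)
  have U: "open U" unfolding U_def by (rule transition_Ck(2)[OF c0(1) c])
  have "Ck (Suc 0) T U" unfolding U_def T_def by (rule transition_Ck(1)[OF c0(1) c])
  then have dT: "T differentiable at (chart_map c0 p)" using x by (rule Ck_Suc_differentiable)
  have Tx: "T (chart_map c0 p) = chart_map c p"
    using chart_inv_map[OF chart[OF c0(1)] c0(2)] by (simp add: T_def)
  have df: "(f \<circ> chart_inv c) differentiable at (T (chart_map c0 p))"
    unfolding Tx by (rule Ck_fun_differentiable[OF f c p])
  have "Df ((f \<circ> chart_inv c) \<circ> T) (chart_map c0 p) = Df (f \<circ> chart_inv c0) (chart_map c0 p)"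
  proof (rule frechet_derivative_transform_within_open[OF _ U x])
    show "((f \<circ> chart_inv c) \<circ> T) differentiable at (chart_map c0 p)"
      using differentiable_chain_at[OF dT df] .
    show "((f \<circ> chart_inv c) \<circ> T) z = (f \<circ> chart_inv c0) z" if "z \<in> U" for z
      using that chart_inv_map[OF chart[OF c0(1)]] chart_inv_map[OF chart[OF c]]
      by (auto simp: U_def T_def)
  qed
  moreover have "h c p = Df T (chart_map c0 p) (h c0 p)"
    using h c c0 p unfolding Ck_vector_field_def T_def by blast
  moreover have "lie_deriv A h f p = Df (f \<circ> chart_inv c0) (chart_map c0 p) (h c0 p)"
    by (simp only: lie_deriv_def Let_def c0_def[symmetric])
  ultimately show ?thesis
    using frechet_derivative_compose[OF dT df] unfolding Tx by (metis comp_apply)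
qed

lemma vfield_Ck:
  "Ck_vector_field k A h \<Longrightarrow> c \<in> A \<Longrightarrow> Ck k (h c \<circ> chart_inv c) (img c)"
  unfolding Ck_vector_field_def by (rule Ck_subset[of _ _ "chart_map c ` chart_dom c"]) auto

lemma Ck_fun_lie_deriv:
  assumes f: "Ck_fun (Suc k) f" and h: "Ck_vector_field m A h" and k: "k \<le> m"
  shows "Ck_fun k (lie_deriv A h f)"
  unfolding Ck_fun_def
proof
  fix c assume c: "c \<in> A"
  show "Ck k (lie_deriv A h f \<circ> chart_inv c) (img c)"
  proof (rule Ck_cong[OF img_open[OF c]])
    show "Ck k (\<lambda>x. Df (f \<circ> chart_inv c) x ((h c \<circ> chart_inv c) x)) (img c)"
      using f c unfolding Ck_fun_def
      by (intro Ck_directional[OF img_open[OF c] _ Ck_le[OF vfield_Ck[OF h c] k]]) blast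
    show "Df (f \<circ> chart_inv c) x ((h c \<circ> chart_inv c) x) = (lie_deriv A h f \<circ> chart_inv c) x"
      if "x \<in> img c" for x
      using lie_deriv_chart[OF Ck_fun_le[OF f] h c img_inv(1,2)[OF c that]] img_inv(3)[OF c that]
      by simp
  qed
qed

abbreviation \<phi> :: "nat \<Rightarrow> 'p \<Rightarrow> real" where
  "\<phi> i \<equiv> (lie_deriv A h1 ^^ i) y1"

text \<open>Each Lie derivative costs one order of differentiability. With fields of class C^n this
  leaves class C^2 for all indices below n, as the bracket argument requires, and class C^1 for
  index n.\<close>

lemma Ck_fun_phi: "i \<le> DIM('e) \<Longrightarrow> Ck_fun (Suc (DIM('e) - i)) (\<phi> i)"
proof (induction i)
  case 0
  then show ?case using Ck_fun_y1 by simp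
next
  case (Suc i)
  then have "Ck_fun (Suc (DIM('e) - i)) (\<phi> i)" by simp
  from Ck_fun_lie_deriv[OF this C1] show ?case
    using Suc.prems by (simp add: Suc_diff_Suc)
qed

lemma Ck_fun_phi_1: "i \<le> DIM('e) \<Longrightarrow> Ck_fun 1 (\<phi> i)"
  by (rule Ck_fun_le[OF Ck_fun_phi]) auto

lemma lie_derivs_along_curve:
  assumes f: "Ck_fun 1 f" and y: "continuous_map (top_of_set J) Y y" and t: "t \<in> J" "y t \<in> Om"
    and c: "c \<in> A" "y t \<in> chart_dom c"
    and der: "((chart_map c \<circ> y) has_vector_derivative v1 *\<^sub>R h1 c (y t) + v2 *\<^sub>R h2 c (y t)) (at t within J)"
  shows "((\<lambda>s. f (y s)) has_real_derivative v1 * lie_deriv A h1 f (y t) + v2 * lie_deriv A h2 f (y t)) (at t within J)"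
proof -
  let ?g = "f \<circ> chart_inv c"
  have dg: "?g differentiable at (chart_map c (y t))"
    by (rule Ck_fun_differentiable[OF f c t(2)])
  have "((\<lambda>s. ?g ((chart_map c \<circ> y) s)) has_derivative
     (\<lambda>h. Df ?g (chart_map c (y t)) (h *\<^sub>R (v1 *\<^sub>R h1 c (y t) + v2 *\<^sub>R h2 c (y t))))) (at t within J)"
    using has_derivative_compose[OF der[unfolded has_vector_derivative_def], of ?g "Df ?g (chart_map c (y t))"]
      Df_works[OF dg] by simp
  also have "(\<lambda>h. Df ?g (chart_map c (y t)) (h *\<^sub>R (v1 *\<^sub>R h1 c (y t) + v2 *\<^sub>R h2 c (y t))))
     = (*) (v1 * lie_deriv A h1 f (y t) + v2 * lie_deriv A h2 f (y t))"
    unfolding lie_deriv_chart[OF f C1 c t(2)] lie_deriv_chart[OF f C2 c t(2)]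
    using Df_linear[OF dg] by (simp add: fun_eq_iff linear_cmul linear_add algebra_simps)
  finally have "((\<lambda>s. ?g ((chart_map c \<circ> y) s)) has_derivative
     (*) (v1 * lie_deriv A h1 f (y t) + v2 * lie_deriv A h2 f (y t))) (at t within J)" .
  then have "((\<lambda>s. f (y s)) has_derivative
     (*) (v1 * lie_deriv A h1 f (y t) + v2 * lie_deriv A h2 f (y t))) (at t within J)"
  proof (rule has_derivative_transform_eventually)
    show "\<forall>\<^sub>F s in at t within J. ?g ((chart_map c \<circ> y) s) = f (y s)"
      using eventually_in_open_along[OF y chart_openin[OF chart[OF c(1)]] t(1) c(2)]
      by eventually_elim (simp add: chart_inv_map[OF chart[OF c(1)]])
  qed (use t c in \<open>simp_all add: chart_inv_map[OF chart[OF c(1)]]\<close>)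
  then show ?thesis by (simp add: has_field_derivative_def)
qed

text \<open>
  Affine dependence on \<open>y\<^sub>1\<close> with slope \<open>\<kappa>\<close> along the fibres of the splitting: \<open>\<kappa> = 1\<close> for \<open>y\<^sub>1\<close>
  itself and \<open>\<kappa> = 0\<close> for all its Lie derivatives.
\<close>

definition line_affine :: "real \<Rightarrow> ('p \<Rightarrow> real) \<Rightarrow> bool" where
  "line_affine \<kappa> f \<longleftrightarrow> (\<forall>p\<in>Om. \<forall>p'\<in>Om. pc p = pc p' \<longrightarrow> f p' = f p + \<kappa> * (y1 p' - y1 p))"

lemma Om_translate:
  assumes "p \<in> Om" obtains q where "q \<in> Om" "pc q = pc p" "y1 q = y1 p + r"
proof -
  have "(y1 p + r, pc p) \<in> UNIV \<times> topspace Yc"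
    using split_bij assms by (auto simp: bij_betw_def)
  then have "(y1 p + r, pc p) \<in> (\<lambda>p. (y1 p, pc p)) ` Om"
    using split_bij by (simp add: bij_betw_def)
  then show ?thesis using that by force
qed

text \<open>In a product chart, motion along the line is the translation by \<open>r\<close> times
  \<open>e\<close>. It changes \<open>f\<close> by the constant \<kappa> r, so the derivatives at
  both points agree, and so do the components of \<open>h\<close> by independence of
  \<open>y1\<close>.\<close>

lemma line_affine_lie_deriv:
  assumes f: "Ck_fun 1 f" and sh: "line_affine \<kappa> f" and h: "Ck_vector_field m A h"
    and ind: "independent_of_line_coordinate Om Ac e y1 pc h"
  shows "line_affine 0 (lie_deriv A h f)"
  unfolding line_affine_def
proof (intro ballI impI)
  fix p p' assume p: "p \<in> Om" and p': "p' \<in> Om" and eq: "pc p = pc p'"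
  obtain c where c: "c \<in> Ac" "pc p \<in> chart_dom c" using Om_pc_chart[OF p] .
  define P where "P = product_chart Om y1 pc e c"
  have P: "P \<in> A" using product_chart_in[OF c(1)] by (simp add: P_def)
  have dom: "chart_dom P = {p \<in> Om. pc p \<in> chart_dom c}" by (simp add: P_def product_chart_def)
  have pd: "p \<in> chart_dom P" "p' \<in> chart_dom P" using p p' c eq by (auto simp: dom)
  define r where "r = y1 p' - y1 p"
  have mp: "chart_map P q = y1 q *\<^sub>R e + chart_map c (pc q)" for q by (simp add: P_def product_chart_def)
  have x': "chart_map P p' = chart_map P p + r *\<^sub>R e"
    using eq by (simp add: mp r_def algebra_simps)
  let ?g = "f \<circ> chart_inv P"
  have d': "(?g has_derivative Df ?g (chart_map P p')) (at (chart_map P p + r *\<^sub>R e))"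
    using Df_works[OF Ck_fun_differentiable[OF f P pd(2) p']] by (simp add: x')
  have "((\<lambda>z. z + r *\<^sub>R e) has_derivative (\<lambda>h. h)) (at (chart_map P p))"
    by (auto intro!: derivative_eq_intros)
  from has_derivative_compose[OF this d']
  have "((\<lambda>z. ?g (z + r *\<^sub>R e) - \<kappa> * r) has_derivative (\<lambda>h. Df ?g (chart_map P p') h - 0)) (at (chart_map P p))"
    by (intro has_derivative_diff has_derivative_const)
  then have "(?g has_derivative (\<lambda>h. Df ?g (chart_map P p') h - 0)) (at (chart_map P p))"
  proof (rule has_derivative_transform_within_open[OF _ img_open[OF P]])
    show "chart_map P p \<in> img P" using pd p by auto
    fix z assume z: "z \<in> img P"
    define q where "q = chart_inv P z"
    have q: "q \<in> chart_dom P" "q \<in> Om" "chart_map P q = z"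
      using img_inv[OF P z] by (auto simp: q_def)
    obtain q' where q': "q' \<in> Om" "pc q' = pc q" "y1 q' = y1 q + r" using Om_translate[OF q(2)] .
    have "z + r *\<^sub>R e = chart_map P q'" using q(3) q' by (simp add: mp algebra_simps)
    moreover have "q' \<in> chart_dom P" using q q' by (auto simp: dom)
    ultimately have "?g (z + r *\<^sub>R e) = f q'" by (simp add: chart_inv_map[OF chart[OF P]])
    also have "\<dots> = f q + \<kappa> * r"
      using sh[unfolded line_affine_def, rule_format, OF q(2) q'(1) q'(2)[symmetric]] q'(3) by simp
    finally show "?g (z + r *\<^sub>R e) - \<kappa> * r = ?g z" by (simp add: q_def)
  qed
  then have "Df ?g (chart_map P p) = Df ?g (chart_map P p')"
    unfolding diff_zero by (rule Df_eqI)
  moreover have "h P p = h P p'"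
    using ind c p p' eq unfolding independent_of_line_coordinate_def P_def by blast
  ultimately show "lie_deriv A h f p' = lie_deriv A h f p + 0 * (y1 p' - y1 p)"
    using lie_deriv_chart[OF f h P pd(1) p] lie_deriv_chart[OF f h P pd(2) p'] by simp
qed

lemma line_affine_phi: "i \<le> DIM('e) \<Longrightarrow> line_affine (if i = 0 then 1 else 0) (\<phi> i)"
proof (induction i)
  case 0
  then show ?case by (simp add: line_affine_def)
next
  case (Suc i)
  then have "line_affine (if i = 0 then 1 else 0) (\<phi> i)" by simp
  from line_affine_lie_deriv[OF Ck_fun_phi_1 this C1 ind1] Suc.prems show ?case by simp
qed

definition fn :: "'p \<Rightarrow> real" where "fn = \<phi> DIM('e)"
definition gn :: "'p \<Rightarrow> real" where "gn = lie_deriv A h2 (\<phi> (DIM('e) - 1))"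

lemma Ck_fun_phi_last: "Ck_fun 2 (\<phi> (DIM('e) - 1))"
proof (rule Ck_fun_le[OF Ck_fun_phi])
  show "2 \<le> Suc (DIM('e) - (DIM('e) - 1))" using DIM_positive[where 'a='e] by linarith
qed simp

lemma Ck_fun_fn_gn: "Ck_fun 1 fn" "Ck_fun 1 gn"
proof -
  show "Ck_fun 1 fn" unfolding fn_def by (rule Ck_fun_phi_1) simp
  have "Ck_fun (Suc 1) (\<phi> (DIM('e) - 1))" using Ck_fun_phi_last by (simp add: numeral_2_eq_2 One_nat_def)
  from Ck_fun_lie_deriv[OF this C2] show "Ck_fun 1 gn"
    unfolding gn_def using DIM_positive[where 'a='e] by (simp add: Suc_le_eq One_nat_def)
qed

lemma line_invariant_fn_gn: "line_affine 0 fn" "line_affine 0 gn"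
proof -
  show "line_affine 0 fn" using line_affine_phi[of "DIM('e)"] by (simp add: fn_def)
  show "line_affine 0 gn" unfolding gn_def
    by (rule line_affine_lie_deriv[OF _ line_affine_phi C2 ind2]) (simp_all add: Ck_fun_phi_1)
qed

lemma gn_nonzero: "p \<in> Om \<Longrightarrow> gn p \<noteq> 0"
  unfolding gn_def by (rule rel_nonzero)

section \<open>The inverse of the flat coordinates\<close>

definition Sv :: "'p \<Rightarrow> 'e" where "Sv p = from_coords (\<lambda>i. \<phi> i p)"
definition T :: "'e \<Rightarrow> 'p" where "T = inv_into Om Sv"

lemma Sv_inner: "i < DIM('e) \<Longrightarrow> Sv p \<bullet> basis_enum i = \<phi> i p"
  by (simp add: Sv_def from_coords_inner)

lemma Smap_Sv: "Smap A h1 y1 p = (\<lambda>i. if i < DIM('e) then Sv p \<bullet> basis_enum i else 0)"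
  by (auto simp: Smap_def Sv_inner)

lemma Sv_bij: "bij_betw Sv Om UNIV"
  unfolding bij_betw_def
proof
  show "inj_on Sv Om"
    using S_bij unfolding bij_betw_def inj_on_def Smap_Sv by metis
  have "v \<in> Sv ` Om" for v
  proof -
    have "(\<lambda>i. if i < DIM('e) then v \<bullet> basis_enum i else 0) \<in> Smap A h1 y1 ` Om"
      using S_bij by (auto simp: bij_betw_def topspace_Euclidean_space)
    then obtain p where p: "p \<in> Om" "Smap A h1 y1 p = (\<lambda>i. if i < DIM('e) then v \<bullet> basis_enum i else 0)"
      by auto
    have "\<phi> i p = v \<bullet> basis_enum i" if "i < DIM('e)" for i
      using fun_cong[OF p(2), of i] that by (simp add: Smap_def)
    then have "Sv p = v"
      unfolding Sv_def by (subst eq_from_coords[of v, symmetric]) (rule from_coords_cong)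
    then show ?thesis using p by blast
  qed
  then show "Sv ` Om = UNIV" by blast
qed

lemma Sv_T [simp]: "Sv (T s) = s" and T_Om [simp]: "T s \<in> Om"
  using Sv_bij f_inv_into_f[of s Sv Om] inv_into_into[of s Sv Om] by (auto simp: T_def bij_betw_def)

lemma T_Sv: "p \<in> Om \<Longrightarrow> T (Sv p) = p"
  using Sv_bij by (simp add: T_def bij_betw_def inv_into_f_f)

text \<open>Both compositions with \<open>g'\<close> are recorded: \<open>f'\<close> after
  \<open>g'\<close> serves the open mapping and inverse function theorems, \<open>g'\<close> after
  \<open>f'\<close> recovers velocities on the manifold.\<close>

lemma Sv_derivative:
  assumes c: "c \<in> A" and p: "p \<in> chart_dom c" "p \<in> Om"
  obtains f' g' where "((Sv \<circ> chart_inv c) has_derivative f') (at (chart_map c p))"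
    "linear f'" "\<And>v. f' v = from_coords (\<lambda>i. Df (\<phi> i \<circ> chart_inv c) (chart_map c p) v)"
    "bounded_linear g'" "f' \<circ> g' = id" "g' \<circ> f' = id"
proof -
  define f' where "f' v = (from_coords (\<lambda>i. Df (\<phi> i \<circ> chart_inv c) (chart_map c p) v) :: 'e)" for v
  have d: "(\<phi> i \<circ> chart_inv c) differentiable at (chart_map c p)" if "i < DIM('e)" for i
    using that by (intro Ck_fun_differentiable[OF Ck_fun_phi_1 c p]) simp
  have der: "((Sv \<circ> chart_inv c) has_derivative f') (at (chart_map c p))"
    unfolding f'_def[abs_def] Sv_def[abs_def] from_coords_def comp_def
    by (intro has_derivative_sum has_derivative_scaleR_left) (use Df_works[OF d] in \<open>auto simp: comp_def\<close>)
  have lin: "linear f'" using der has_derivative_linear by blast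
  have inj: "inj f'"
  proof -
    have "v = 0" if "f' v = 0" for v
    proof (rule relative_degree_independent[where n = "DIM('e)" and W = "img c"
          and \<phi> = "\<lambda>i. \<phi> i \<circ> chart_inv c" and H = "h1 c \<circ> chart_inv c" and g = "h2 c \<circ> chart_inv c"
          and x = "chart_map c p"])
      show "Ck 2 (\<phi> i \<circ> chart_inv c) (img c)" if i: "i < DIM('e)" for i
      proof -
        have "Ck_fun 2 (\<phi> i)" using i by (intro Ck_fun_le[OF Ck_fun_phi]) auto
        then show ?thesis using c by (simp add: Ck_fun_def)
      qed
      show "(\<phi> (Suc i) \<circ> chart_inv c) x = Df (\<phi> i \<circ> chart_inv c) x ((h1 c \<circ> chart_inv c) x)"
        if "Suc i < DIM('e)" "x \<in> img c" for i x
        using lie_deriv_chart[OF Ck_fun_phi_1 C1 c img_inv(1,2)[OF c that(2)], of i] that img_inv(3)[OF c that(2)]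
        by simp
      show "Df (\<phi> i \<circ> chart_inv c) x ((h2 c \<circ> chart_inv c) x) = 0"
        if "Suc i < DIM('e)" "x \<in> img c" for i x
        using lie_deriv_chart[OF Ck_fun_phi_1 C2 c img_inv(1,2)[OF c that(2)], of i] that img_inv(2,3)[OF c that(2)]
          rel_zero[of i "chart_inv c x"] by simp
      show "Df (\<phi> i \<circ> chart_inv c) x ((h2 c \<circ> chart_inv c) x) \<noteq> 0"
        if "Suc i = DIM('e)" "x \<in> img c" for i x
      proof -
        have i: "i = DIM('e) - 1" "i \<le> DIM('e)" using that(1) by simp_all
        have "lie_deriv A h2 (\<phi> i) (chart_inv c x) \<noteq> 0"
          unfolding i(1) by (rule rel_nonzero[OF img_inv(2)[OF c that(2)]])
        then show ?thesis
          using lie_deriv_chart[OF Ck_fun_phi_1[OF i(2)] C2 c img_inv(1,2)[OF c that(2)]] img_inv(3)[OF c that(2)]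
          by (simp only: comp_apply not_False_eq_True)
      qed
      show "Df (\<phi> i \<circ> chart_inv c) (chart_map c p) v = 0" if "i < DIM('e)" for i
        using from_coords_inner[OF that, of "\<lambda>i. Df (\<phi> i \<circ> chart_inv c) (chart_map c p) v"] \<open>f' v = 0\<close>
        by (simp add: f'_def)
    qed (use c p img_open vfield_Ck[OF C1 c] vfield_Ck[OF C2 c] in auto)
    then show ?thesis using linear_injective_0[OF lin] by blast
  qed
  obtain g' where g': "linear g'" "\<And>x. g' (f' x) = x" "\<And>x. f' (g' x) = x"
    using linear_injective_isomorphism[OF lin inj] by blast
  show ?thesis
  proof (rule that[OF der lin])
    show "bounded_linear g'" using g'(1) by (simp add: linear_conv_bounded_linear)
    show "f' v = from_coords (\<lambda>i. Df (\<phi> i \<circ> chart_inv c) (chart_map c p) v)" for v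
      by (rule f'_def)
    show "f' \<circ> g' = id" "g' \<circ> f' = id"
      using g'(2,3) by (simp_all add: fun_eq_iff)
  qed
qed

lemma Sv_chart_continuous: "c \<in> A \<Longrightarrow> continuous_on (img c) (Sv \<circ> chart_inv c)"
proof (rule continuous_at_imp_continuous_on, rule ballI)
  fix x assume c: "c \<in> A" and x: "x \<in> img c"
  obtain f' where "((Sv \<circ> chart_inv c) has_derivative f') (at (chart_map c (chart_inv c x)))"
    using Sv_derivative[OF c img_inv(1,2)[OF c x]] by blast
  then show "isCont (Sv \<circ> chart_inv c) x"
    unfolding img_inv(3)[OF c x] by (rule has_derivative_continuous)
qed

text \<open>Invertibility of the derivative at every point gives local surjectivity. For the
  bijection \<open>Sv\<close>, openness is the same as continuity of the inverse
  \<open>T\<close>.\<close>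

lemma Sv_open_map:
  assumes U: "openin Y U" shows "open (Sv ` (Om \<inter> U))"
proof -
  have "Sv p \<in> interior (Sv ` (Om \<inter> U))" if p: "p \<in> Om" "p \<in> U" for p
  proof -
    obtain c where c: "c \<in> A" "p \<in> chart_dom c" using Om_chart[OF p(1)] .
    let ?W = "chart_map c ` (chart_dom c \<inter> (Om \<inter> U))"
    have W: "open ?W" using chart_open_map[OF chart[OF c(1)] openin_Int[OF Om_open U]] by simp
    obtain f' g' where fg: "((Sv \<circ> chart_inv c) has_derivative f') (at (chart_map c p))"
      "bounded_linear g'" "f' \<circ> g' = id"
      using Sv_derivative[OF c p(1)] by blast
    have cont: "continuous_on ?W (Sv \<circ> chart_inv c)"
      by (rule continuous_on_subset[OF Sv_chart_continuous[OF c(1)]]) auto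
    have xW: "chart_map c p \<in> ?W" using c p by auto
    have "(Sv \<circ> chart_inv c) (chart_map c p) \<in> interior ((Sv \<circ> chart_inv c) ` ?W)"
      by (rule sussmann_open_mapping[OF W cont xW fg order.refl]) (use W xW in \<open>simp add: interior_open\<close>)
    moreover have "(Sv \<circ> chart_inv c) ` ?W \<subseteq> Sv ` (Om \<inter> U)"
      using chart_inv_map[OF chart[OF c(1)]] by auto
    ultimately have "(Sv \<circ> chart_inv c) (chart_map c p) \<in> interior (Sv ` (Om \<inter> U))"
      using interior_mono by blast
    then show ?thesis
      by (simp add: chart_inv_map[OF chart[OF c(1)] c(2)])
  qed
  then have "Sv ` (Om \<inter> U) \<subseteq> interior (Sv ` (Om \<inter> U))" by blast
  then show ?thesis using interior_subset open_interior by (metis subset_antisym)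
qed

lemma T_continuous: "continuous_map euclidean Y T"
  unfolding continuous_map_def
proof (intro conjI allI impI)
  show "T \<in> topspace euclidean \<rightarrow> topspace Y"
    using openin_subset[OF Om_open] T_Om by blast
  fix U assume "openin Y U"
  moreover have "{x \<in> topspace euclidean. T x \<in> U} = Sv ` (Om \<inter> U)"
    using T_Sv by (auto simp: image_iff intro!: bexI[of _ "T _"])
  ultimately show "openin euclidean {x \<in> topspace euclidean. T x \<in> U}"
    using Sv_open_map by simp
qed

text \<open>The derivative of \<open>Sv\<close> sends the velocity prescribed by the fields to the
  vector of Lie derivatives along them, which is the velocity of \<open>s\<close>; the inverse
  derivative sends it back.\<close>

lemma T_lifts_curve:
  assumes c: "c \<in> A" "T (s t) \<in> chart_dom c" and t: "t \<in> J"
    and s: "(s has_vector_derivative from_coords (\<lambda>i. v1 * lie_deriv A h1 (\<phi> i) (T (s t)) +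
        v2 * lie_deriv A h2 (\<phi> i) (T (s t)))) (at t within J)"
  shows "((chart_map c \<circ> T \<circ> s) has_vector_derivative
      v1 *\<^sub>R h1 c (T (s t)) + v2 *\<^sub>R h2 c (T (s t))) (at t within J)"
proof -
  define p where "p = T (s t)"
  define v where "v = v1 *\<^sub>R h1 c p + v2 *\<^sub>R h2 c p"
  have p: "p \<in> chart_dom c" "p \<in> Om" using c by (auto simp: p_def)
  obtain f' g' where fg: "((Sv \<circ> chart_inv c) has_derivative f') (at (chart_map c p))"
      "linear f'" "\<And>v. f' v = from_coords (\<lambda>i. Df (\<phi> i \<circ> chart_inv c) (chart_map c p) v)"
      "bounded_linear g'" "f' \<circ> g' = id" "g' \<circ> f' = id"
    by (rule Sv_derivative[OF c(1) p], rule that)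
  have x: "chart_map c p \<in> img c" using p by auto
  have "((chart_map c \<circ> T) has_derivative g') (at ((Sv \<circ> chart_inv c) (chart_map c p)))"
  proof (rule has_derivative_inverse_strong[OF img_open[OF c(1)] x Sv_chart_continuous[OF c(1)] _ fg(1,5)])
    show "(chart_map c \<circ> T) ((Sv \<circ> chart_inv c) z) = z" if "z \<in> img c" for z
      using img_inv[OF c(1) that] T_Sv by simp
  qed
  then have g: "((chart_map c \<circ> T) has_derivative g') (at (s t))"
    using chart_inv_map[OF chart[OF c(1)] p(1)] by (simp add: p_def)
  have "f' v = from_coords (\<lambda>i. v1 * lie_deriv A h1 (\<phi> i) p + v2 * lie_deriv A h2 (\<phi> i) p)"
    unfolding fg(3)
  proof (rule from_coords_cong)
    fix i assume i: "i < DIM('e)"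
    have r: "Ck_fun 1 (\<phi> i)" using i by (intro Ck_fun_phi_1) simp
    have "linear (Df (\<phi> i \<circ> chart_inv c) (chart_map c p))"
      by (rule Df_linear[OF Ck_fun_differentiable[OF r c(1) p]])
    then show "Df (\<phi> i \<circ> chart_inv c) (chart_map c p) v = v1 * lie_deriv A h1 (\<phi> i) p + v2 * lie_deriv A h2 (\<phi> i) p"
      unfolding v_def lie_deriv_chart[OF r C1 c(1) p] lie_deriv_chart[OF r C2 c(1) p]
      by (simp add: linear_add linear_cmul)
  qed
  then have "(s has_derivative (\<lambda>h. h *\<^sub>R f' v)) (at t within J)"
    using s by (simp add: has_vector_derivative_def p_def)
  from has_derivative_compose[OF this g]
  have "((\<lambda>r. (chart_map c \<circ> T) (s r)) has_derivative (\<lambda>h. g' (h *\<^sub>R f' v))) (at t within J)" .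
  moreover have "g' (h *\<^sub>R f' v) = h *\<^sub>R v" for h
    using fun_cong[OF fg(6), of v] linear_cmul[OF bounded_linear.linear[OF fg(4)]] by simp
  ultimately show ?thesis
    by (simp add: has_vector_derivative_def comp_def v_def p_def)
qed

text \<open>Along a fibre \<open>y1\<close>, the first coordinate of \<open>Sv\<close>, moves
  freely, and the other coordinates are constant by \<open>line_affine_phi\<close>. Injectivity of
  \<open>Sv\<close> identifies the translated point.\<close>

lemma T_translate: "pc (T (s + r *\<^sub>R basis_enum 0)) = pc (T s)"
proof -
  obtain q where q: "q \<in> Om" "pc q = pc (T s)" "y1 q = y1 (T s) + r"
    using Om_translate[OF T_Om] .
  have "Sv q = from_coords (\<lambda>i. (s + r *\<^sub>R basis_enum 0) \<bullet> basis_enum i)"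
    unfolding Sv_def
  proof (rule from_coords_cong)
    fix i assume i: "i < DIM('e)"
    have "\<phi> i q = \<phi> i (T s) + (if i = 0 then 1 else 0) * (y1 q - y1 (T s))"
      using line_affine_phi[OF less_imp_le[OF i], unfolded line_affine_def, rule_format, OF T_Om q(1) q(2)[symmetric]] .
    also have "\<phi> i (T s) = s \<bullet> basis_enum i" using Sv_inner[OF i, of "T s"] by simp
    finally show "\<phi> i q = (s + r *\<^sub>R basis_enum 0) \<bullet> basis_enum i"
      using q(3) i by (simp add: inner_add_left inner_basis_enum)
  qed
  then have "Sv q = s + r *\<^sub>R basis_enum 0" by (simp only: eq_from_coords)
  then show ?thesis using T_Sv[OF q(1)] q(2) by simp
qed

lemma line_invariant_T_translate:
  assumes "line_affine 0 f" shows "f (T (s + r *\<^sub>R basis_enum 0)) = f (T s)"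
  using assms[unfolded line_affine_def, rule_format, OF T_Om T_Om T_translate[symmetric], of s r] by simp

lemma Ck_fun_T_continuous:
  assumes "Ck_fun 1 f" shows "continuous_on UNIV (\<lambda>s. f (T s))"
proof -
  have "isCont (\<lambda>s. f (T s)) s" for s
  proof -
    obtain c where c: "c \<in> A" "T s \<in> chart_dom c" using Om_chart[OF T_Om] .
    obtain f' g' where fg: "((Sv \<circ> chart_inv c) has_derivative f') (at (chart_map c (T s)))" "f' \<circ> g' = id"
      using Sv_derivative[OF c T_Om] by blast
    have x: "chart_map c (T s) \<in> img c" using c by auto
    have "((chart_map c \<circ> T) has_derivative g') (at ((Sv \<circ> chart_inv c) (chart_map c (T s))))"
    proof (rule has_derivative_inverse_strong[OF img_open[OF c(1)] x Sv_chart_continuous[OF c(1)] _ fg])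
      show "(chart_map c \<circ> T) ((Sv \<circ> chart_inv c) z) = z" if "z \<in> img c" for z
        using img_inv[OF c(1) that] T_Sv by simp
    qed
    then have "isCont (chart_map c \<circ> T) s"
      using has_derivative_continuous chart_inv_map[OF chart[OF c(1)] c(2)] by fastforce
    then have "isCont ((f \<circ> chart_inv c) \<circ> (chart_map c \<circ> T)) s"
      by (rule continuous_at_compose) (use differentiable_imp_continuous_within[OF Ck_fun_differentiable[OF assms c T_Om]] in simp)
    moreover have ev: "\<forall>\<^sub>F s' in nhds s. ((f \<circ> chart_inv c) \<circ> (chart_map c \<circ> T)) s' = f (T s')"
    proof -
      have "open {s'. T s' \<in> chart_dom c}"
        using T_continuous chart_openin[OF chart[OF c(1)]] unfolding continuous_map_def by simp
      then have "\<forall>\<^sub>F s' in nhds s. s' \<in> {s'. T s' \<in> chart_dom c}"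
        using c(2) by (intro eventually_nhds_in_open) auto
      then show ?thesis
        by eventually_elim (simp add: chart_inv_map[OF chart[OF c(1)]])
    qed
    ultimately show ?thesis by (simp only: isCont_cong[OF ev])
  qed
  then show ?thesis by (simp add: continuous_on_eq_continuous_at)
qed

lemma T_in_topspace: "pc (T s) \<in> topspace Yc"
  using bij_betw_imp_surj_on[OF split_bij] T_Om[of s] by blast

text \<open>\<open>line_splitting\<close> requires only a bijection together with product charts;
  continuity of the projection has to be read off those charts.\<close>

lemma pc_T_continuous: "continuous_map euclidean Yc (\<lambda>s. pc (T s))"
  unfolding continuous_map_def
proof (intro conjI allI impI)
  show "(\<lambda>s. pc (T s)) \<in> topspace euclidean \<rightarrow> topspace Yc"
    using T_in_topspace by blast
  fix U assume U: "openin Yc U"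
  have "\<exists>O'. open O' \<and> s \<in> O' \<and> O' \<subseteq> {s. pc (T s) \<in> U}" if s: "pc (T s) \<in> U" for s
  proof -
    obtain c where c: "c \<in> Ac" "pc (T s) \<in> chart_dom c" using Om_pc_chart[OF T_Om] .
    define P where "P = product_chart Om y1 pc e c"
    have P: "P \<in> A" using product_chart_in[OF c(1)] by (simp add: P_def)
    have dom: "chart_dom P = {p \<in> Om. pc p \<in> chart_dom c}" by (simp add: P_def product_chart_def)
    have mp: "chart_map P q = y1 q *\<^sub>R e + chart_map c (pc q)" for q by (simp add: P_def product_chart_def)
    have "openin (top_of_set {v. v \<bullet> e = 0}) (chart_map c ` (chart_dom c \<inter> U))"
      by (rule chart_open_map[OF chart_c[OF c(1)] U])
    then obtain W where W: "open W" "chart_map c ` (chart_dom c \<inter> U) = {v. v \<bullet> e = 0} \<inter> W"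
      unfolding openin_open by blast
    \<comment> \<open>\<open>Q\<close> deletes the component along \<open>e\<close>. Applied after a
      product chart it gives the chart of the second factor, so a relatively open set of the
      hyperplane pulls back to an open set of the manifold.\<close>
    define Q where "Q x = x - (x \<bullet> e) *\<^sub>R e" for x :: 'e
    have "open (Q -` W)"
      unfolding Q_def by (intro open_vimage W continuous_intros)
    have Q: "Q (chart_map P q) = chart_map c (pc q)" if "q \<in> chart_dom P" for q
      using product_chart_e[OF c(1), of q] that unfolding Q_def by (simp add: dom mp P_def[symmetric])
    have "openin (subtopology Y (chart_dom P)) {q \<in> chart_dom P. chart_map P q \<in> Q -` W}"
    proof -
      have "{x \<in> topspace (subtopology Y (chart_dom P)). chart_map P x \<in> Q -` W} = {q \<in> chart_dom P. chart_map P q \<in> Q -` W}"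
        using openin_subset[OF chart_openin[OF chart[OF P]]] by (auto simp: topspace_subtopology)
      then show ?thesis
        using chart_map_continuous[OF chart[OF P], unfolded continuous_map_def, THEN conjunct2, rule_format,
            of "Q -` W"] \<open>open (Q -` W)\<close>
        by (simp only: open_openin[symmetric])
    qed
    then have o: "openin Y {q \<in> chart_dom P. chart_map P q \<in> Q -` W}"
      using openin_trans_full chart_openin[OF chart[OF P]] by blast
    have sub: "pc q \<in> U" if q: "q \<in> chart_dom P" "chart_map P q \<in> Q -` W" for q
    proof -
      have d: "pc q \<in> chart_dom c" using q(1) by (simp add: dom)
      have "chart_map c (pc q) \<in> {v. v \<bullet> e = 0}"
        using openin_subset[OF chart_image[OF chart_c[OF c(1)]]] d by auto
      moreover have "chart_map c (pc q) \<in> W" using q(2) Q[OF q(1)] by simp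
      ultimately have "chart_map c (pc q) \<in> chart_map c ` (chart_dom c \<inter> U)" using W(2) by simp
      then obtain r where r: "r \<in> chart_dom c" "r \<in> U" "chart_map c (pc q) = chart_map c r" by blast
      have "pc q = chart_inv c (chart_map c (pc q))" by (rule chart_inv_map[OF chart_c[OF c(1)] d, symmetric])
      also have "\<dots> = r" unfolding r(3) by (rule chart_inv_map[OF chart_c[OF c(1)] r(1)])
      finally show ?thesis using r(2) by simp
    qed
    define O' where "O' = {s. T s \<in> {q \<in> chart_dom P. chart_map P q \<in> Q -` W}}"
    have "open O'"
      using T_continuous[unfolded continuous_map_def, THEN conjunct2, rule_format, OF o]
      by (simp add: O'_def)
    moreover have "s \<in> O'"
    proof -
      have d: "T s \<in> chart_dom P" using c(2) by (simp add: dom)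
      have "chart_map c (pc (T s)) \<in> W" using W(2) c(2) s by blast
      then show ?thesis using Q[OF d] d by (simp add: O'_def)
    qed
    moreover have "O' \<subseteq> {s. pc (T s) \<in> U}" using sub by (auto simp: O'_def)
    ultimately show ?thesis by blast
  qed
  then have "open {s. pc (T s) \<in> U}"
    by (subst open_subopen) blast
  then show "openin euclidean {x \<in> topspace euclidean. pc (T x) \<in> U}" by simp
qed

end

section \<open>Reference trajectories\<close>

text \<open>Guarantees uniqueness of derivatives on the half-line, including the one-sided
  derivative at 0.\<close>

lemma halfline_not_bot: "0 \<le> t \<Longrightarrow> at (t::real) within {0..} \<noteq> bot"
  using at_within_nhd[of t "{..<t+1}" "{0..}" "{0..t+1}"]
  by (simp add: trivial_limit_within islimpt_Icc) (auto simp: trivial_limit_within intro: islimpt_subset[of t "{t..t+1}"])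

text \<open>Boundedness of a function and its first \<open>m\<close> derivatives on the half-line.
  The derivative is quantified existentially, so that the algebraic closure properties need no
  formulas for derivatives of higher order.\<close>

primrec bdd_diff :: "nat \<Rightarrow> (real \<Rightarrow> real) \<Rightarrow> bool" where
  "bdd_diff 0 f \<longleftrightarrow> (\<exists>B. \<forall>t\<ge>0. \<bar>f t\<bar> \<le> B)"
| "bdd_diff (Suc m) f \<longleftrightarrow> (\<exists>B. \<forall>t\<ge>0. \<bar>f t\<bar> \<le> B) \<and>
     (\<exists>f'. (\<forall>t\<ge>0. (f has_real_derivative f' t) (at t within {0..})) \<and> bdd_diff m f')"

lemma bdd_diff_bounded: "bdd_diff m f \<Longrightarrow> \<exists>B. \<forall>t\<ge>0. \<bar>f t\<bar> \<le> B"
  by (cases m) auto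

lemma bdd_diff_cong: "bdd_diff m f \<Longrightarrow> (\<And>t. 0 \<le> t \<Longrightarrow> f t = g t) \<Longrightarrow> bdd_diff m g"
proof (cases m)
  case 0
  assume "bdd_diff m f" "\<And>t. 0 \<le> t \<Longrightarrow> f t = g t"
  with 0 show ?thesis by auto
next
  case (Suc k)
  assume f: "bdd_diff m f" and eq: "\<And>t. 0 \<le> t \<Longrightarrow> f t = g t"
  then obtain f' where f': "\<And>t. 0 \<le> t \<Longrightarrow> (f has_real_derivative f' t) (at t within {0..})" "bdd_diff k f'"
    using Suc by auto
  have "(g has_real_derivative f' t) (at t within {0..})" if "0 \<le> t" for t
    using f'(1)[OF that] eq that
    by (intro has_field_derivative_transform_within[OF f'(1)[OF that], of 1]) auto
  moreover have "\<exists>B. \<forall>t\<ge>0. \<bar>g t\<bar> \<le> B"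
    using bdd_diff_bounded[OF f] eq by auto
  ultimately show ?thesis using Suc f'(2) by auto
qed

lemma bdd_diff_derivative:
  assumes "bdd_diff (Suc m) f" "\<And>t. 0 \<le> t \<Longrightarrow> (f has_real_derivative g t) (at t within {0..})"
  shows "bdd_diff m g"
proof -
  obtain f' where f': "\<And>t. 0 \<le> t \<Longrightarrow> (f has_real_derivative f' t) (at t within {0..})" "bdd_diff m f'"
    using assms(1) by auto
  show ?thesis
    by (rule bdd_diff_cong[OF f'(2)])
      (rule has_field_derivative_unique[OF f'(1) assms(2) halfline_not_bot])
qed

lemma bdd_diff_Suc_imp: "bdd_diff (Suc m) f \<Longrightarrow> bdd_diff m f"
proof (induction m arbitrary: f)
  case (Suc m)
  then obtain f' where "\<And>t. 0 \<le> t \<Longrightarrow> (f has_real_derivative f' t) (at t within {0..})" "bdd_diff (Suc m) f'"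
    by auto
  moreover have "bdd_diff m f'" using Suc.IH calculation by blast
  ultimately show ?case using bdd_diff_bounded[OF Suc.prems] by auto
qed auto

lemma bdd_diff_const: "bdd_diff m (\<lambda>t. c)"
  by (induction m arbitrary: c) (auto intro!: exI[of _ "\<lambda>t. 0"] exI[of _ "\<bar>_\<bar>"])

lemma bdd_diff_add: "bdd_diff m f \<Longrightarrow> bdd_diff m g \<Longrightarrow> bdd_diff m (\<lambda>t. f t + g t)"
proof (induction m arbitrary: f g)
  have b: "\<exists>B. \<forall>t\<ge>0. \<bar>f t + g t\<bar> \<le> B"
    if bf: "\<exists>B. \<forall>t\<ge>0. \<bar>f t\<bar> \<le> B" and bg: "\<exists>B. \<forall>t\<ge>0. \<bar>g t\<bar> \<le> B" for f g :: "real \<Rightarrow> real"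
  proof -
    obtain B1 where B1: "\<And>t. t \<ge> 0 \<Longrightarrow> \<bar>f t\<bar> \<le> B1" using bf by blast
    obtain B2 where "\<And>t. t \<ge> 0 \<Longrightarrow> \<bar>g t\<bar> \<le> B2" using bg by blast
    with B1 have "\<bar>f t + g t\<bar> \<le> B1 + B2" if "t \<ge> 0" for t
      using abs_triangle_ineq[of "f t" "g t"] that by (meson add_mono order.trans)
    then show ?thesis by blast
  qed
  { case 0 then show ?case using b by simp }
  case (Suc m)
  then obtain f' g' where d: "\<And>t. 0 \<le> t \<Longrightarrow> (f has_real_derivative f' t) (at t within {0..})" "bdd_diff m f'"
    "\<And>t. 0 \<le> t \<Longrightarrow> (g has_real_derivative g' t) (at t within {0..})" "bdd_diff m g'"
    by auto
  show ?case
    unfolding bdd_diff.simps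
    using b[OF bdd_diff_bounded[OF Suc.prems(1)] bdd_diff_bounded[OF Suc.prems(2)]] DERIV_add[OF d(1,3)]
      Suc.IH[OF d(2,4)]
    by (intro conjI exI[of _ "\<lambda>t. f' t + g' t"]) auto
qed

lemma bdd_diff_mult: "bdd_diff m f \<Longrightarrow> bdd_diff m g \<Longrightarrow> bdd_diff m (\<lambda>t. f t * g t)"
proof (induction m arbitrary: f g)
  have b: "\<exists>B. \<forall>t\<ge>0. \<bar>f t * g t\<bar> \<le> B"
    if bf: "\<exists>B. \<forall>t\<ge>0. \<bar>f t\<bar> \<le> B" and bg: "\<exists>B. \<forall>t\<ge>0. \<bar>g t\<bar> \<le> B" for f g :: "real \<Rightarrow> real"
  proof -
    obtain B1 where B1: "\<And>t. t \<ge> 0 \<Longrightarrow> \<bar>f t\<bar> \<le> B1" using bf by blast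
    obtain B2 where "\<And>t. t \<ge> 0 \<Longrightarrow> \<bar>g t\<bar> \<le> B2" using bg by blast
    with B1 have "\<bar>f t * g t\<bar> \<le> B1 * B2" if "t \<ge> 0" for t
      unfolding abs_mult using that by (intro mult_mono) (auto intro: order.trans[OF abs_ge_zero])
    then show ?thesis by blast
  qed
  { case 0 then show ?case using b by simp }
  case (Suc m)
  then obtain f' g' where d: "\<And>t. 0 \<le> t \<Longrightarrow> (f has_real_derivative f' t) (at t within {0..})" "bdd_diff m f'"
    "\<And>t. 0 \<le> t \<Longrightarrow> (g has_real_derivative g' t) (at t within {0..})" "bdd_diff m g'"
    by auto
  have "bdd_diff m (\<lambda>t. f' t * g t + g' t * f t)"
    using Suc.IH[OF d(2) bdd_diff_Suc_imp[OF Suc.prems(2)]] Suc.IH[OF d(4) bdd_diff_Suc_imp[OF Suc.prems(1)]]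
    by (rule bdd_diff_add)
  then show ?case
    unfolding bdd_diff.simps
    using b[OF bdd_diff_bounded[OF Suc.prems(1)] bdd_diff_bounded[OF Suc.prems(2)]] DERIV_mult[OF d(1,3)]
    by (intro conjI exI[of _ "\<lambda>t. f' t * g t + g' t * f t"]) auto
qed

text \<open>With r = 1 / sqrt g the derivative is - g' r^3 / 2, again a product of \<open>g'\<close>
  and \<open>r\<close>, so the induction closes under products.\<close>

lemma bdd_diff_inverse_sqrt:
  assumes c: "0 < c" "\<And>t. 0 \<le> t \<Longrightarrow> c \<le> g t"
  shows "bdd_diff m g \<Longrightarrow> bdd_diff m (\<lambda>t. inverse (sqrt (g t)))"
proof (induction m)
  have b: "\<bar>inverse (sqrt (g t))\<bar> \<le> inverse (sqrt c)" if "0 \<le> t" for t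
    using c(1) c(2)[OF that] by (simp add: le_imp_inverse_le)
  { case 0 then show ?case using b by auto }
  case (Suc m)
  then obtain g' where g': "\<And>t. 0 \<le> t \<Longrightarrow> (g has_real_derivative g' t) (at t within {0..})" "bdd_diff m g'"
    by auto
  have r: "bdd_diff m (\<lambda>t. inverse (sqrt (g t)))"
    using Suc.IH bdd_diff_Suc_imp[OF Suc.prems] by blast
  have "((\<lambda>t. inverse (sqrt (g t))) has_real_derivative
      - (1/2) * (g' t * (inverse (sqrt (g t)) * (inverse (sqrt (g t)) * inverse (sqrt (g t)))))) (at t within {0..})"
    if t: "0 \<le> t" for t
  proof -
    have "0 < g t" using c(1) c(2)[OF t] by linarith
    then show ?thesis
      using g'(1)[OF t] by (auto intro!: derivative_eq_intros simp: field_simps)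
  qed
  moreover have "bdd_diff m (\<lambda>t. - (1/2) * (g' t * (inverse (sqrt (g t)) * (inverse (sqrt (g t)) * inverse (sqrt (g t))))))"
    by (intro bdd_diff_mult bdd_diff_const r g'(2))
  ultimately show ?case
    unfolding bdd_diff.simps using b by (intro conjI exI) auto
qed

text \<open>Induction on the number n + 1 - k of derivatives still available; the top derivative is
  bounded but not assumed differentiable.\<close>

lemma vderiv_bdd_diff:
  assumes "strongly_admissible n xD" "1 \<le> k" "k \<le> n + 1"
  shows "bdd_diff (n + 1 - k) (\<lambda>t. vderiv k xD t $ i)"
  using assms(2,3)
proof (induction "n + 1 - k" arbitrary: k)
  have b: "\<exists>B. \<forall>t\<ge>0. \<bar>vderiv k xD t $ i\<bar> \<le> B" if "1 \<le> k" "k \<le> n + 1" for k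
  proof -
    have "bounded (vderiv k xD ` {0..})"
      using assms(1) that by (auto simp: strongly_admissible_def)
    then obtain B where "\<And>t. 0 \<le> t \<Longrightarrow> norm (vderiv k xD t) \<le> B"
      unfolding bounded_iff by auto
    then have "\<bar>vderiv k xD t $ i\<bar> \<le> B" if "0 \<le> t" for t
      using component_le_norm_cart[of "vderiv k xD t" i] that by (meson order.trans)
    then show ?thesis by blast
  qed
  { case 0 then show ?case using b by simp }
  case (Suc d)
  have diff: "vderiv k xD differentiable (at t within {0..})" if "0 \<le> t" for t
    using assms(1) that Suc(2,4)
    by (auto simp: strongly_admissible_def admissible_def Ck_halfline_def)
  have "((\<lambda>t. vderiv k xD t $ i) has_real_derivative vderiv (Suc k) xD t $ i) (at t within {0..})" if "0 \<le> t" for t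
  proof -
    have "(vderiv k xD has_vector_derivative vderiv (Suc k) xD t) (at t within {0..})"
      using diff[OF that] by (simp add: vector_derivative_works)
    from bounded_linear.has_vector_derivative[OF bounded_linear_vec_nth this]
    show ?thesis by (simp add: has_real_derivative_iff_has_vector_derivative)
  qed
  moreover have "bdd_diff d (\<lambda>t. vderiv (Suc k) xD t $ i)"
  proof -
    have e: "d = n + 1 - Suc k" "1 \<le> Suc k" "Suc k \<le> n + 1" using Suc(2,3,4) by auto
    show ?thesis using Suc(1)[OF e] unfolding e(1)[symmetric] .
  qed
  ultimately have "bdd_diff (Suc d) (\<lambda>t. vderiv k xD t $ i)"
    unfolding bdd_diff.simps
    by (intro conjI b[OF Suc.prems] exI[of _ "\<lambda>t. vderiv (Suc k) xD t $ i"]) (blast | assumption)+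
  then show ?case using Suc(2) by simp
qed

text \<open>
  If a curve has velocity \<open>v (cos \<theta>, sin \<theta>)\<close>, then the quotient \<open>\<theta>' / v\<close> is a polynomial in the components
  of the first two derivatives of the curve and in \<open>1 / |v|\<close>.
\<close>

lemma angle_derivative_bdd:
  assumes p1: "bdd_diff (Suc m) p1" and p2: "bdd_diff (Suc m) p2" and r: "bdd_diff (Suc m) r"
    and c: "\<And>t. 0 \<le> t \<Longrightarrow> cos (\<theta> t) = r t * p1 t" and s: "\<And>t. 0 \<le> t \<Longrightarrow> sin (\<theta> t) = r t * p2 t"
    and th: "\<And>t. 0 \<le> t \<Longrightarrow> (\<theta> has_real_derivative \<theta>' t) (at t within {0..})"
  shows "bdd_diff m \<theta>'"
proof -
  obtain p1' p2' r' where d: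
    "\<And>t. 0 \<le> t \<Longrightarrow> (p1 has_real_derivative p1' t) (at t within {0..})" "bdd_diff m p1'"
    "\<And>t. 0 \<le> t \<Longrightarrow> (p2 has_real_derivative p2' t) (at t within {0..})" "bdd_diff m p2'"
    "\<And>t. 0 \<le> t \<Longrightarrow> (r has_real_derivative r' t) (at t within {0..})" "bdd_diff m r'"
    using p1 p2 r by auto
  note low = bdd_diff_Suc_imp[OF p1] bdd_diff_Suc_imp[OF p2] bdd_diff_Suc_imp[OF r]
  define q1 where "q1 t = r' t * p1 t + p1' t * r t" for t
  define q2 where "q2 t = r' t * p2 t + p2' t * r t" for t
  \<comment> \<open>This is cos \<theta> (sin \<theta>)' - sin \<theta> (cos \<theta>)', which
    equals \<theta>' without division by a sine or cosine that may vanish.\<close>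
  have "bdd_diff m (\<lambda>t. r t * p1 t * q2 t + - 1 * (r t * p2 t * q1 t))"
    unfolding q1_def q2_def by (intro bdd_diff_add bdd_diff_mult bdd_diff_const low d)
  moreover have "r t * p1 t * q2 t + - 1 * (r t * p2 t * q1 t) = \<theta>' t" if t: "0 \<le> t" for t
  proof -
    have "((\<lambda>t. cos (\<theta> t)) has_real_derivative q1 t) (at t within {0..})"
      using DERIV_mult[OF d(5,1)[OF t]] c t unfolding q1_def
      by (intro has_field_derivative_transform_within[OF DERIV_mult[OF d(5,1)[OF t]], of 1]) auto
    moreover have "((\<lambda>t. cos (\<theta> t)) has_real_derivative - sin (\<theta> t) * \<theta>' t) (at t within {0..})"
      by (auto intro!: derivative_eq_intros th[OF t])
    ultimately have 1: "q1 t = - sin (\<theta> t) * \<theta>' t"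
      by (rule has_field_derivative_unique[OF _ _ halfline_not_bot[OF t]])
    have "((\<lambda>t. sin (\<theta> t)) has_real_derivative q2 t) (at t within {0..})"
      using s t unfolding q2_def
      by (intro has_field_derivative_transform_within[OF DERIV_mult[OF d(5,3)[OF t]], of 1]) auto
    moreover have "((\<lambda>t. sin (\<theta> t)) has_real_derivative cos (\<theta> t) * \<theta>' t) (at t within {0..})"
      by (auto intro!: derivative_eq_intros th[OF t])
    ultimately have 2: "q2 t = cos (\<theta> t) * \<theta>' t"
      by (rule has_field_derivative_unique[OF _ _ halfline_not_bot[OF t]])
    have "r t * p1 t * q2 t + - 1 * (r t * p2 t * q1 t) = ((sin (\<theta> t))\<^sup>2 + (cos (\<theta> t))\<^sup>2) * \<theta>' t"
      unfolding 1 2 c[OF t, symmetric] s[OF t, symmetric] by algebra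
    then show ?thesis by simp
  qed
  ultimately show ?thesis by (rule bdd_diff_cong)
qed

lemma sgn_constant:
  fixes f :: "real \<Rightarrow> real"
  assumes "continuous_on {0..} f" "\<And>t. 0 \<le> t \<Longrightarrow> f t \<noteq> 0" "0 \<le> t"
  shows "sgn (f t) = sgn (f 0)"
proof (rule ccontr)
  assume "sgn (f t) \<noteq> sgn (f 0)"
  then have "f 0 < 0 \<and> 0 < f t \<or> f t < 0 \<and> 0 < f 0"
    using assms(2)[of 0] assms(2)[OF assms(3)] by (auto simp: sgn_if split: if_splits)
  moreover have "continuous_on {0..t} f" by (rule continuous_on_subset[OF assms(1)]) auto
  ultimately obtain x where "0 \<le> x" "f x = 0"
    using IVT'[of f 0 0 t] IVT2'[of f t 0 0] assms(3) by (metis less_imp_le)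
  then show False using assms(2) by blast
qed

context flat_system
begin

lemma coords_along_solution:
  assumes sol: "solves_system Y A Om y1 h1 h2 J u q" and t: "t \<in> J"
  shows "((\<lambda>s. fst (q s) $ 1) has_real_derivative u t $ 1 * cos (y1 (snd (q t)))) (at t within J)"
    and "((\<lambda>s. fst (q s) $ 2) has_real_derivative u t $ 1 * sin (y1 (snd (q t)))) (at t within J)"
    and "Ck_fun 1 f \<Longrightarrow> ((\<lambda>s. f (snd (q s))) has_real_derivative
      u t $ 1 * lie_deriv A h1 f (snd (q t)) + u t $ 2 * lie_deriv A h2 f (snd (q t))) (at t within J)"
    and "i + 1 < DIM('e) \<Longrightarrow> ((\<lambda>s. \<phi> i (snd (q s))) has_real_derivative u t $ 1 * \<phi> (i + 1) (snd (q t))) (at t within J)"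
    and "i + 1 = DIM('e) \<Longrightarrow> ((\<lambda>s. \<phi> i (snd (q s))) has_real_derivative
      u t $ 1 * fn (snd (q t)) + u t $ 2 * gn (snd (q t))) (at t within J)"
proof -
  have Om: "snd (q t) \<in> Om" and cont: "continuous_map (top_of_set J) Y (snd \<circ> q)"
    and x: "((fst \<circ> q) has_vector_derivative u t $ 1 *\<^sub>R vector [cos (y1 (snd (q t))), sin (y1 (snd (q t)))]) (at t within J)"
    and y: "\<And>c. c \<in> A \<Longrightarrow> snd (q t) \<in> chart_dom c \<Longrightarrow> ((chart_map c \<circ> snd \<circ> q) has_vector_derivative
              u t $ 1 *\<^sub>R h1 c (snd (q t)) + u t $ 2 *\<^sub>R h2 c (snd (q t))) (at t within J)"
    using sol t by (auto simp: solves_system_def)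
  show "((\<lambda>s. fst (q s) $ 1) has_real_derivative u t $ 1 * cos (y1 (snd (q t)))) (at t within J)"
    "((\<lambda>s. fst (q s) $ 2) has_real_derivative u t $ 1 * sin (y1 (snd (q t)))) (at t within J)"
    using bounded_linear.has_vector_derivative[OF bounded_linear_vec_nth x, of 1]
      bounded_linear.has_vector_derivative[OF bounded_linear_vec_nth x, of 2]
    by (simp_all add: has_real_derivative_iff_has_vector_derivative)
  obtain c where c: "c \<in> A" "snd (q t) \<in> chart_dom c" using Om_chart[OF Om] .
  show f: "((\<lambda>s. f (snd (q s))) has_real_derivative
      u t $ 1 * lie_deriv A h1 f (snd (q t)) + u t $ 2 * lie_deriv A h2 f (snd (q t))) (at t within J)"
    if "Ck_fun 1 f" for f
    using lie_derivs_along_curve[OF that cont t, of c "u t $ 1" "u t $ 2"] Om c y[OF c] by (simp add: comp_assoc)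
  show "((\<lambda>s. \<phi> i (snd (q s))) has_real_derivative u t $ 1 * \<phi> (i + 1) (snd (q t))) (at t within J)"
    if i: "i + 1 < DIM('e)"
    using f[OF Ck_fun_phi_1[of i]] i rel_zero[OF _ Om, of i] by (simp add: Suc_eq_plus1[symmetric] del: Suc_eq_plus1)
  show "((\<lambda>s. \<phi> i (snd (q s))) has_real_derivative
      u t $ 1 * fn (snd (q t)) + u t $ 2 * gn (snd (q t))) (at t within J)"
    if i: "i + 1 = DIM('e)"
  proof -
    have i': "i = DIM('e) - 1" "DIM('e) = Suc i" using i by simp_all
    show ?thesis
      using f[OF Ck_fun_phi_1[of i]] unfolding fn_def gn_def i'(1)[symmetric] i'(2) by simp
  qed
qed

end

text \<open>Unfolds the nesting: a component keeps the form it received at its own level, with the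
  next entry of \<open>z\<close> in the place of \<zeta>.\<close>

lemma Bvec_components:
  "k < 2 \<Longrightarrow> 0 < i \<Longrightarrow> Bvec \<gamma> n w i z a \<zeta> k = Bvec \<gamma> n w 0 z a (z 2) k"
  "j + 1 < i \<Longrightarrow> Bvec \<gamma> n w i z a \<zeta> (j + 2) = bcoef \<gamma> n w (j + 1) z a + beta \<gamma> n w (j + 1) z a * z (j + 3)"
  "j + 1 = i \<Longrightarrow> Bvec \<gamma> n w i z a \<zeta> (j + 2) = bcoef \<gamma> n w i z a + beta \<gamma> n w i z a * \<zeta>"
proof -
  show "k < 2 \<Longrightarrow> 0 < i \<Longrightarrow> Bvec \<gamma> n w i z a \<zeta> k = Bvec \<gamma> n w 0 z a (z 2) k"
  proof (induction i arbitrary: \<zeta>)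
    case (Suc i)
    then show ?case by (cases i) (simp_all add: numeral_2_eq_2)
  qed simp
  show last: "Bvec \<gamma> n w i z a \<zeta> (j + 2) = bcoef \<gamma> n w i z a + beta \<gamma> n w i z a * \<zeta>"
    if "j + 1 = i" for i \<zeta>
    using that by (cases i) (auto simp: One_nat_def)
  show "j + 1 < i \<Longrightarrow> Bvec \<gamma> n w i z a \<zeta> (j + 2) = bcoef \<gamma> n w (j + 1) z a + beta \<gamma> n w (j + 1) z a * z (j + 3)"
  proof (induction i arbitrary: \<zeta>)
    case (Suc i)
    show ?case
    proof (cases "j + 1 = i")
      case True
      then show ?thesis using last[OF True, of "z (i + 2)"] by (auto simp: numeral_3_eq_3 One_nat_def)
    next
      case False
      then show ?thesis using Suc by simp
    qed
  qed simp
qed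

section \<open>The closed loop\<close>

text \<open>Neither \<open>a\<close> nor \<open>b\<close> is assumed to converge, so pointwise
  continuity of \<open>G\<close> would not suffice.\<close>

lemma tendsto_diagonal:
  fixes G :: "'a::metric_space \<times> 'a \<Rightarrow> real"
  assumes G: "continuous_on UNIV G" and K: "compact K"
    and a: "\<forall>\<^sub>F t in F. a t \<in> K" and b: "\<forall>\<^sub>F t in F. b t \<in> K"
    and ab: "((\<lambda>t. dist (a t) (b t)) \<longlongrightarrow> 0) F"
  shows "((\<lambda>t. G (a t, b t) - G (b t, b t)) \<longlongrightarrow> 0) F"
proof (rule tendstoI)
  fix \<epsilon> :: real assume e: "0 < \<epsilon>"
  have "uniformly_continuous_on (K \<times> K) G"
    by (intro compact_uniformly_continuous compact_Times K continuous_on_subset[OF G]) auto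
  then obtain \<eta> where \<eta>: "0 < \<eta>"
    "\<And>x x'. x \<in> K \<times> K \<Longrightarrow> x' \<in> K \<times> K \<Longrightarrow> dist x' x < \<eta> \<Longrightarrow> dist (G x') (G x) < \<epsilon>"
    using e unfolding uniformly_continuous_on_def by metis
  have "\<forall>\<^sub>F t in F. dist (a t) (b t) < \<eta>"
    using tendstoD[OF ab \<eta>(1)] by simp
  with a b show "\<forall>\<^sub>F t in F. dist (G (a t, b t) - G (b t, b t)) 0 < \<epsilon>"
  proof eventually_elim
    case (elim t)
    have "dist (a t, b t) (b t, b t) < \<eta>" using elim(3) by (simp add: dist_Pair_Pair)
    from \<eta>(2)[OF _ _ this] elim(1,2) show ?case by (simp add: dist_real_def)
  qed
qed

lemma bounded_times_tendsto_0:
  fixes f g :: "'a \<Rightarrow> real"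
  assumes "\<forall>\<^sub>F t in F. \<bar>f t\<bar> \<le> B" "(g \<longlongrightarrow> 0) F"
  shows "((\<lambda>t. f t * g t) \<longlongrightarrow> 0) F"
proof -
  have "\<forall>\<^sub>F t in F. norm (f t * g t) \<le> B * \<bar>g t\<bar>"
    using assms(1) by eventually_elim (simp add: abs_mult mult_right_mono)
  moreover have "((\<lambda>t. B * \<bar>g t\<bar>) \<longlongrightarrow> 0) F"
    by (rule tendsto_mult_right_zero[OF tendsto_rabs_zero[OF assms(2)]])
  ultimately show ?thesis by (rule Lim_null_comparison)
qed

text \<open>
  Sets the coordinate \<open>s\<^sub>1 = y\<^sub>1\<close>, the only one that may be unbounded, to zero.
\<close>

definition drop_line :: "'e::euclidean_space \<Rightarrow> 'e" where
  "drop_line v = v + (- (v \<bullet> basis_enum 0)) *\<^sub>R basis_enum 0"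

lemma drop_line_diff: "drop_line v - drop_line v' = drop_line (v - v')"
  by (simp add: drop_line_def inner_diff_left algebra_simps)

lemma drop_line_inner: "drop_line v \<bullet> b = v \<bullet> b - (v \<bullet> basis_enum 0) * (basis_enum 0 \<bullet> b)"
  by (simp add: drop_line_def inner_diff_left)

lemma norm_le_coords: "norm (v::'e::euclidean_space) \<le> (\<Sum>i<DIM('e). \<bar>v \<bullet> basis_enum i\<bar>)"
  by (subst eq_from_coords[of v, symmetric], unfold from_coords_def, rule order.trans[OF norm_sum])
    (auto intro!: sum_mono simp: basis_enum_in_Basis)

lemma norm_drop_line_le:
  fixes v :: "'e::euclidean_space"
  assumes "\<And>i. 0 < i \<Longrightarrow> i < DIM('e) \<Longrightarrow> \<bar>v \<bullet> basis_enum i\<bar> \<le> B" "0 \<le> B"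
  shows "norm (drop_line v) \<le> real DIM('e) * B"
proof -
  have "\<bar>drop_line v \<bullet> basis_enum i\<bar> \<le> B" if "i < DIM('e)" for i
    using assms that DIM_positive[where 'a = 'e]
    by (cases "i = 0") (auto simp: drop_line_inner inner_basis_enum)
  then have "(\<Sum>i<DIM('e). \<bar>drop_line v \<bullet> basis_enum i\<bar>) \<le> (\<Sum>i<DIM('e). B)"
    by (intro sum_mono) auto
  then show ?thesis using norm_le_coords[of "drop_line v"] by simp
qed

lemma norm_drop_line_tendsto_0:
  fixes v :: "_ \<Rightarrow> 'e::euclidean_space"
  assumes "\<And>i. i < DIM('e) \<Longrightarrow> ((\<lambda>t. v t \<bullet> basis_enum i) \<longlongrightarrow> 0) F"
  shows "((\<lambda>t. norm (drop_line (v t))) \<longlongrightarrow> 0) F"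
proof -
  have "((\<lambda>t. drop_line (v t) \<bullet> basis_enum i) \<longlongrightarrow> 0) F" if i: "i < DIM('e)" for i
  proof -
    have "((\<lambda>t. v t \<bullet> basis_enum i - (v t \<bullet> basis_enum 0) * (basis_enum 0 \<bullet> (basis_enum i :: 'e)))
        \<longlongrightarrow> 0 - 0 * (basis_enum 0 \<bullet> (basis_enum i :: 'e))) F"
      by (intro tendsto_intros assms i) simp
    then show ?thesis by (simp add: drop_line_inner)
  qed
  then have "((\<lambda>t. \<Sum>i<DIM('e). \<bar>drop_line (v t) \<bullet> basis_enum i\<bar>) \<longlongrightarrow> (\<Sum>i<DIM('e). 0)) F"
    by (intro tendsto_sum tendsto_rabs_zero) auto
  then have lim: "((\<lambda>t. \<Sum>i<DIM('e). \<bar>drop_line (v t) \<bullet> basis_enum i\<bar>) \<longlongrightarrow> 0) F" by simp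
  have "\<forall>t. norm (norm (drop_line (v t))) \<le> (\<Sum>i<DIM('e). \<bar>drop_line (v t) \<bullet> basis_enum i\<bar>)"
    by (simp add: norm_le_coords)
  then show ?thesis
    by (rule Lim_null_comparison[OF always_eventually lim])
qed

section \<open>A fixed reference trajectory and its bounds\<close>

locale reference = flat_system Y A h1 h2 Om Yc Ac e y1 pc
  for Y :: "'p topology" and A :: "('p, 'e::euclidean_space) chart set"
    and h1 h2 :: "('p, 'e) vfield"
    and Om :: "'p set" and Yc :: "'c topology" and Ac :: "('c, 'e) chart set"
    and e :: 'e and y1 :: "'p \<Rightarrow> real" and pc :: "'p \<Rightarrow> 'c" +
  fixes \<gamma> :: real and \<delta> :: "nat \<Rightarrow> real" and M :: "'p operator"
    and d :: "'p \<Rightarrow> 'p \<Rightarrow> real" and dc :: "'c \<Rightarrow> 'c \<Rightarrow> real"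
    and xD :: "real \<Rightarrow> real^2" and qD :: "real \<Rightarrow> (real^2) \<times> 'p" and uD :: "real \<Rightarrow> real^2"
  assumes gamma: "\<gamma> > 0" and delta: "\<And>i. i \<in> {1..DIM('e)} \<Longrightarrow> \<delta> i > 0"
    and man: "maneuvering_operator Y A Om y1 h1 h2 M"
    and metric: "Metric_space (topspace Yc) dc" and mtop: "Metric_space.mtopology (topspace Yc) dc = Yc"
    and d_eq: "\<And>y y'. y \<in> Om \<Longrightarrow> y' \<in> Om \<Longrightarrow> d y y' = \<bar>y1 y - y1 y'\<bar> + dc (pc y) (pc y')"
    and adm: "strongly_admissible DIM('e) xD" and MxD: "M xD = (qD, uD)"
begin

definition yD :: "real \<Rightarrow> 'p" where "yD t = snd (qD t)"
definition v1 :: "real \<Rightarrow> real" where "v1 t = uD t $ 1"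
definition v2 :: "real \<Rightarrow> real" where "v2 t = v1 t * fn (yD t) + uD t $ 2 * gn (yD t)"
definition w :: real where "w = sgn (v1 0)"
definition \<rho> :: "real \<Rightarrow> real" where "\<rho> t = \<bar>v1 t\<bar>"
text \<open>The last entry is the ratio of the transformed inputs. With it the equation of the last
  coordinate, whose derivative is \<open>v2\<close>, takes the same form as the others:
  \<open>v1\<close> times the next entry.\<close>

definition aD :: "real \<Rightarrow> nat \<Rightarrow> real" where
  "aD t j = (if j < DIM('e) then \<phi> j (yD t) else if j = DIM('e) then v2 t / v1 t else 0)"

lemma n_pos: "0 < DIM('e)" by simp

lemma qD_x: "\<And>t. 0 \<le> t \<Longrightarrow> fst (qD t) = xD t" and yD_Om: "\<And>t. 0 \<le> t \<Longrightarrow> yD t \<in> Om"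
    and uD_cont: "continuous_on {0..} uD" and qD_sol: "solves_system Y A Om y1 h1 h2 {0..} uD qD"
  using man adm MxD unfolding maneuvering_operator_def strongly_admissible_def yD_def by blast+

lemma velocity:
  assumes t: "0 \<le> t"
  shows "vderiv 1 xD t = v1 t *\<^sub>R vector [cos (y1 (yD t)), sin (y1 (yD t))]"
proof -
  have "((fst \<circ> qD) has_vector_derivative v1 t *\<^sub>R vector [cos (y1 (yD t)), sin (y1 (yD t))]) (at t within {0..})"
    using qD_sol t unfolding solves_system_def v1_def yD_def by simp
  then have "(xD has_vector_derivative v1 t *\<^sub>R vector [cos (y1 (yD t)), sin (y1 (yD t))]) (at t within {0..})"
    by (rule has_vector_derivative_transform[rotated 2]) (use t qD_x in auto)
  then show ?thesis
    unfolding One_nat_def vderiv.simps by (rule vector_derivative_within[OF halfline_not_bot[OF t]])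
qed

lemma norm_velocity: "0 \<le> t \<Longrightarrow> norm (vderiv 1 xD t) = \<rho> t"
proof -
  have "(v1 t * cos (y1 (yD t)))\<^sup>2 + (v1 t * sin (y1 (yD t)))\<^sup>2
      = (v1 t)\<^sup>2 * ((sin (y1 (yD t)))\<^sup>2 + (cos (y1 (yD t)))\<^sup>2)"
    by algebra
  then show "0 \<le> t \<Longrightarrow> ?thesis"
    unfolding velocity by (simp add: norm_vector_2 \<rho>_def)
qed

lemma rho_bounds: "\<exists>c C. 0 < c \<and> (\<forall>t\<ge>0. c \<le> \<rho> t \<and> \<rho> t \<le> C)"
proof -
  define c where "c = (INF t\<in>{0..}. norm (vderiv 1 xD t))"
  have c: "0 < c" using adm by (simp add: strongly_admissible_def admissible_def c_def)
  have "c \<le> \<rho> t" if "0 \<le> t" for t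
    unfolding c_def norm_velocity[OF that, symmetric] using that
    by (intro cINF_lower bdd_belowI[of _ 0]) auto
  moreover have "bounded (vderiv 1 xD ` {0..})"
    using adm unfolding strongly_admissible_def by (metis atLeastAtMost_iff le_add2 order_refl)
  then obtain C where "\<And>t. 0 \<le> t \<Longrightarrow> norm (vderiv 1 xD t) \<le> C"
    unfolding bounded_iff by auto
  then have "\<rho> t \<le> C" if "0 \<le> t" for t using norm_velocity[OF that] that by metis
  ultimately show ?thesis using c by blast
qed

lemma v1_nz: "0 \<le> t \<Longrightarrow> v1 t \<noteq> 0"
  using rho_bounds unfolding \<rho>_def by force

lemma v1_cont: "continuous_on {0..} v1"
  unfolding v1_def using uD_cont by (intro continuous_intros)

lemma sgn_v1: "0 \<le> t \<Longrightarrow> sgn (v1 t) = w"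
  unfolding w_def by (rule sgn_constant[OF v1_cont v1_nz])

lemma w_cases: "w = 1 \<or> w = -1"
  using v1_nz[of 0] by (auto simp: w_def sgn_if)

lemma rho_w: "0 \<le> t \<Longrightarrow> \<rho> t * w = v1 t"
  using sgn_v1[of t] mult_sgn_abs[of "v1 t"] by (simp add: \<rho>_def mult.commute)

lemma along_reference:
  "Ck_fun 1 f \<Longrightarrow> continuous_on {0..} (\<lambda>t. f (yD t))"
  unfolding yD_def
  by (rule DERIV_continuous_on[OF coords_along_solution(3)[OF qD_sol]])

lemma aD_deriv:
  assumes t: "0 \<le> t" and j: "j < DIM('e)"
  shows "((\<lambda>s. aD s j) has_real_derivative \<rho> t * w * aD t (j + 1)) (at t within {0..})"
proof (cases "j + 1 < DIM('e)")
  case True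
  then show ?thesis
    using coords_along_solution(4)[OF qD_sol _ True] t j
    by (simp add: rho_w aD_def v1_def yD_def)
next
  case False
  then have "j + 1 = DIM('e)" using j by simp
  from coords_along_solution(5)[OF qD_sol _ this] show ?thesis
    using t j False v1_nz[OF t] \<open>j + 1 = DIM('e)\<close> by (simp add: rho_w aD_def v1_def v2_def yD_def)
qed

lemma v2_cont: "continuous_on {0..} v2"
proof -
  have "continuous_on {0..} (\<lambda>t. uD t $ 2)" using uD_cont by (intro continuous_intros)
  then show ?thesis
    unfolding v2_def by (intro continuous_on_add continuous_on_mult v1_cont along_reference Ck_fun_fn_gn)
qed

lemma aD_cont: "continuous_on {0..} (\<lambda>t. aD t j)"
proof -
  consider "j < DIM('e)" | "j = DIM('e)" | "DIM('e) < j" by linarith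
  then show ?thesis
  proof cases
    case 1
    then show ?thesis using aD_deriv by (intro DERIV_continuous_on) auto
  next
    case 2
    then show ?thesis
      unfolding aD_def using v1_nz by (auto intro!: continuous_intros v2_cont v1_cont)
  next
    case 3
    then show ?thesis by (simp add: aD_def)
  qed
qed

text \<open>Entry \<open>j\<close> arises from the heading angle by \<open>j\<close>
  differentiations, each followed by division by \<open>v1\<close>, which leaves DIM - j bounded
  derivatives. The angle itself may be unbounded; therefore the claim starts at index 1.\<close>

lemma aD_bdd_diff:
  assumes "1 \<le> j" "j \<le> DIM('e)"
  shows "bdd_diff (DIM('e) - j) (\<lambda>t. aD t j)"
proof -
  define p1 where "p1 t = vderiv 1 xD t $ 1" for t
  define p2 where "p2 t = vderiv 1 xD t $ 2" for t
  have p: "bdd_diff DIM('e) p1" "bdd_diff DIM('e) p2"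
    using vderiv_bdd_diff[OF adm, of 1] unfolding p1_def p2_def by auto
  have pv: "p1 t = v1 t * cos (aD t 0)" "p2 t = v1 t * sin (aD t 0)" if "0 \<le> t" for t
    using velocity[OF that] n_pos by (simp_all add: p1_def p2_def aD_def)
  define g where "g t = p1 t * p1 t + p2 t * p2 t" for t
  have g: "g t = (\<rho> t)\<^sup>2" if "0 \<le> t" for t
  proof -
    have "g t = (v1 t)\<^sup>2 * ((sin (aD t 0))\<^sup>2 + (cos (aD t 0))\<^sup>2)"
      unfolding g_def pv[OF that] by algebra
    then show ?thesis by (simp add: \<rho>_def)
  qed
  obtain c C where c: "0 < c" "\<And>t. 0 \<le> t \<Longrightarrow> c \<le> \<rho> t" using rho_bounds by blast
  have gc: "c\<^sup>2 \<le> g t" if "0 \<le> t" for t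
    unfolding g[OF that] using c that by (intro power_mono) auto
  \<comment> \<open>This is 1 / \<open>v1\<close>. The input \<open>v1\<close> is only known to be
    continuous; written through the velocity components its reciprocal inherits their bounded
    derivatives.\<close>
  define r where "r t = w * inverse (sqrt (g t))" for t
  have "bdd_diff DIM('e) g"
    unfolding g_def by (intro bdd_diff_add bdd_diff_mult p)
  then have r: "bdd_diff DIM('e) r"
    unfolding r_def using c gc
    by (intro bdd_diff_mult bdd_diff_const bdd_diff_inverse_sqrt[of "c\<^sup>2"]) auto
  have rv: "r t * v1 t = 1" if "0 \<le> t" for t
  proof -
    have "r t * v1 t = (w * w) * (inverse (\<rho> t) * \<rho> t)"
      unfolding r_def g[OF that] rho_w[OF that, symmetric] by (simp add: \<rho>_def)
    then show ?thesis using c(1) c(2)[OF that] w_cases by auto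
  qed
  have low: "bdd_diff m r" if "m \<le> DIM('e)" for m
    using that r by (induction rule: inc_induct) (auto dest: bdd_diff_Suc_imp simp del: bdd_diff.simps)
  have der: "((\<lambda>s. aD s j) has_real_derivative v1 t * aD t (j + 1)) (at t within {0..})"
    if "0 \<le> t" "j < DIM('e)" for t j
    using aD_deriv[OF that] rho_w[OF that(1)] by simp
  have divide_speed: "bdd_diff m (\<lambda>t. aD t (j + 1))"
    if "bdd_diff m (\<lambda>t. v1 t * aD t (j + 1))" "m \<le> DIM('e)" for m j
  proof (rule bdd_diff_cong[OF bdd_diff_mult[OF low[OF that(2)] that(1)]])
    show "r t * (v1 t * aD t (j + 1)) = aD t (j + 1)" if "0 \<le> t" for t
      using rv[OF that] by (simp add: mult.assoc[symmetric])
  qed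
  show ?thesis
    using assms
  proof (induction j rule: dec_induct)
    case base
    obtain m where m: "DIM('e) = Suc m" using n_pos gr0_conv_Suc by blast
    have "bdd_diff m (\<lambda>t. v1 t * aD t (0 + 1))"
    proof (rule angle_derivative_bdd[of m p1 p2 r "\<lambda>t. aD t 0"])
      show "cos (aD t 0) = r t * p1 t" "sin (aD t 0) = r t * p2 t" if "0 \<le> t" for t
        unfolding pv[OF that] using rv[OF that] by (simp_all add: mult.assoc[symmetric])
      show "((\<lambda>t. aD t 0) has_real_derivative v1 t * aD t (0 + 1)) (at t within {0..})" if "0 \<le> t" for t
        by (rule der[OF that n_pos])
    qed (use p r in \<open>simp_all only: m\<close>)
    from divide_speed[OF this] m show ?case by (simp add: One_nat_def)
  next
    case (step j)
    then have IH: "bdd_diff (DIM('e) - j) (\<lambda>t. aD t j)" and j: "j < DIM('e)" by auto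
    have "DIM('e) - j = Suc (DIM('e) - Suc j)" using j by simp
    with IH have "bdd_diff (Suc (DIM('e) - Suc j)) (\<lambda>t. aD t j)" by simp
    from bdd_diff_derivative[OF this der[OF _ j]] have "bdd_diff (DIM('e) - Suc j) (\<lambda>t. v1 t * aD t (j + 1))" .
    from divide_speed[OF this] show ?case by (simp add: One_nat_def)
  qed
qed

lemma aD_abox: "\<exists>K\<ge>0. \<forall>t\<ge>0. aD t \<in> abox (DIM('e) + 1) K"
proof -
  have "\<exists>B. \<forall>t\<ge>0. \<bar>aD t j\<bar> \<le> B" if "1 \<le> j" "j \<le> DIM('e)" for j
    using bdd_diff_bounded[OF aD_bdd_diff[OF that]] .
  then obtain B where B: "\<And>j t. 1 \<le> j \<Longrightarrow> j \<le> DIM('e) \<Longrightarrow> 0 \<le> t \<Longrightarrow> \<bar>aD t j\<bar> \<le> B j"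
    by metis
  define K where "K = (\<Sum>j\<le>DIM('e). \<bar>B j\<bar>)"
  have "\<bar>aD t j\<bar> \<le> K" if "0 < j" "j < DIM('e) + 1" "0 \<le> t" for j t
  proof -
    have "\<bar>aD t j\<bar> \<le> \<bar>B j\<bar>" using B[of j t] that by simp
    also have "\<bar>B j\<bar> \<le> K" unfolding K_def using that by (intro member_le_sum) auto
    finally show ?thesis .
  qed
  then show ?thesis
    by (intro exI[of _ K]) (auto simp: abox_def K_def intro: sum_nonneg)
qed

lemma error_system_exists: "\<exists>c C K. 0 \<le> K \<and> error_system \<gamma> \<delta> DIM('e) w \<rho> aD c C K"
proof -
  obtain c C where c: "0 < c" "\<And>t. 0 \<le> t \<Longrightarrow> c \<le> \<rho> t" "\<And>t. 0 \<le> t \<Longrightarrow> \<rho> t \<le> C"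
    using rho_bounds by blast
  obtain K where K: "0 \<le> K" "\<And>t. 0 \<le> t \<Longrightarrow> aD t \<in> abox (DIM('e) + 1) K" using aD_abox by blast
  have "continuous_on {0..} \<rho>" unfolding \<rho>_def using v1_cont by (intro continuous_intros)
  then have "error_system \<gamma> \<delta> DIM('e) w \<rho> aD c C K"
    using gamma delta w_cases c K aD_deriv aD_cont by unfold_locales auto
  then show ?thesis using K by blast
qed

section \<open>Error coordinates and the control law in them\<close>

definition zc :: "(real^2) \<times> 'p \<Rightarrow> real \<Rightarrow> nat \<Rightarrow> real" where
  "zc q t = (\<lambda>k. if k = 0 then (fst q - fst (qD t)) $ 1 else if k = 1 then (fst q - fst (qD t)) $ 2
     else Smap A h1 y1 (snd q) (k - 2) - Smap A h1 y1 (yD t) (k - 2))"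

lemma zc_sigma: "i < DIM('e) \<Longrightarrow> zc q t (i + 2) = \<phi> i (snd q) - \<phi> i (yD t)"
  by (simp add: zc_def Smap_def)

abbreviation ctrl :: "real \<Rightarrow> (real^2) \<times> 'p \<Rightarrow> real^2" where
  "ctrl t q \<equiv> maneuvering_control_law A h1 h2 y1 \<gamma> \<delta> M t q xD"

lemma Fmat_eq: "Fmat A h1 h2 y1 y = vector [vector [1, 0], vector [fn y, gn y]]"
  by (simp add: Fmat_def fn_def gn_def)

lemma Fmat_inv:
  assumes "y \<in> Om"
  shows "matrix_inv (Fmat A h1 h2 y1 y) = vector [vector [1, 0], vector [- fn y / gn y, 1 / gn y]]"
  using gn_nonzero[OF assms] unfolding Fmat_eq
  by (intro matrix_inv_unique)
    (auto simp: matrix_matrix_mult_def vec_eq_iff forall_2 sum_2 mat_def field_simps)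

lemma ctrl_components:
  assumes t: "0 \<le> t" and y: "snd q \<in> Om"
  shows "ctrl t q $ 1 = \<rho> t * lam \<gamma> w (zc q t) (aD t)"
    and "ctrl t q $ 2 = (\<rho> t * alpha \<gamma> \<delta> DIM('e) w DIM('e) (zc q t) (aD t) + v2 t - fn (snd q) * ctrl t q $ 1) / gn (snd q)"
proof -
  have FuD: "Fmat A h1 h2 y1 (yD t) *v uD t = vector [v1 t, v2 t]"
    by (simp add: Fmat_eq vec_eq_iff forall_2 matrix_vector_mult_def sum_2 v1_def v2_def mult.commute)
  have F2: "F2mat A h1 h2 y1 (yD t) *v uD t = vector [0, v2 t]"
    unfolding F2mat_def matrix_vector_mul_assoc[symmetric] FuD
    by (simp add: vec_eq_iff forall_2 matrix_vector_mult_def sum_2)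
  have a: "(Smap A h1 y1 (yD t))(DIM('e) := v2 t / v1 t) = aD t"
    by (auto simp: Smap_def aD_def)
  have psi: "Psi \<gamma> \<delta> DIM('e) (fst q - fst (qD t)) (\<lambda>i. Smap A h1 y1 (snd q) i - Smap A h1 y1 (yD t) i)
      (Smap A h1 y1 (yD t)) (vector [v1 t, v2 t])
    = vector [lam \<gamma> w (zc q t) (aD t), alpha \<gamma> \<delta> DIM('e) w DIM('e) (zc q t) (aD t)]"
    unfolding Psi_def Let_def vector_2 a sgn_v1[OF t] zc_def by simp
  have eq: "ctrl t q = matrix_inv (Fmat A h1 h2 y1 (snd q)) *v
     (\<rho> t *\<^sub>R vector [lam \<gamma> w (zc q t) (aD t), alpha \<gamma> \<delta> DIM('e) w DIM('e) (zc q t) (aD t)] + vector [0, v2 t])"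
    unfolding maneuvering_control_law_def MxD Phi_def
    using psi FuD F2 by (simp add: case_prod_unfold yD_def \<rho>_def v1_def)
  show 1: "ctrl t q $ 1 = \<rho> t * lam \<gamma> w (zc q t) (aD t)"
    unfolding eq Fmat_inv[OF y] by (simp add: matrix_vector_mult_def sum_2)
  show "ctrl t q $ 2 = (\<rho> t * alpha \<gamma> \<delta> DIM('e) w DIM('e) (zc q t) (aD t) + v2 t - fn (snd q) * ctrl t q $ 1) / gn (snd q)"
    unfolding 1 unfolding eq Fmat_inv[OF y]
    by (simp add: matrix_vector_mult_def sum_2 diff_divide_distrib add_divide_distrib algebra_simps)
qed

text \<open>The left side is the second component of F(y) u, so the inverse of F in the control law
  cancels.\<close>

lemma ctrl_last:
  assumes "0 \<le> t" "snd q \<in> Om"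
  shows "ctrl t q $ 1 * fn (snd q) + ctrl t q $ 2 * gn (snd q)
    = \<rho> t * alpha \<gamma> \<delta> DIM('e) w DIM('e) (zc q t) (aD t) + v2 t"
  using ctrl_components(2)[OF assms] gn_nonzero[OF assms(2)] by (simp add: field_simps)

end

text \<open>The offset \<open>bcoef\<close> is what makes each row a difference of two velocities:
  multiplied by \<rho>, the factor \<open>lam\<close> becomes the actual first input and
  \<open>w\<close> the reference one, each acting on its own coordinate.\<close>

lemma Bvec_explicit:
  assumes "0 < n"
  shows "Bvec \<gamma> n w n z a \<zeta> 0 = lam \<gamma> w z a * cos (a 0 + z 2) - w * cos (a 0)"
    and "Bvec \<gamma> n w n z a \<zeta> 1 = lam \<gamma> w z a * sin (a 0 + z 2) - w * sin (a 0)"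
    and "i + 1 < n \<Longrightarrow> Bvec \<gamma> n w n z a \<zeta> (i + 2) = lam \<gamma> w z a * (a (i + 1) + z (i + 3)) - w * a (i + 1)"
    and "i + 1 = n \<Longrightarrow> Bvec \<gamma> n w n z a \<zeta> (i + 2) = \<zeta>"
proof -
  have b: "B0 \<gamma> w z a (z 2) $ 1 = lam \<gamma> w z a * cos (a 0 + z 2) - w * cos (a 0)"
    "B0 \<gamma> w z a (z 2) $ 2 = lam \<gamma> w z a * sin (a 0 + z 2) - w * sin (a 0)"
    by (simp_all add: B0_def rot_def matrix_vector_mult_def sum_2 cos_add sin_add)
  show "Bvec \<gamma> n w n z a \<zeta> 0 = lam \<gamma> w z a * cos (a 0 + z 2) - w * cos (a 0)"
    "Bvec \<gamma> n w n z a \<zeta> 1 = lam \<gamma> w z a * sin (a 0 + z 2) - w * sin (a 0)"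
    using Bvec_components(1)[OF _ assms, of 0] Bvec_components(1)[OF _ assms, of 1] b by simp_all
  show "i + 1 < n \<Longrightarrow> Bvec \<gamma> n w n z a \<zeta> (i + 2) = lam \<gamma> w z a * (a (i + 1) + z (i + 3)) - w * a (i + 1)"
    using Bvec_components(2)[of i n] by (simp add: bcoef_def beta_def algebra_simps)
  show "i + 1 = n \<Longrightarrow> Bvec \<gamma> n w n z a \<zeta> (i + 2) = \<zeta>"
    using Bvec_components(3)[of i n] by (simp add: bcoef_def beta_def)
qed

lemma less_add_2_cases:
  fixes k n :: nat
  assumes "k < n + 2"
  obtains "k = 0" | "k = 1" | i where "k = i + 2" "i + 1 < n" | i where "k = i + 2" "i + 1 = n"
proof -
  have "k = 0 \<or> k = 1 \<or> k = (k - 2) + 2 \<and> ((k - 2) + 1 < n \<or> (k - 2) + 1 = n)"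
    using assms by linarith
  then show ?thesis using that by blast
qed

context reference
begin

lemma error_derivative:
  assumes sol: "solves_system Y A Om y1 h1 h2 J (\<lambda>t. ctrl t (q t)) q" and J: "J \<subseteq> {0..}" and t: "t \<in> J"
    and k: "k < DIM('e) + 2"
  shows "((\<lambda>s. zc (q s) s k) has_real_derivative \<rho> t * error_field \<gamma> \<delta> DIM('e) w (zc (q t) t) (aD t) k) (at t within J)"
proof -
  have t0: "0 \<le> t" and t0': "t \<in> {0..}" using J t by auto
  have Om: "snd (q t) \<in> Om" using sol t by (simp add: solves_system_def)
  define u where "u = ctrl t (q t)"
  define z where "z = zc (q t) t"
  have u1: "u $ 1 = \<rho> t * lam \<gamma> w z (aD t)"
    using ctrl_components(1)[OF t0 Om] by (simp add: u_def z_def)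
  have a0: "aD t 0 = y1 (yD t)" using n_pos by (simp add: aD_def)
  have z2: "aD t 0 + z 2 = y1 (snd (q t))"
    using zc_sigma[OF n_pos, of "q t" t] unfolding add_0 by (simp add: z_def a0)
  have rw: "v1 t = \<rho> t * w" using rho_w[OF t0] by simp
  note qs = coords_along_solution[OF sol t, folded u_def]
  note rs = coords_along_solution[OF qD_sol t0', folded v1_def yD_def, THEN DERIV_subset[OF _ J]]
  from k show ?thesis
  proof (cases rule: less_add_2_cases)
    case 1
    have "((\<lambda>s. fst (q s) $ 1 - fst (qD s) $ 1) has_real_derivative
        u $ 1 * cos (y1 (snd (q t))) - v1 t * cos (y1 (yD t))) (at t within J)"
      by (intro DERIV_diff qs(1) DERIV_subset[OF coords_along_solution(1)[OF qD_sol t0', folded v1_def yD_def] J])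
    then show ?thesis
      unfolding 1 error_field_def Bvec_explicit(1)[OF n_pos] z_def[symmetric] z2
      by (simp add: zc_def u1 a0 rw right_diff_distrib mult.assoc)
  next
    case 2
    have "((\<lambda>s. fst (q s) $ 2 - fst (qD s) $ 2) has_real_derivative
        u $ 1 * sin (y1 (snd (q t))) - v1 t * sin (y1 (yD t))) (at t within J)"
      by (intro DERIV_diff qs(2) DERIV_subset[OF coords_along_solution(2)[OF qD_sol t0', folded v1_def yD_def] J])
    then show ?thesis
      unfolding 2 error_field_def Bvec_explicit(2)[OF n_pos] z_def[symmetric] z2
      by (simp add: zc_def u1 a0 rw right_diff_distrib mult.assoc)
  next
    case (3 i)
    have i: "i < DIM('e)" "i + 1 < DIM('e)" using 3 by simp_all
    have "((\<lambda>s. \<phi> i (snd (q s)) - \<phi> i (yD s)) has_real_derivative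
        u $ 1 * \<phi> (i + 1) (snd (q t)) - v1 t * \<phi> (i + 1) (yD t)) (at t within J)"
      using DERIV_subset[OF coords_along_solution(4)[OF qD_sol t0' i(2), folded v1_def yD_def] J]
      unfolding yD_def by (intro DERIV_diff qs(4)[OF i(2)])
    moreover have "aD t (i + 1) = \<phi> (i + 1) (yD t)" using i by (simp add: aD_def)
    moreover have "aD t (i + 1) + z (i + 3) = \<phi> (i + 1) (snd (q t))"
      using zc_sigma[OF i(2), of "q t" t] calculation(2) by (simp add: z_def numeral_3_eq_3 numeral_2_eq_2 One_nat_def)
    ultimately show ?thesis
      unfolding 3(1) error_field_def Bvec_explicit(3)[OF n_pos i(2)] zc_sigma[OF i(1)] z_def[symmetric]
      by (simp only: u1 rw right_diff_distrib mult.assoc)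
  next
    case (4 i)
    have i: "i < DIM('e)" "i + 1 = DIM('e)" using 4 by simp_all
    have "((\<lambda>s. \<phi> i (snd (q s)) - \<phi> i (yD s)) has_real_derivative
        (u $ 1 * fn (snd (q t)) + u $ 2 * gn (snd (q t))) - v2 t) (at t within J)"
      using DERIV_subset[OF coords_along_solution(5)[OF qD_sol t0' i(2), folded v1_def yD_def] J]
      unfolding yD_def v2_def by (intro DERIV_diff qs(5)[OF i(2)])
    then show ?thesis
      unfolding 4(1) error_field_def Bvec_explicit(4)[OF n_pos i(2)] zc_sigma[OF i(1)] u_def ctrl_last[OF t0 Om]
      by simp
  qed
qed

text \<open>Solutions of the error system are prescribed in the first DIM + 2 entries only; the
  feedback must not see any other entry of the tuple.\<close>

lemma zc_cong:
  assumes "\<And>k. k < DIM('e) + 2 \<Longrightarrow> z k = z' k"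
  shows "lam \<gamma> w z a = lam \<gamma> w z' a" "alpha \<gamma> \<delta> DIM('e) w DIM('e) z a = alpha \<gamma> \<delta> DIM('e) w DIM('e) z' a" "k < DIM('e) + 2 \<Longrightarrow> error_field \<gamma> \<delta> DIM('e) w z a k = error_field \<gamma> \<delta> DIM('e) w z' a k"
proof -
  interpret chained_feedback \<gamma> \<delta> "DIM('e)" w
    using gamma delta w_cases by unfold_locales auto
  show "alpha \<gamma> \<delta> DIM('e) w DIM('e) z a = alpha \<gamma> \<delta> DIM('e) w DIM('e) z' a"
    by (rule smooth_cong_coords[OF smooth_alpha]) (use assms in auto)
  show "lam \<gamma> w z a = lam \<gamma> w z' a"
    by (rule smooth_cong_coords[OF smooth_lam[of "DIM('e) + 2" 1]]) (use assms in auto)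
  show "k < DIM('e) + 2 \<Longrightarrow> error_field \<gamma> \<delta> DIM('e) w z a k = error_field \<gamma> \<delta> DIM('e) w z' a k"
    unfolding error_field_def
    by (rule smooth_cong_coords[OF smooth_Bvec[OF _ _ smooth_alpha[of "DIM('e)"]]]) (use assms in auto)
qed

text \<open>Converse of \<open>error_derivative\<close>: as \<open>Sv\<close> is onto, the
  coordinates obtained by adding the errors to the reference belong to a curve in \<open>Om\<close>,
  and \<open>T\<close> supplies it. Existence for the closed loop is thereby reduced to the error
  system.\<close>

lemma lift_error_solution:
  assumes Z: "\<And>t k. 0 \<le> t \<Longrightarrow> k < DIM('e) + 2 \<Longrightarrow>
      ((\<lambda>s. Z s k) has_real_derivative \<rho> t * error_field \<gamma> \<delta> DIM('e) w (Z t) (aD t) k) (at t within {0..})"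
  defines "q \<equiv> \<lambda>t. (fst (qD t) + vector [Z t 0, Z t 1], T (from_coords (\<lambda>i. Z t (i + 2) + aD t i)))"
  shows "solves_system Y A Om y1 h1 h2 {0..} (\<lambda>t. ctrl t (q t)) q"
    and "\<And>t k. 0 \<le> t \<Longrightarrow> k < DIM('e) + 2 \<Longrightarrow> zc (q t) t k = Z t k"
proof -
  define s where "s t = (from_coords (\<lambda>i. Z t (i + 2) + aD t i) :: 'e)" for t
  have q: "q t = (fst (qD t) + vector [Z t 0, Z t 1], T (s t))" for t by (simp add: q_def s_def)
  have phi: "\<phi> i (T (s t)) = Z t (i + 2) + aD t i" if "i < DIM('e)" for i t
    using Sv_inner[OF that, of "T (s t)"] from_coords_inner[OF that, of "\<lambda>i. Z t (i + 2) + aD t i"]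
    by (simp add: s_def)
  show zc: "zc (q t) t k = Z t k" if "0 \<le> t" "k < DIM('e) + 2" for t k
  proof -
    have "k = 0 \<or> k = 1 \<or> (\<exists>i<DIM('e). k = i + 2)"
    proof (cases "k < 2")
      case False
      then have "k - 2 < DIM('e)" "k = (k - 2) + 2" using that(2) by linarith+
      then show ?thesis by blast
    qed auto
    then show ?thesis
    proof (elim disjE exE conjE)
      fix i assume i: "i < DIM('e)" "k = i + 2"
      then show ?thesis
        unfolding i(2) zc_sigma[OF i(1)] by (simp add: q phi[OF i(1)] aD_def)
    qed (simp_all add: zc_def q)
  qed
  have Om: "snd (q t) \<in> Om" for t by (simp add: q)
  show "solves_system Y A Om y1 h1 h2 {0..} (\<lambda>t. ctrl t (q t)) q"
    unfolding solves_system_def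
  proof (intro conjI ballI impI)
    fix t :: real
    show "snd (q t) \<in> Om" by (rule Om)
  next
    have "continuous_on {0..} (\<lambda>t. Z t (i + 2) + aD t i)" if "i < DIM('e)" for i
      by (intro continuous_on_add aD_cont DERIV_continuous_on[OF Z]) (use that in auto)
    then have "continuous_on {0..} s"
      unfolding s_def from_coords_def
      by (intro continuous_on_sum continuous_on_scaleR continuous_on_const) simp
    then have "continuous_map (top_of_set {0..}) euclidean s" by simp
    from continuous_map_compose[OF this T_continuous]
    show "continuous_map (top_of_set {0..}) Y (snd \<circ> q)" by (simp add: q comp_def)
  next
    fix t :: real assume "t \<in> {0..}"
    then have t: "0 \<le> t" by simp
    define u where "u = ctrl t (q t)"
    have u1: "u $ 1 = \<rho> t * lam \<gamma> w (Z t) (aD t)"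
      using ctrl_components(1)[OF t Om] zc_cong(1)[of "zc (q t) t" "Z t"] zc[OF t] by (simp add: u_def)
    have ul: "u $ 1 * fn (T (s t)) + u $ 2 * gn (T (s t)) = \<rho> t * alpha \<gamma> \<delta> DIM('e) w DIM('e) (Z t) (aD t) + v2 t"
      using ctrl_last[OF t Om] zc_cong(2)[of "zc (q t) t" "Z t"] zc[OF t] by (simp add: u_def q)
    have rw: "\<rho> t * w = v1 t" by (rule rho_w[OF t])
    have y0: "aD t 0 + Z t 2 = y1 (T (s t))" using phi[OF n_pos, of t] unfolding add_0 by simp
    have a0: "aD t 0 = y1 (yD t)" using n_pos by (simp add: aD_def)
    have x1: "((\<lambda>s. fst (qD s) $ 1 + Z s 0) has_real_derivative u $ 1 * cos (y1 (T (s t)))) (at t within {0..})"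
    proof -
      have "((\<lambda>s. fst (qD s) $ 1 + Z s 0) has_real_derivative
          uD t $ 1 * cos (y1 (snd (qD t))) + \<rho> t * error_field \<gamma> \<delta> DIM('e) w (Z t) (aD t) 0) (at t within {0..})"
        using t by (intro DERIV_add coords_along_solution(1)[OF qD_sol] Z) auto
      then show ?thesis
        unfolding error_field_def Bvec_explicit(1)[OF n_pos] y0
        by (simp add: u1 a0 v1_def[symmetric] yD_def[symmetric] rw[symmetric] algebra_simps)
    qed
    have x2: "((\<lambda>s. fst (qD s) $ 2 + Z s 1) has_real_derivative u $ 1 * sin (y1 (T (s t)))) (at t within {0..})"
    proof -
      have "((\<lambda>s. fst (qD s) $ 2 + Z s 1) has_real_derivative
          uD t $ 1 * sin (y1 (snd (qD t))) + \<rho> t * error_field \<gamma> \<delta> DIM('e) w (Z t) (aD t) 1) (at t within {0..})"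
        using t by (intro DERIV_add coords_along_solution(2)[OF qD_sol] Z) auto
      then show ?thesis
        unfolding error_field_def Bvec_explicit(2)[OF n_pos] y0
        by (simp add: u1 a0 v1_def[symmetric] yD_def[symmetric] rw[symmetric] algebra_simps)
    qed
    have "((\<lambda>s. (fst (qD s) $ 1 + Z s 0) *\<^sub>R axis 1 1 + (fst (qD s) $ 2 + Z s 1) *\<^sub>R axis 2 1 :: real^2)
        has_vector_derivative
        (u $ 1 * cos (y1 (T (s t)))) *\<^sub>R axis 1 1 + (u $ 1 * sin (y1 (T (s t)))) *\<^sub>R axis 2 1) (at t within {0..})"
      by (intro has_vector_derivative_add bounded_linear.has_vector_derivative[OF bounded_linear_scaleR_left]
          x1[unfolded has_real_derivative_iff_has_vector_derivative]
          x2[unfolded has_real_derivative_iff_has_vector_derivative])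
    moreover have "(fst (qD s) $ 1 + Z s 0) *\<^sub>R axis 1 1 + (fst (qD s) $ 2 + Z s 1) *\<^sub>R axis 2 1 = (fst \<circ> q) s" for s
      by (simp add: q vec_eq_iff forall_2 axis_def)
    moreover have "(u $ 1 * cos (y1 (T (s t)))) *\<^sub>R axis 1 1 + (u $ 1 * sin (y1 (T (s t)))) *\<^sub>R axis 2 1
        = u $ 1 *\<^sub>R (vector [cos (y1 (snd (q t))), sin (y1 (snd (q t)))] :: real^2)"
      by (simp add: q vec_eq_iff forall_2 axis_def)
    ultimately show "((fst \<circ> q) has_vector_derivative
        ctrl t (q t) $ 1 *\<^sub>R vector [cos (y1 (snd (q t))), sin (y1 (snd (q t)))]) (at t within {0..})"
      by (simp add: u_def comp_def)
    fix c assume c: "c \<in> A" and dom: "snd (q t) \<in> chart_dom c"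
    have coord: "((\<lambda>s. Z s (i + 2) + aD s i) has_real_derivative
        u $ 1 * lie_deriv A h1 (\<phi> i) (T (s t)) + u $ 2 * lie_deriv A h2 (\<phi> i) (T (s t))) (at t within {0..})"
      if i: "i < DIM('e)" for i
    proof -
      have d: "((\<lambda>s. Z s (i + 2) + aD s i) has_real_derivative
          \<rho> t * error_field \<gamma> \<delta> DIM('e) w (Z t) (aD t) (i + 2) + \<rho> t * w * aD t (i + 1)) (at t within {0..})"
        using t i by (intro DERIV_add Z aD_deriv) auto
      have "i + 1 < DIM('e) \<or> i + 1 = DIM('e)" using i by linarith
      then show ?thesis
      proof
        assume i1: "i + 1 < DIM('e)"
        have "lie_deriv A h2 (\<phi> i) (T (s t)) = 0" using rel_zero[of i "T (s t)"] i1 by simp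
        moreover have "lie_deriv A h1 (\<phi> i) (T (s t)) = Z t (i + 3) + aD t (i + 1)"
          using phi[OF i1, of t] by (simp add: numeral_3_eq_3 numeral_2_eq_2 One_nat_def)
        ultimately show ?thesis
          using d unfolding error_field_def Bvec_explicit(3)[OF n_pos i1] by (simp add: u1 algebra_simps)
      next
        assume i1: "i + 1 = DIM('e)"
        have "i = DIM('e) - 1" "DIM('e) = Suc i" using i1 by simp_all
        then have f: "fn = lie_deriv A h1 (\<phi> i)" "gn = lie_deriv A h2 (\<phi> i)"
          by (simp_all add: fn_def gn_def)
        have "\<rho> t * w * aD t (i + 1) = v2 t"
          using v1_nz[OF t] by (simp add: rw aD_def i1)
        then show ?thesis
          using d ul unfolding error_field_def Bvec_explicit(4)[OF n_pos i1] f by simp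
      qed
    qed
    have "(s has_vector_derivative from_coords (\<lambda>i. u $ 1 * lie_deriv A h1 (\<phi> i) (T (s t)) +
        u $ 2 * lie_deriv A h2 (\<phi> i) (T (s t)))) (at t within {0..})"
      unfolding s_def[abs_def] from_coords_def
    proof (rule has_vector_derivative_sum)
      fix i assume "i \<in> {..<DIM('e)}"
      then have "((\<lambda>s. Z s (i + 2) + aD s i) has_vector_derivative
        u $ 1 * lie_deriv A h1 (\<phi> i) (T (s t)) + u $ 2 * lie_deriv A h2 (\<phi> i) (T (s t))) (at t within {0..})"
        using coord by (simp add: has_real_derivative_iff_has_vector_derivative)
      from bounded_linear.has_vector_derivative[OF bounded_linear_scaleR_left this, of "basis_enum i :: 'e"]
      show "((\<lambda>s. (Z s (i + 2) + aD s i) *\<^sub>R (basis_enum i :: 'e)) has_vector_derivative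
        (u $ 1 * lie_deriv A h1 (\<phi> i) (T (\<Sum>i<DIM('e). (Z t (i + 2) + aD t i) *\<^sub>R basis_enum i)) +
         u $ 2 * lie_deriv A h2 (\<phi> i) (T (\<Sum>i<DIM('e). (Z t (i + 2) + aD t i) *\<^sub>R basis_enum i))) *\<^sub>R basis_enum i)
        (at t within {0..})"
        by (simp add: s_def from_coords_def)
    qed
    from T_lifts_curve[OF c _ \<open>t \<in> {0..}\<close> this] dom
    show "((chart_map c \<circ> snd \<circ> q) has_vector_derivative
        ctrl t (q t) $ 1 *\<^sub>R h1 c (snd (q t)) + ctrl t (q t) $ 2 *\<^sub>R h2 c (snd (q t))) (at t within {0..})"
      by (simp add: q u_def comp_def)
  qed
qed

text \<open>\<open>Vf\<close> does not increase, so the errors stay in one box while the reference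
  parameters stay in \<open>abox\<close>. Only the second component of F(y) u is bounded here;
  passing to the second input divides by \<open>gn\<close>, which needs the compactness argument of
  \<open>invariant_function_tendsto\<close>.\<close>

lemma closed_loop_bounds:
  assumes sol: "solves_system Y A Om y1 h1 h2 {0..} (\<lambda>t. ctrl t (q t)) q"
  shows "\<exists>B. \<forall>t\<ge>0. \<bar>\<rho> t\<bar> \<le> B \<and> \<bar>v2 t\<bar> \<le> B \<and> \<bar>ctrl t (q t) $ 1\<bar> \<le> B \<and>
      \<bar>\<rho> t * alpha \<gamma> \<delta> DIM('e) w DIM('e) (zc (q t) t) (aD t) + v2 t\<bar> \<le> B \<and>
      drop_line (Sv (snd (q t))) \<in> cball 0 B \<and> drop_line (Sv (yD t)) \<in> cball 0 B"
proof -
  obtain c C K where K: "0 \<le> K" and es: "error_system \<gamma> \<delta> DIM('e) w \<rho> aD c C K"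
    using error_system_exists by blast
  interpret E: error_system \<gamma> \<delta> "DIM('e)" w \<rho> aD c C K by (rule es)
  define z where "z t = zc (q t) t" for t
  have Om: "snd (q t) \<in> Om" if "0 \<le> t" for t using sol that by (simp add: solves_system_def)
  have zsol: "E.sol {0..} z"
    unfolding E.sol_def z_def using error_derivative[OF sol] by simp
  obtain R where R: "0 \<le> R" "\<And>y b. b \<in> abox (DIM('e) + 1) K \<Longrightarrow>
      V \<gamma> \<delta> DIM('e) w DIM('e) y b \<le> V \<gamma> \<delta> DIM('e) w DIM('e) (z 0) (aD 0) \<Longrightarrow> y \<in> zbox (DIM('e) + 2) R"
    using E.V_bounded_imp_zbox by blast
  have zb: "z t \<in> zbox (DIM('e) + 2) R" and ab: "aD t \<in> abox (DIM('e) + 1) K" if t: "0 \<le> t" for t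
  proof -
    show "aD t \<in> abox (DIM('e) + 1) K" by (rule E.a_box[OF t])
    then show "z t \<in> zbox (DIM('e) + 2) R"
      by (rule R(2)[OF _ E.V_le_along_sol[OF zsol _ _ t]]) auto
  qed
  obtain B1 where B1: "\<And>y b. y \<in> zbox (DIM('e) + 2) R \<Longrightarrow> b \<in> abox (DIM('e) + 1) K \<Longrightarrow>
      \<bar>alpha \<gamma> \<delta> DIM('e) w DIM('e) y b\<bar> \<le> B1"
    using smooth_bounded[OF E.smooth_alpha, where R = R and K = K] by blast
  have "smooth (DIM('e) + 2) (DIM('e) + 1) (lam \<gamma> w)" by (rule E.smooth_lam) auto
  from smooth_bounded[OF this, of R K] obtain B2 where B2: "\<And>y b. y \<in> zbox (DIM('e) + 2) R \<Longrightarrow>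
      b \<in> abox (DIM('e) + 1) K \<Longrightarrow> \<bar>lam \<gamma> w y b\<bar> \<le> B2"
    by blast
  have rho: "\<bar>\<rho> t\<bar> \<le> C" if "0 \<le> t" for t using E.rho_le[OF that] by (simp add: \<rho>_def)
  have C: "0 \<le> C" using E.C_pos by simp
  have v2: "\<bar>v2 t\<bar> \<le> C * K" if t: "0 \<le> t" for t
  proof -
    have "\<bar>aD t DIM('e)\<bar> \<le> K" using ab[OF t] by (auto simp: abox_def)
    moreover have "v2 t = v1 t * aD t DIM('e)" using v1_nz[OF t] by (simp add: aD_def)
    ultimately show ?thesis
      using rho[OF t] C by (simp add: \<rho>_def abs_mult mult_mono)
  qed
  have u1: "\<bar>ctrl t (q t) $ 1\<bar> \<le> C * B2" if t: "0 \<le> t" for t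
    unfolding ctrl_components(1)[OF t Om[OF t]] z_def[symmetric] abs_mult
    using rho[OF t] C B2[OF zb[OF t] ab[OF t]] by (intro mult_mono) auto
  have al: "\<bar>\<rho> t * alpha \<gamma> \<delta> DIM('e) w DIM('e) (z t) (aD t) + v2 t\<bar> \<le> C * B1 + C * K" if t: "0 \<le> t" for t
  proof -
    have "\<bar>\<rho> t * alpha \<gamma> \<delta> DIM('e) w DIM('e) (z t) (aD t)\<bar> \<le> C * B1"
      unfolding abs_mult using rho[OF t] C B1[OF zb[OF t] ab[OF t]] by (intro mult_mono) auto
    then show ?thesis using v2[OF t] by linarith
  qed
  have Si: "Sv (yD t) \<bullet> basis_enum i = aD t i" "Sv (snd (q t)) \<bullet> basis_enum i = z t (i + 2) + aD t i"
    if "i < DIM('e)" for i t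
    using zc_sigma[OF that, of "q t" t] that by (simp_all add: Sv_inner aD_def z_def)
  have r1: "norm (drop_line (Sv (yD t))) \<le> real DIM('e) * (R + K)" if t: "0 \<le> t" for t
  proof (rule norm_drop_line_le)
    fix i assume "0 < i" "i < DIM('e)"
    then have "\<bar>aD t i\<bar> \<le> K" using ab[OF t] by (auto simp: abox_def)
    then show "\<bar>Sv (yD t) \<bullet> basis_enum i\<bar> \<le> R + K"
      using Si(1)[OF \<open>i < DIM('e)\<close>, of t] R(1) by linarith
  qed (use R(1) K in simp)
  have r2: "norm (drop_line (Sv (snd (q t)))) \<le> real DIM('e) * (R + K)" if t: "0 \<le> t" for t
  proof (rule norm_drop_line_le)
    fix i assume i: "0 < i" "i < DIM('e)"
    then have "\<bar>aD t i\<bar> \<le> K" using ab[OF t] by (auto simp: abox_def)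
    moreover have "\<bar>z t (i + 2)\<bar> \<le> R" using zb[OF t] i by (auto simp: zbox_def)
    ultimately show "\<bar>Sv (snd (q t)) \<bullet> basis_enum i\<bar> \<le> R + K"
      using Si(2)[OF \<open>i < DIM('e)\<close>, of t] by linarith
  qed (use R(1) K in simp)
  define B where "B = max (max C (C * K)) (max (max (C * B2) (C * B1 + C * K)) (real DIM('e) * (R + K)))"
  have "C \<le> B" "C * K \<le> B" "C * B2 \<le> B" "C * B1 + C * K \<le> B" "real DIM('e) * (R + K) \<le> B"
    unfolding B_def by simp_all
  then show ?thesis
    using rho v2 u1 al r1 r2 unfolding z_def mem_cball_0 by (intro exI[of _ B]) (meson order.trans)
qed

section \<open>Limits along the closed loop\<close>

lemma closed_loop_error_limits:
  assumes sol: "solves_system Y A Om y1 h1 h2 {0..} (\<lambda>t. ctrl t (q t)) q"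
  shows "k < DIM('e) + 2 \<Longrightarrow> ((\<lambda>t. zc (q t) t k) \<longlongrightarrow> 0) at_top"
    and "((\<lambda>t. alpha \<gamma> \<delta> DIM('e) w DIM('e) (zc (q t) t) (aD t)) \<longlongrightarrow> 0) at_top"
    and "((\<lambda>t. lam \<gamma> w (zc (q t) t) (aD t)) \<longlongrightarrow> w) at_top"
proof -
  obtain c C K where es: "error_system \<gamma> \<delta> DIM('e) w \<rho> aD c C K"
    using error_system_exists by blast
  interpret E: error_system \<gamma> \<delta> "DIM('e)" w \<rho> aD c C K by (rule es)
  have "E.sol {0..} (\<lambda>t. zc (q t) t)"
    unfolding E.sol_def using error_derivative[OF sol] by simp
  from E.sol_limit[OF this] show "k < DIM('e) + 2 \<Longrightarrow> ((\<lambda>t. zc (q t) t k) \<longlongrightarrow> 0) at_top"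
    "((\<lambda>t. alpha \<gamma> \<delta> DIM('e) w DIM('e) (zc (q t) t) (aD t)) \<longlongrightarrow> 0) at_top"
    "((\<lambda>t. lam \<gamma> w (zc (q t) t) (aD t)) \<longlongrightarrow> w) at_top"
    by simp_all
qed

text \<open>Invariance under \<open>drop_line\<close> moves both arguments into one closed ball,
  where uniform continuity is available although \<open>y1\<close> may escape to infinity.\<close>

lemma invariant_tendsto:
  fixes G :: "'e \<times> 'e \<Rightarrow> real"
  assumes sol: "solves_system Y A Om y1 h1 h2 {0..} (\<lambda>t. ctrl t (q t)) q"
    and G: "continuous_on UNIV G" and inv: "\<And>v v'. G (drop_line v, drop_line v') = G (v, v')"
  shows "((\<lambda>t. G (Sv (snd (q t)), Sv (yD t)) - G (Sv (yD t), Sv (yD t))) \<longlongrightarrow> 0) at_top"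
proof -
  obtain B where B: "\<And>t. 0 \<le> t \<Longrightarrow> drop_line (Sv (snd (q t))) \<in> cball 0 B \<and> drop_line (Sv (yD t)) \<in> cball 0 B"
    using closed_loop_bounds[OF sol] by blast
  have "((\<lambda>t. norm (drop_line (Sv (snd (q t)) - Sv (yD t)))) \<longlongrightarrow> 0) at_top"
  proof (rule norm_drop_line_tendsto_0)
    fix i assume i: "i < DIM('e)"
    have "((\<lambda>t. zc (q t) t (i + 2)) \<longlongrightarrow> 0) at_top"
      using closed_loop_error_limits(1)[OF sol, of "i + 2"] i by simp
    then show "((\<lambda>t. (Sv (snd (q t)) - Sv (yD t)) \<bullet> basis_enum i) \<longlongrightarrow> 0) at_top"
      by (simp only: zc_sigma[OF i] inner_diff_left Sv_inner[OF i])
  qed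
  then have "((\<lambda>t. dist (drop_line (Sv (snd (q t)))) (drop_line (Sv (yD t)))) \<longlongrightarrow> 0) at_top"
    by (simp add: dist_norm drop_line_diff)
  moreover have "\<forall>\<^sub>F t in at_top. drop_line (Sv (snd (q t))) \<in> cball 0 B"
    using eventually_ge_at_top[of 0] by eventually_elim (use B in blast)
  moreover have "\<forall>\<^sub>F t in at_top. drop_line (Sv (yD t)) \<in> cball 0 B"
    using eventually_ge_at_top[of 0] by eventually_elim (use B in blast)
  ultimately have "((\<lambda>t. G (drop_line (Sv (snd (q t))), drop_line (Sv (yD t))) - G (drop_line (Sv (yD t)), drop_line (Sv (yD t)))) \<longlongrightarrow> 0) at_top"
    by (intro tendsto_diagonal[OF G compact_cball])
  then show ?thesis unfolding inv .
qed

lemma drop_line_T: "pc (T (drop_line v)) = pc (T v)"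
  unfolding drop_line_def by (rule T_translate)

text \<open>The distance of the projections, read in flat coordinates, ignores the line coordinate
  and vanishes on the diagonal.\<close>

lemma dc_tendsto:
  assumes sol: "solves_system Y A Om y1 h1 h2 {0..} (\<lambda>t. ctrl t (q t)) q"
  shows "((\<lambda>t. dc (pc (snd (q t))) (pc (yD t))) \<longlongrightarrow> 0) at_top"
proof -
  interpret Metric_space "topspace Yc" dc by (rule metric)
  define G where "G = (\<lambda>p::'e \<times> 'e. dc (pc (T (fst p))) (pc (T (snd p))))"
  have P: "continuous_map euclidean (mtopology_of (metric (topspace Yc, dc))) (\<lambda>s. pc (T s))"
    using pc_T_continuous by (simp add: mtop)
  have f: "continuous_map (euclidean :: ('e \<times> 'e) topology) euclidean fst"
    "continuous_map (euclidean :: ('e \<times> 'e) topology) euclidean snd"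
    by (simp_all add: continuous_on_fst continuous_on_snd)
  have "continuous_map euclidean euclidean
      (\<lambda>p. mdist (metric (topspace Yc, dc)) (((\<lambda>s. pc (T s)) \<circ> fst) p) (((\<lambda>s. pc (T s)) \<circ> snd) p))"
    by (rule continuous_map_mdist[OF continuous_map_compose[OF f(1) P] continuous_map_compose[OF f(2) P]])
  then have "continuous_on UNIV G" by (simp add: G_def)
  from invariant_tendsto[OF sol this] have
    "((\<lambda>t. G (Sv (snd (q t)), Sv (yD t)) - G (Sv (yD t), Sv (yD t))) \<longlongrightarrow> 0) at_top"
    by (simp add: G_def drop_line_T)
  moreover have "\<forall>\<^sub>F t in at_top. G (Sv (snd (q t)), Sv (yD t)) - G (Sv (yD t), Sv (yD t))
      = dc (pc (snd (q t))) (pc (yD t))"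
    using eventually_ge_at_top[of 0]
  proof eventually_elim
    case (elim t)
    have "T (Sv (snd (q t))) = snd (q t)"
      using sol elim by (intro T_Sv) (simp add: solves_system_def)
    moreover have "T (Sv (yD t)) = yD t" using T_Sv[OF yD_Om[OF elim]] .
    moreover have "pc (yD t) \<in> topspace Yc" using T_in_topspace[of "Sv (yD t)"] calculation(2) by simp
    ultimately show ?case by (simp add: G_def)
  qed
  ultimately show ?thesis by (rule Lim_transform_eventually)
qed

lemma invariant_function_tendsto:
  fixes H :: "'e \<Rightarrow> real"
  assumes sol: "solves_system Y A Om y1 h1 h2 {0..} (\<lambda>t. ctrl t (q t)) q"
    and H: "continuous_on UNIV H" and inv: "\<And>v. H (drop_line v) = H v"
  shows "((\<lambda>t. H (Sv (snd (q t))) - H (Sv (yD t))) \<longlongrightarrow> 0) at_top"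
    and "\<exists>B. \<forall>t\<ge>0. \<bar>H (Sv (snd (q t)))\<bar> \<le> B \<and> \<bar>H (Sv (yD t))\<bar> \<le> B"
proof -
  have "continuous_on UNIV (\<lambda>p::'e \<times> 'e. H (fst p))"
    by (intro continuous_on_compose2[OF H] continuous_intros) auto
  from invariant_tendsto[OF sol this]
  show "((\<lambda>t. H (Sv (snd (q t))) - H (Sv (yD t))) \<longlongrightarrow> 0) at_top"
    by (simp add: inv)
  obtain B where B: "\<And>t. 0 \<le> t \<Longrightarrow> drop_line (Sv (snd (q t))) \<in> cball 0 B \<and> drop_line (Sv (yD t)) \<in> cball 0 B"
    using closed_loop_bounds[OF sol] by blast
  have "bounded (H ` cball 0 B)"
    by (intro compact_imp_bounded compact_continuous_image continuous_on_subset[OF H]) auto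
  then obtain B' where B': "\<forall>x\<in>H ` cball 0 B. norm x \<le> B'"
    unfolding bounded_iff by blast
  have "\<bar>H (Sv (snd (q t)))\<bar> \<le> B' \<and> \<bar>H (Sv (yD t))\<bar> \<le> B'" if "0 \<le> t" for t
    using B'[rule_format, OF imageI, of "drop_line (Sv (snd (q t)))"] B'[rule_format, OF imageI, of "drop_line (Sv (yD t))"]
      B[OF that] by (simp only: inv real_norm_def simp_thms)
  then show "\<exists>B. \<forall>t\<ge>0. \<bar>H (Sv (snd (q t)))\<bar> \<le> B \<and> \<bar>H (Sv (yD t))\<bar> \<le> B" by blast
qed

lemma closed_loop_limits:
  assumes sol: "solves_system Y A Om y1 h1 h2 {0..} (\<lambda>t. ctrl t (q t)) q"
  shows "((\<lambda>t. fst (q t) - xD t) \<longlongrightarrow> 0) at_top"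
    and "((\<lambda>t. d (snd (q t)) (yD t)) \<longlongrightarrow> 0) at_top"
    and "((\<lambda>t. ctrl t (q t) - uD t) \<longlongrightarrow> 0) at_top"
    and "bounded ((\<lambda>t. ctrl t (q t)) ` {0..})"
proof -
  have Om: "snd (q t) \<in> Om" if "0 \<le> t" for t using sol that by (simp add: solves_system_def)
  note lim = closed_loop_error_limits[OF sol]
  have "((\<lambda>t. fst (q t) - fst (qD t)) \<longlongrightarrow> 0) at_top"
  proof (rule vec_tendstoI)
    fix i :: 2
    have "i = 1 \<or> i = 2" by (rule exhaust_2)
    then show "((\<lambda>t. (fst (q t) - fst (qD t)) $ i) \<longlongrightarrow> 0 $ i) at_top"
      using lim(1)[of 0] lim(1)[of 1] by (auto simp: zc_def)
  qed
  then show "((\<lambda>t. fst (q t) - xD t) \<longlongrightarrow> 0) at_top"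
    by (rule Lim_transform_eventually) (rule eventually_mono[OF eventually_ge_at_top[of 0]], simp add: qD_x)
  have "((\<lambda>t. zc (q t) t 2) \<longlongrightarrow> 0) at_top"
    using lim(1)[of 2] n_pos by simp
  then have "((\<lambda>t. y1 (snd (q t)) - y1 (yD t)) \<longlongrightarrow> 0) at_top"
    using zc_sigma[OF n_pos] unfolding add_0 by simp
  then have "((\<lambda>t. \<bar>y1 (snd (q t)) - y1 (yD t)\<bar> + dc (pc (snd (q t))) (pc (yD t))) \<longlongrightarrow> 0 + 0) at_top"
    by (intro tendsto_add tendsto_rabs_zero dc_tendsto[OF sol])
  then have "((\<lambda>t. \<bar>y1 (snd (q t)) - y1 (yD t)\<bar> + dc (pc (snd (q t))) (pc (yD t))) \<longlongrightarrow> 0) at_top"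
    by simp
  then show "((\<lambda>t. d (snd (q t)) (yD t)) \<longlongrightarrow> 0) at_top"
    by (rule Lim_transform_eventually)
      (rule eventually_mono[OF eventually_ge_at_top[of 0]], simp add: d_eq Om yD_Om)
  \<comment> \<open>\<open>ig\<close> and \<open>fg\<close> are, up to sign, the entries of the
    inverse of F in flat coordinates. Hypothesis C makes them independent of the line coordinate, so
    they are bounded along both trajectories and their differences tend to 0.\<close>
  define ig where "ig v = inverse (gn (T v))" for v
  define fg where "fg v = fn (T v) * inverse (gn (T v))" for v
  have cont: "continuous_on UNIV ig" "continuous_on UNIV fg"
  proof -
    have "continuous_on UNIV (\<lambda>v. fn (T v))" "continuous_on UNIV (\<lambda>v. gn (T v))"
      by (intro Ck_fun_T_continuous Ck_fun_fn_gn)+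
    then show "continuous_on UNIV ig" "continuous_on UNIV fg"
      unfolding ig_def fg_def
      by (intro continuous_on_inverse continuous_on_mult; simp add: gn_nonzero)+
  qed
  have inv: "ig (drop_line v) = ig v" "fg (drop_line v) = fg v" for v
    unfolding ig_def fg_def drop_line_def line_invariant_T_translate[OF line_invariant_fn_gn(1)] line_invariant_T_translate[OF line_invariant_fn_gn(2)]
    by simp_all
  define al where "al t = alpha \<gamma> \<delta> DIM('e) w DIM('e) (zc (q t) t) (aD t)" for t
  define s where "s t = Sv (snd (q t))" for t
  define sD where "sD t = Sv (yD t)" for t
  define u where "u t = ctrl t (q t)" for t
  have u2: "u t $ 2 = ig (s t) * (\<rho> t * al t + v2 t) - fg (s t) * u t $ 1" if t: "0 \<le> t" for t
    unfolding u_def ctrl_components(2)[OF t Om[OF t]] ig_def fg_def s_def T_Sv[OF Om[OF t]] al_def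
    by (simp add: divide_inverse algebra_simps)
  have uD2: "uD t $ 2 = ig (sD t) * v2 t - fg (sD t) * v1 t" if t: "0 \<le> t" for t
    unfolding ig_def fg_def sD_def T_Sv[OF yD_Om[OF t]] v2_def
    using gn_nonzero[OF yD_Om[OF t]] by (simp add: field_simps)
  obtain B where B: "\<And>t. 0 \<le> t \<Longrightarrow> \<bar>\<rho> t\<bar> \<le> B \<and> \<bar>v2 t\<bar> \<le> B \<and> \<bar>u t $ 1\<bar> \<le> B \<and> \<bar>\<rho> t * al t + v2 t\<bar> \<le> B"
    using closed_loop_bounds[OF sol] unfolding u_def al_def by blast
  obtain B1 where B1: "\<And>t. 0 \<le> t \<Longrightarrow> \<bar>ig (s t)\<bar> \<le> B1"
    using invariant_function_tendsto(2)[OF sol cont(1) inv(1)] unfolding s_def by blast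
  obtain B2 where B2: "\<And>t. 0 \<le> t \<Longrightarrow> \<bar>fg (s t)\<bar> \<le> B2 \<and> \<bar>fg (sD t)\<bar> \<le> B2"
    using invariant_function_tendsto(2)[OF sol cont(2) inv(2)] unfolding s_def sD_def by blast
  have "\<bar>u t $ 2\<bar> \<le> B1 * B + B2 * B" if t: "0 \<le> t" for t
  proof -
    have "\<bar>ig (s t) * (\<rho> t * al t + v2 t)\<bar> \<le> B1 * B" "\<bar>fg (s t) * u t $ 1\<bar> \<le> B2 * B"
      unfolding abs_mult using B[OF t] B1[OF t] B2[OF t]
      by (auto intro!: mult_mono intro: order.trans[OF abs_ge_zero])
    then show ?thesis unfolding u2[OF t] by linarith
  qed
  then have "norm (u t) \<le> B + (B1 * B + B2 * B)" if "0 \<le> t" for t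
    using norm_le_l1_cart[of "u t"] B[OF that] that by (fastforce simp: sum_2)
  then show "bounded ((\<lambda>t. ctrl t (q t)) ` {0..})"
    unfolding u_def by (intro boundedI) auto
  have ev: "\<forall>\<^sub>F t in at_top. \<bar>f t\<bar> \<le> B'" if "\<And>t. 0 \<le> t \<Longrightarrow> \<bar>f t\<bar> \<le> B'" for f :: "real \<Rightarrow> real" and B'
    using eventually_ge_at_top[of 0] by eventually_elim (rule that)
  have d1: "((\<lambda>t. \<rho> t * (lam \<gamma> w (zc (q t) t) (aD t) - w)) \<longlongrightarrow> 0) at_top"
    using B by (intro bounded_times_tendsto_0[OF ev[of _ B]] LIM_zero lim(3)) auto
  have u1: "\<rho> t * (lam \<gamma> w (zc (q t) t) (aD t) - w) = u t $ 1 - v1 t" if t: "0 \<le> t" for t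
    unfolding u_def ctrl_components(1)[OF t Om[OF t]] rho_w[OF t, symmetric] by (simp add: algebra_simps)
  have d1': "((\<lambda>t. u t $ 1 - v1 t) \<longlongrightarrow> 0) at_top"
    by (rule Lim_transform_eventually[OF d1]) (rule eventually_mono[OF eventually_ge_at_top[of 0]], rule u1)
  have t1: "((\<lambda>t. ig (s t) * (\<rho> t * al t)) \<longlongrightarrow> 0) at_top"
    using B B1 lim(2) by (intro bounded_times_tendsto_0[OF ev[of _ B1]] bounded_times_tendsto_0[OF ev[of _ B]]) (auto simp: al_def)
  have t2: "((\<lambda>t. v2 t * (ig (s t) - ig (sD t))) \<longlongrightarrow> 0) at_top"
    using B invariant_function_tendsto(1)[OF sol cont(1) inv(1)]
    by (intro bounded_times_tendsto_0[OF ev[of _ B]]) (auto simp: s_def sD_def)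
  have t3: "((\<lambda>t. u t $ 1 * (fg (s t) - fg (sD t))) \<longlongrightarrow> 0) at_top"
    using B invariant_function_tendsto(1)[OF sol cont(2) inv(2)]
    by (intro bounded_times_tendsto_0[OF ev[of _ B]]) (auto simp: s_def sD_def)
  have t4: "((\<lambda>t. fg (sD t) * (u t $ 1 - v1 t)) \<longlongrightarrow> 0) at_top"
    using B2 d1' by (intro bounded_times_tendsto_0[OF ev[of _ B2]]) auto
  \<comment> \<open>The difference of the second inputs is split so that every product has one
    bounded factor and one factor tending to 0; neither the reference nor its inputs need
    converge.\<close>
  have d2: "((\<lambda>t. ig (s t) * (\<rho> t * al t) + v2 t * (ig (s t) - ig (sD t)) - u t $ 1 * (fg (s t) - fg (sD t))
      - fg (sD t) * (u t $ 1 - v1 t)) \<longlongrightarrow> 0) at_top"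
    using tendsto_diff[OF tendsto_diff[OF tendsto_add[OF t1 t2] t3] t4] by simp
  have d2': "((\<lambda>t. u t $ 2 - uD t $ 2) \<longlongrightarrow> 0) at_top"
  proof (rule Lim_transform_eventually[OF d2])
    show "\<forall>\<^sub>F t in at_top. ig (s t) * (\<rho> t * al t) + v2 t * (ig (s t) - ig (sD t))
      - u t $ 1 * (fg (s t) - fg (sD t)) - fg (sD t) * (u t $ 1 - v1 t) = u t $ 2 - uD t $ 2"
      using eventually_ge_at_top[of 0]
      by eventually_elim (simp add: u2 uD2 algebra_simps)
  qed
  show "((\<lambda>t. ctrl t (q t) - uD t) \<longlongrightarrow> 0) at_top"
  proof (rule vec_tendstoI)
    fix i :: 2
    have "i = 1 \<or> i = 2" by (rule exhaust_2)
    then show "((\<lambda>t. (ctrl t (q t) - uD t) $ i) \<longlongrightarrow> 0 $ i) at_top"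
      using d1' d2' by (auto simp: u_def v1_def)
  qed
qed

lemma closed_loop_exists:
  assumes "q0 \<in> UNIV \<times> Om"
  shows "\<exists>q. q 0 = q0 \<and> solves_system Y A Om y1 h1 h2 {0..} (\<lambda>t. ctrl t (q t)) q"
proof -
  obtain c C K where es: "error_system \<gamma> \<delta> DIM('e) w \<rho> aD c C K"
    using error_system_exists by blast
  interpret E: error_system \<gamma> \<delta> "DIM('e)" w \<rho> aD c C K by (rule es)
  \<comment> \<open>Two position errors and one error for each coordinate of the manifold: this
    product type is a concrete Euclidean space of the dimension required for the existence
    theorem.\<close>
  have "DIM(real \<times> real \<times> 'e) = DIM('e) + 2" by simp
  from E.sol_exists[OF this, of "zc q0 0"] obtain Z where
    Z0: "\<And>k. k < DIM('e) + 2 \<Longrightarrow> Z 0 k = zc q0 0 k" and Z: "E.sol {0..} Z" by blast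
  define q where "q t = (fst (qD t) + vector [Z t 0, Z t 1], T (from_coords (\<lambda>i. Z t (i + 2) + aD t i)))" for t
  have sol: "solves_system Y A Om y1 h1 h2 {0..} (\<lambda>t. ctrl t (q t)) q"
    using lift_error_solution(1)[of Z] Z unfolding E.sol_def q_def[abs_def] by simp
  have "fst (q 0) = fst q0"
    using Z0[of 0] Z0[of 1] by (simp add: q_def zc_def vec_eq_iff forall_2)
  moreover have "snd (q 0) = snd q0"
  proof -
    have "(from_coords (\<lambda>i. Z 0 (i + 2) + aD 0 i) :: 'e) = Sv (snd q0)"
      unfolding Sv_def
      by (rule from_coords_cong) (simp only: Z0 zc_sigma add_less_cancel_right aD_def if_True diff_add_cancel)
    then show ?thesis using T_Sv[of "snd q0"] assms by (auto simp: q_def)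
  qed
  ultimately have "q 0 = q0" by (rule prod_eqI)
  with sol show ?thesis by blast
qed

text \<open>The error coordinates determine the state, since \<open>Sv\<close> is injective on
  \<open>Om\<close>; uniqueness is inherited from the error system.\<close>

lemma closed_loop_unique:
  assumes q: "solves_system Y A Om y1 h1 h2 {0..} (\<lambda>t. ctrl t (q t)) q"
    and q': "solves_system Y A Om y1 h1 h2 {0..<b} (\<lambda>t. ctrl t (q' t)) q'"
    and init: "q' 0 = q 0" and t: "t \<in> {0..<b}"
  shows "q' t = q t"
proof -
  obtain c C K where es: "error_system \<gamma> \<delta> DIM('e) w \<rho> aD c C K"
    using error_system_exists by blast
  interpret E: error_system \<gamma> \<delta> "DIM('e)" w \<rho> aD c C K by (rule es)
  have Om: "snd (q t) \<in> Om" "snd (q' t) \<in> Om"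
    using q q' t by (auto simp: solves_system_def)
  have J: "{0..<b} \<subseteq> {0..}" by auto
  have "E.sol {0..} (\<lambda>t. zc (q t) t)" "E.sol {0..<b} (\<lambda>t. zc (q' t) t)"
    unfolding E.sol_def using error_derivative[OF q] error_derivative[OF q' J] by simp_all
  note sols = this
  have eq: "zc (q' t) t k = zc (q t) t k" if "k < DIM('e) + 2" for k
    by (rule E.sol_unique[OF sols(2) E.sol_subset[OF sols(1) J] J _ _ _ that])
      (use t init in auto)
  have "fst (q' t) = fst (q t)"
    using eq[of 0] eq[of 1] by (simp add: zc_def vec_eq_iff forall_2)
  moreover have "Sv (snd (q' t)) = Sv (snd (q t))"
    unfolding Sv_def
  proof (rule from_coords_cong)
    fix i assume "i < DIM('e)"
    then show "\<phi> i (snd (q' t)) = \<phi> i (snd (q t))"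
      using eq[of "i + 2"] zc_sigma[of i "q' t" t] zc_sigma[of i "q t" t] by simp
  qed
  then have "snd (q' t) = snd (q t)" using T_Sv Om by metis
  ultimately show ?thesis by (rule prod_eqI)
qed

end

theorem theorem3:
  fixes Y :: "'p topology" and A :: "('p, 'e::euclidean_space) chart set"
    and h1 h2 :: "('p, 'e) vfield"
    and Om :: "'p set" and Yc :: "'c topology" and Ac :: "('c, 'e) chart set"
    and e :: 'e and y1 :: "'p \<Rightarrow> real" and pc :: "'p \<Rightarrow> 'c"
    and M :: "'p operator"
    and d :: "'p \<Rightarrow> 'p \<Rightarrow> real" and dc :: "'c \<Rightarrow> 'c \<Rightarrow> real"
    and \<gamma> :: real and \<delta> :: "nat \<Rightarrow> real"
  assumes "smooth_manifold (UNIV :: 'e set) Y A"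
    and "Ck_vector_field DIM('e) A h1" and "Ck_vector_field DIM('e) A h2"
    and "\<gamma> > 0" and "\<And>i. i \<in> {1..DIM('e)} \<Longrightarrow> \<delta> i > 0"
    \<comment> \<open>A\<close>
    and "line_splitting Y A Om Yc Ac e y1 pc"
    and "\<And>i y. i + 2 \<le> DIM('e) \<Longrightarrow> y \<in> Om \<Longrightarrow> lie_deriv A h2 ((lie_deriv A h1 ^^ i) y1) y = 0"
    and "\<And>y. y \<in> Om \<Longrightarrow> lie_deriv A h2 ((lie_deriv A h1 ^^ (DIM('e) - 1)) y1) y \<noteq> 0"
    and "bij_betw (Smap A h1 y1) Om (topspace (Euclidean_space DIM('e)))"
    and "maneuvering_operator Y A Om y1 h1 h2 M"
    \<comment> \<open>B\<close>
    and "Metric_space (topspace Yc) dc" and "Metric_space.mtopology (topspace Yc) dc = Yc"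
    and "\<And>y y'. y \<in> Om \<Longrightarrow> y' \<in> Om \<Longrightarrow> d y y' = \<bar>y1 y - y1 y'\<bar> + dc (pc y) (pc y')"
    \<comment> \<open>C\<close>
    and "independent_of_line_coordinate Om Ac e y1 pc h1"
    and "independent_of_line_coordinate Om Ac e y1 pc h2"
  shows "stabilizes_point_trajectories Y A Om y1 h1 h2 d M
           (maneuvering_control_law A h1 h2 y1 \<gamma> \<delta> M) \<and>
         (\<forall>xD q. strongly_admissible DIM('e) xD \<and>
            closed_loop_solution Y A Om y1 h1 h2
              (maneuvering_control_law A h1 h2 y1 \<gamma> \<delta> M) xD {0..} q \<longrightarrow>
            bounded ((\<lambda>t. maneuvering_control_law A h1 h2 y1 \<gamma> \<delta> M t (q t) xD) ` {0..}))"
proof -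
  have flat: "flat_system Y A h1 h2 Om Yc Ac e y1 pc"
    using assms(1-3,6-9,14,15) by unfold_locales
  have ref: "reference Y A h1 h2 Om Yc Ac e y1 pc \<gamma> \<delta> M d dc xD qD uD"
    if "strongly_admissible DIM('e) xD" "M xD = (qD, uD)" for xD qD uD
    using flat assms(4,5,10-13) that by (intro reference.intro reference_axioms.intro)
  show ?thesis
  proof (intro conjI allI impI)
    show "stabilizes_point_trajectories Y A Om y1 h1 h2 d M (maneuvering_control_law A h1 h2 y1 \<gamma> \<delta> M)"
      unfolding stabilizes_point_trajectories_def closed_loop_solution_def
    proof (intro allI impI ballI)
      fix xD uD :: "real \<Rightarrow> real^2" and qD :: "real \<Rightarrow> (real^2) \<times> 'p" and q0 :: "(real^2) \<times> 'p"
      assume "strongly_admissible DIM('e) xD \<and> M xD = (qD, uD)" and q0: "q0 \<in> UNIV \<times> Om"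
      then interpret R: reference Y A h1 h2 Om Yc Ac e y1 pc \<gamma> \<delta> M d dc xD qD uD
        by (intro ref) auto
      obtain q where q: "q 0 = q0"
        "solves_system Y A Om y1 h1 h2 {0..} (\<lambda>t. maneuvering_control_law A h1 h2 y1 \<gamma> \<delta> M t (q t) xD) q"
        using R.closed_loop_exists[OF q0] by blast
      have unique: "q' t = q t" if "solves_system Y A Om y1 h1 h2 {0..<T}
            (\<lambda>t. maneuvering_control_law A h1 h2 y1 \<gamma> \<delta> M t (q' t) xD) q' \<and> q' 0 = q0" "t \<in> {0..<T}" for T q' t
        using R.closed_loop_unique[OF q(2), of T q' t] that q(1) by simp
      show "\<exists>q. q 0 = q0 \<and>
        solves_system Y A Om y1 h1 h2 {0..} (\<lambda>t. maneuvering_control_law A h1 h2 y1 \<gamma> \<delta> M t (q t) xD) q \<and>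
        (\<forall>T>0. \<forall>q'. solves_system Y A Om y1 h1 h2 {0..<T}
            (\<lambda>t. maneuvering_control_law A h1 h2 y1 \<gamma> \<delta> M t (q' t) xD) q' \<and> q' 0 = q0 \<longrightarrow>
          (\<forall>t\<in>{0..<T}. q' t = q t)) \<and>
        ((\<lambda>t. fst (q t) - xD t) \<longlongrightarrow> 0) at_top \<and>
        ((\<lambda>t. d (snd (q t)) (snd (qD t))) \<longlongrightarrow> 0) at_top \<and>
        ((\<lambda>t. maneuvering_control_law A h1 h2 y1 \<gamma> \<delta> M t (q t) xD - uD t) \<longlongrightarrow> 0) at_top"
        using R.closed_loop_limits[OF q(2)] unfolding R.yD_def
        by (intro exI[of _ q] conjI q allI impI ballI) (rule unique, assumption+)+
    qed
  next
    fix xD :: "real \<Rightarrow> real^2" and q :: "real \<Rightarrow> (real^2) \<times> 'p"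
    assume a: "strongly_admissible DIM('e) xD \<and> closed_loop_solution Y A Om y1 h1 h2
       (maneuvering_control_law A h1 h2 y1 \<gamma> \<delta> M) xD {0..} q"
    obtain qD uD where "M xD = (qD, uD)" by (cases "M xD")
    with a interpret R: reference Y A h1 h2 Om Yc Ac e y1 pc \<gamma> \<delta> M d dc xD qD uD
      by (intro ref) auto
    show "bounded ((\<lambda>t. maneuvering_control_law A h1 h2 y1 \<gamma> \<delta> M t (q t) xD) ` {0..})"
      using R.closed_loop_limits(4) a by (simp add: closed_loop_solution_def)
  qed
qed

end
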